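(* Let $f\in\mathbb{C}[x_1,\dots,x_{N+1}]$, $G=\langle g\rangle\cong\mathbb{Z}/2\mathbb{Z}$ and $\bar f$ be as described in the context. There is an isomorphism of algebras $\psi:\mathrm{Jac}(\bar f)\to\mathrm{Jac}(f,G)$, given by $$\psi([x_i])=\begin{cases}[x_i]\,\xi_{\mathrm{id}},& i\ne1,N+1,\\ [x_1^2]\,\xi_{\mathrm{id}},& i=1,\\ \xi_g,& i=N+1.\end{cases}$$
   Context: A polynomial is non-degenerate if the common zero set of its partial derivatives is exactly $\{0\}$. $\mathrm{Jac}(h)$ is the polynomial ring modulo the ideal of partial derivatives of $h$. Graphs. For a map $\kappa$ of a finite set to itself, $\Gamma_\kappa$ is the oriented graph with an arrow $j\to\kappa(j)$ whenever $\kappa(j)\ne j$. It is a loop with branches graph if it is connected and consists of one globally oriented cycle (the loop, possibly of length 1, i.e. a fixed point) and finitely many pairwise disjoint oriented chains, each ending by an arrow into a loop vertex. A leaf is a vertex off the loop with no incoming arrow. Setup. Let $I=\{1,\dots,N\}$, $\kappa_0:I\to I$ with $\Gamma_{\kappa_0}$ a loop with branches graph, $L$ its set of loop vertices; assume $1$ is a leaf and $\kappa_0(1)=2$. Let $a_1\ge1$, $a_j\ge2$ ($2\le j\le N$) be integers and $f_{\kappa_0}=x_1^{2a_1}x_2+\sum_{j=2}^Nx_j^{a_j}x_{\kappa_0(j)}$, with rational weights $q_j$ determined by $2a_1q_1+q_2=1$, $a_jq_j+q_{\kappa_0(j)}=1$ ($j\ge2$). For $m\in L$ let $S_m$ be the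 set of vertices with an arrow ending in $m$, and $A=\bigcup_{m\in L}\{J\subseteq S_m:|J|\ge2\}$. For each $J\in A$ let positive integers $b_{J,s}$ ($s\in J$) with $\sum_{s\in J}b_{J,s}q_s=1$ be given, and $\varepsilon_J\in\mathbb{C}^*$ such that, with $f_{add}=\sum_{J\in A}\varepsilon_J\prod_{s\in J}x_s^{b_{J,s}}$, the polynomial $f_0=f_{\kappa_0}+f_{add}$ is non-degenerate. Put $f=f_0+x_{N+1}^2$. Let $g$ act by $x_m\mapsto-x_m$ for $m\in\{1,N+1\}$, $x_m\mapsto x_m$ otherwise, $G=\langle g\rangle$, and assume $f$ is $G$-invariant (i.e. $b_{J,1}$ is even whenever $1\in J$). Put $$\bar f=x_1^{a_1}x_2+\sum_{j=2}^Nx_j^{a_j}x_{\kappa_0(j)}+x_{N+1}^2x_1+\bar f_{add},$$ where $\bar f_{add}$ is obtained from $f_{add}$ by replacing $x_1^2$ by $x_1$ (i.e. each exponent $b_{J,1}$ of $x_1$ by $b_{J,1}/2$). The algebra $\mathrm{Jac}(f,G)$. Let $f\in\mathbb{C}[x_1,\dots,x_n]$ be non-degenerate and $G$ a finite group of diagonal symmetries $g=(g_1,\dots,g_n)\in(\mathbb{C}^* )^n$, $g(x)=(g_1x_1,\dots,g_nx_n)$, $f(g(x))=f(x)$. (Here $n=N+1$.) Put $f^g=f|_{\mathrm{Fix}(g)}$, with $\mathrm{Jac}(f^g)=\mathbb{C}$ if $\mathrm{Fix}(g)=\{0\}$, and $\mathrm{Jac}'(f,G)=\bigoplus_{g\in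 G}\mathrm{Jac}(f^g)\xi_g$, with $\xi_g$ formal generators. Let $I_g=\{i:g_i=1\}$, $I_g^c=\{1,\dots,n\}\setminus I_g$, $d_g=|I_g^c|$, $d_{g,h}=\frac12(d_g+d_h-d_{gh})$. The Clifford algebra $Cl_n$ is generated by $\theta_i,\partial_{\theta_i}$ with $\theta_i\theta_j=-\theta_j\theta_i$, $\partial_{\theta_i}\partial_{\theta_j}=-\partial_{\theta_j}\partial_{\theta_i}$, $\partial_{\theta_i}\theta_j=\delta_{ij}-\theta_j\partial_{\theta_i}$. Let $\mathbb{C}[\theta]=Cl_n/Cl_n\langle\partial_{\theta_1},\dots,\partial_{\theta_n}\rangle$ and $\mathbb{C}[\partial_\theta]=Cl_n/Cl_n\langle\theta_1,\dots,\theta_n\rangle$ as left $Cl_n$-modules; $\partial_{\theta_K}=\prod_{i\in K}\partial_{\theta_i}$ in increasing order. The difference derivative is $$\nabla_i^{x\to(x,y)}(f)=\frac{f(y_1,\dots,y_{i-1},x_i,\dots,x_n)-f(y_1,\dots,y_i,x_{i+1},\dots,x_n)}{x_i-y_i},$$ and expressions such as $\nabla_i^{x\to(x,g(x))}$ mean that the resulting polynomial is evaluated at $y=g(x)$. Define $$\mathrm{H}_f(x,y,z)=\sum_{1\le j\le i\le n}\nabla_j^{y\to(y,z)}\nabla_i^{x\to(x,y)}(f)\,\theta_i\otimes\theta_j,\qquad \mathrm{H}_f(x,g(x),x)=\mathrm{H}_f(x,y,z)|_{y=g(x),z=x},$$ $$\mathrm{H}_{f,g}(x)=\sum_{i,j\in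 I_g^c,\ j<i}\frac1{1-g_j}\nabla_j^{x\to(x,x^g)}\nabla_i^{x\to(x,g(x))}(f)\,\theta_j\theta_i,$$ where $(x^g)_i=x_i$ for $i\in I_g$ and $(x^g)_i=0$ for $i\in I_g^c$. Let $\lfloor\cdot\rfloor_{gh}$ be the linear extension of the natural map $\mathbb{C}[x]\to\mathrm{Jac}(f^{gh})$ to coefficients. Let $\Upsilon:\mathbb{C}[\theta]^{\otimes2}\otimes\mathbb{C}[\partial_\theta]^{\otimes2}\to\mathbb{C}[\partial_\theta]$ (extended linearly in $x$) be $p_1(\theta)\otimes p_2(\theta)\otimes q_1(\partial_\theta)\otimes q_2(\partial_\theta)\mapsto(-1)^{|q_1||p_2|}p_1(q_1)\cdot p_2(q_2)$, where $p_i(q_i)$ is the action of $p_i$ on $q_i\in\mathbb{C}[\partial_\theta]$. Then $\sigma_{g,h}\in\mathrm{Jac}(f^{gh})$ is $0$ if $d_{g,h}\notin\mathbb{Z}_{\ge0}$, and otherwise is the coefficient of $\partial_{\theta_{I_{gh}^c}}$ in $$\frac1{d_{g,h}!}\Upsilon\Big(\big(\lfloor\mathrm{H}_f(x,g(x),x)\rfloor_{gh}+\lfloor\mathrm{H}_{f,g}(x)\rfloor_{gh}\otimes1+1\otimes\lfloor\mathrm{H}_{f,h}(g(x))\rfloor_{gh}\big)^{d_{g,h}}\otimes\partial_{\theta_{I_g^c}}\otimes\partial_{\theta_{I_h^c}}\Big),$$ the power being taken in $\mathbb{C}[x]\otimes\mathbb{C}[\theta]\otimes\mathbb{C}[\theta]$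 with its natural (graded, Koszul-sign) multiplication. The product on $\mathrm{Jac}'(f,G)$ is $[\phi]\xi_g\cup[\psi]\xi_h=[\phi\psi\sigma_{g,h}]\xi_{gh}$ for $\phi,\psi\in\mathbb{C}[x]$. An element $h\in G$ acts by $[\phi(x)]\xi_g\mapsto\prod_{i\in I_g^c}h_i^{-1}\cdot[\phi(h(x))]\xi_g$. Finally $\mathrm{Jac}(f,G)=(\mathrm{Jac}'(f,G))^G$ with the induced product. *)

theory Defs
  imports Complex_Main "HOL-Library.Poly_Mapping" "HOL-Algebra.QuotRing"
    "HOL-Algebra.Module" "HOL-Algebra.Generated_Groups"
begin

section \<open>Polynomials\<close>

type_synonym 'v mpoly = "('v \<Rightarrow>\<^sub>0 nat) \<Rightarrow>\<^sub>0 complex"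

definition Const :: "complex \<Rightarrow> 'v mpoly" where
  "Const c = Poly_Mapping.single 0 c"

definition Var :: "'v \<Rightarrow> 'v mpoly" where
  "Var v = Poly_Mapping.single (Poly_Mapping.single v 1) 1"

definition vars :: "'v mpoly \<Rightarrow> 'v set" where
  "vars p = (\<Union>m \<in> Poly_Mapping.keys p. Poly_Mapping.keys m)"

definition subst :: "('v \<Rightarrow> 'w mpoly) \<Rightarrow> 'v mpoly \<Rightarrow> 'w mpoly" where
  "subst s p = (\<Sum>m \<in> Poly_Mapping.keys p.
     Const (Poly_Mapping.lookup p m) * (\<Prod>v \<in> Poly_Mapping.keys m. s v ^ Poly_Mapping.lookup m v))"

definition eval :: "('v \<Rightarrow> complex) \<Rightarrow> 'v mpoly \<Rightarrow> complex" where
  "eval x p = (\<Sum>m \<in> Poly_Mapping.keys p.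
     Poly_Mapping.lookup p m * (\<Prod>v \<in> Poly_Mapping.keys m. x v ^ Poly_Mapping.lookup m v))"

definition pderiv :: "'v \<Rightarrow> 'v mpoly \<Rightarrow> 'v mpoly" where
  "pderiv v p = (\<Sum>m \<in> Poly_Mapping.keys p.
     Poly_Mapping.single (m - Poly_Mapping.single v 1)
       (Poly_Mapping.lookup p m * of_nat (Poly_Mapping.lookup m v)))"

text \<open>Points of the affine space with coordinates in \<open>V\<close> are functions vanishing off \<open>V\<close>.\<close>

definition nondegenerate :: "'v set \<Rightarrow> 'v mpoly \<Rightarrow> bool" where
  "nondegenerate V p \<longleftrightarrow>
     {x. (\<forall>v. v \<notin> V \<longrightarrow> x v = 0) \<and> (\<forall>v\<in>V. eval x (pderiv v p) = 0)} = {\<lambda>_. 0}"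


section \<open>Jacobian algebras\<close>

definition complex_ring :: "complex ring" where
  "complex_ring = \<lparr>carrier = UNIV, mult = (*), one = 1, zero = 0, add = (+)\<rparr>"

definition algebra_iso ::
    "('k, 'm) ring_scheme \<Rightarrow> ('k, 'a, 'p) module_scheme \<Rightarrow> ('k, 'b, 'q) module_scheme \<Rightarrow> ('a \<Rightarrow> 'b) set" where
  "algebra_iso K A B = {h. algebra K A \<and> algebra K B \<and> h \<in> ring_iso A B \<and>
     (\<forall>c \<in> carrier K. \<forall>a \<in> carrier A. h (c \<odot>\<^bsub>A\<^esub> a) = c \<odot>\<^bsub>B\<^esub> h a)}"

definition poly_ring :: "'v set \<Rightarrow> 'v mpoly ring" where
  "poly_ring V = \<lparr>carrier = {p. vars p \<subseteq> V}, mult = (*), one = 1, zero = 0, add = (+)\<rparr>"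

definition jac_ideal :: "'v set \<Rightarrow> 'v mpoly \<Rightarrow> 'v mpoly set" where
  "jac_ideal V h = genideal (poly_ring V) ((\<lambda>v. pderiv v h) ` V)"

definition jac_class :: "'v set \<Rightarrow> 'v mpoly \<Rightarrow> 'v mpoly \<Rightarrow> 'v mpoly set" where
  "jac_class V h p = jac_ideal V h +>\<^bsub>poly_ring V\<^esub> p"

definition jac :: "'v set \<Rightarrow> 'v mpoly \<Rightarrow> (complex, 'v mpoly set) module" where
  "jac V h = (let Q = poly_ring V Quot jac_ideal V h in
     \<lparr>carrier = carrier Q, mult = mult Q, one = one Q, zero = zero Q, add = add Q,
      smult = (\<lambda>c A. \<Union>p\<in>A. jac_class V h (Const c * p))\<rparr>)"


section \<open>The Clifford algebra\<close>

text \<open>Words with concatenation as addition, so that \<open>'a word \<Rightarrow>\<^sub>0 complex\<close> is the free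
  associative algebra.\<close>

datatype 'a word = Word (letters: "'a list")

instantiation word :: (type) monoid_add
begin

definition "0 = Word []"
definition "u + v = Word (letters u @ letters v)"

instance
  by standard (auto simp: zero_word_def plus_word_def)

end

datatype cgen = Theta nat | DTheta nat

type_synonym free_elt = "cgen word \<Rightarrow>\<^sub>0 complex"

definition fscalar :: "complex \<Rightarrow> free_elt" where
  "fscalar c = Poly_Mapping.single 0 c"

definition fgen :: "cgen \<Rightarrow> free_elt" where
  "fgen x = Poly_Mapping.single (Word [x]) 1"

definition free_algebra :: "nat \<Rightarrow> free_elt ring" where
  "free_algebra n =
     \<lparr>carrier = {p. \<forall>w \<in> Poly_Mapping.keys p. set (letters w) \<subseteq> Theta ` {1..n} \<union> DTheta ` {1..n}},
      mult = (*), one = 1, zero = 0, add = (+)\<rparr>"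

definition clifford_relations :: "nat \<Rightarrow> free_elt set" where
  "clifford_relations n =
     {fgen (Theta i) * fgen (Theta j) + fgen (Theta j) * fgen (Theta i) | i j.
        i \<in> {1..n} \<and> j \<in> {1..n}} \<union>
     {fgen (DTheta i) * fgen (DTheta j) + fgen (DTheta j) * fgen (DTheta i) | i j.
        i \<in> {1..n} \<and> j \<in> {1..n}} \<union>
     {fgen (DTheta i) * fgen (Theta j) - ((if i = j then 1 else 0) - fgen (Theta j) * fgen (DTheta i)) | i j.
        i \<in> {1..n} \<and> j \<in> {1..n}}"

definition clifford :: "nat \<Rightarrow> free_elt set ring" where
  "clifford n = free_algebra n Quot genideal (free_algebra n) (clifford_relations n)"

definition clifford_class :: "nat \<Rightarrow> free_elt \<Rightarrow> free_elt set" where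
  "clifford_class n p =
     genideal (free_algebra n) (clifford_relations n) +>\<^bsub>free_algebra n\<^esub> p"

definition left_ideal :: "('a, 'm) ring_scheme \<Rightarrow> 'a set \<Rightarrow> 'a set" where
  "left_ideal R S = \<Inter>{H. additive_subgroup H R \<and> S \<subseteq> H \<and>
     (\<forall>a \<in> carrier R. \<forall>h \<in> H. a \<otimes>\<^bsub>R\<^esub> h \<in> H)}"

definition theta :: "nat set \<Rightarrow> free_elt" where
  "theta K = prod_list (map (\<lambda>i. fgen (Theta i)) (sorted_list_of_set K))"

definition dtheta :: "nat set \<Rightarrow> free_elt" where
  "dtheta K = prod_list (map (\<lambda>i. fgen (DTheta i)) (sorted_list_of_set K))"

text \<open>The coordinates, with respect to the basis \<open>theta M\<close> (resp. \<open>dtheta M\<close>), \<open>M \<subseteq> {1..n}\<close>, of the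
  image of \<open>p\<close> in the left module obtained from the Clifford algebra by dividing out the left ideal
  generated by the \<open>DTheta i\<close> (resp. the \<open>Theta i\<close>). In the first module the products
  \<open>theta K * theta L\<close> give the multiplication of the exterior algebra in the \<open>Theta i\<close>, and
  likewise in the second one.\<close>

definition theta_coord :: "nat \<Rightarrow> free_elt \<Rightarrow> nat set \<Rightarrow> complex" where
  "theta_coord n p = (THE c. (\<forall>M. \<not> M \<subseteq> {1..n} \<longrightarrow> c M = 0) \<and>
     clifford_class n (p - (\<Sum>M \<in> Pow {1..n}. fscalar (c M) * theta M))
       \<in> left_ideal (clifford n) ((\<lambda>i. clifford_class n (fgen (DTheta i))) ` {1..n}))"

definition dtheta_coord :: "nat \<Rightarrow> free_elt \<Rightarrow> nat set \<Rightarrow> complex" where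
  "dtheta_coord n p = (THE c. (\<forall>M. \<not> M \<subseteq> {1..n} \<longrightarrow> c M = 0) \<and>
     clifford_class n (p - (\<Sum>M \<in> Pow {1..n}. fscalar (c M) * dtheta M))
       \<in> left_ideal (clifford n) ((\<lambda>i. clifford_class n (fgen (Theta i))) ` {1..n}))"

text \<open>The graded tensor square of the exterior algebra in the \<open>Theta i\<close>, with coefficients in \<open>R\<close>:
  \<open>u (K, L)\<close> is the coefficient of \<open>theta K \<otimes> theta L\<close>, and
  \<open>(theta K \<otimes> theta L) (theta K' \<otimes> theta L') =
    (-1) ^ (card L * card K') theta K theta K' \<otimes> theta L theta L'\<close>.\<close>

definition theta_square ::
    "nat \<Rightarrow> (complex, 'r, 'm) module_scheme \<Rightarrow> (nat set \<times> nat set \<Rightarrow> 'r) ring" where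
  "theta_square n R = (let B = Pow {1..n} \<times> Pow {1..n} in
     \<lparr>carrier = (B \<rightarrow>\<^sub>E carrier R),
      mult = (\<lambda>u v. \<lambda>(M, M') \<in> B. finsum R (\<lambda>((K, L), (K', L')).
        ((-1) ^ (card L * card K') * theta_coord n (theta K * theta K') M
           * theta_coord n (theta L * theta L') M')
          \<odot>\<^bsub>R\<^esub> (u (K, L) \<otimes>\<^bsub>R\<^esub> v (K', L'))) (B \<times> B)),
      one = (\<lambda>b \<in> B. if b = ({}, {}) then \<one>\<^bsub>R\<^esub> else \<zero>\<^bsub>R\<^esub>),
      zero = (\<lambda>b \<in> B. \<zero>\<^bsub>R\<^esub>),
      add = (\<lambda>u v. \<lambda>b \<in> B. u b \<oplus>\<^bsub>R\<^esub> v b)\<rparr>)"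

text \<open>The coefficient of \<open>dtheta M\<close> in \<open>\<Upsilon> (u \<otimes> dtheta P \<otimes> dtheta Q)\<close>; the two arguments \<open>A\<close>, \<open>A'\<close>
  expand \<open>p\<^sub>1 (q\<^sub>1)\<close> and \<open>p\<^sub>2 (q\<^sub>2)\<close>.\<close>

definition Upsilon_coeff ::
    "nat \<Rightarrow> (complex, 'r, 'm) module_scheme \<Rightarrow> (nat set \<times> nat set \<Rightarrow> 'r) \<Rightarrow>
      nat set \<Rightarrow> nat set \<Rightarrow> nat set \<Rightarrow> 'r" where
  "Upsilon_coeff n R u P Q M = finsum R (\<lambda>(K, L).
     ((-1) ^ (card P * card L) *
       (\<Sum>A \<in> Pow {1..n}. \<Sum>A' \<in> Pow {1..n}.
          dtheta_coord n (theta K * dtheta P) A * dtheta_coord n (theta L * dtheta Q) A'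
            * dtheta_coord n (dtheta A * dtheta A') M))
      \<odot>\<^bsub>R\<^esub> u (K, L)) (Pow {1..n} \<times> Pow {1..n})"


section \<open>Difference derivatives\<close>

datatype xyz = X nat | Y nat | Z nat

definition rename :: "(nat \<Rightarrow> xyz) \<Rightarrow> (nat \<Rightarrow> xyz) \<Rightarrow> nat set \<Rightarrow> xyz mpoly \<Rightarrow> xyz mpoly" where
  "rename s t K = subst (\<lambda>v. if v \<in> s ` K then Var (t (the_inv s v)) else Var v)"

definition nabla :: "(nat \<Rightarrow> xyz) \<Rightarrow> (nat \<Rightarrow> xyz) \<Rightarrow> nat \<Rightarrow> xyz mpoly \<Rightarrow> xyz mpoly" where
  "nabla s t i p = (THE q. (Var (s i) - Var (t i)) * q = rename s t {1..<i} p - rename s t {1..i} p)"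

text \<open>\<^term>\<open>nabla X Y i\<close> and \<^term>\<open>nabla Y Z i\<close> are the difference derivatives from \<open>x\<close> to \<open>(x, y)\<close> and from \<open>y\<close>
  to \<open>(y, z)\<close>. The quotient is exact and unique, polynomials forming an integral domain.\<close>

definition in_X :: "nat mpoly \<Rightarrow> xyz mpoly" where
  "in_X = subst (\<lambda>i. Var (X i))"

definition at_yz :: "(nat \<Rightarrow> nat mpoly) \<Rightarrow> (nat \<Rightarrow> nat mpoly) \<Rightarrow> xyz mpoly \<Rightarrow> nat mpoly" where
  "at_yz y z = subst (\<lambda>v. case v of X i \<Rightarrow> Var i | Y i \<Rightarrow> y i | Z i \<Rightarrow> z i)"

definition nabla_at :: "(nat \<Rightarrow> nat mpoly) \<Rightarrow> nat \<Rightarrow> nat mpoly \<Rightarrow> nat mpoly" where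
  "nabla_at y i p = at_yz y Var (nabla X Y i (in_X p))"


section \<open>Diagonal symmetries and the algebra of a pair\<close>

text \<open>A diagonal symmetry in \<open>n\<close> variables is its sequence of entries at \<open>1..n\<close>, continued by \<open>1\<close>.\<close>

type_synonym diag = "nat \<Rightarrow> complex"

definition torus :: "nat \<Rightarrow> diag monoid" where
  "torus n = \<lparr>carrier = {g. (\<forall>i. g i \<noteq> 0) \<and> (\<forall>i. i \<notin> {1..n} \<longrightarrow> g i = 1)},
     mult = (\<lambda>g h i. g i * h i), one = (\<lambda>_. 1)\<rparr>"

definition diag_subst :: "diag \<Rightarrow> nat mpoly \<Rightarrow> nat mpoly" where
  "diag_subst g = subst (\<lambda>i. Const (g i) * Var i)"

definition fixed :: "nat \<Rightarrow> diag \<Rightarrow> nat set" where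
  "fixed n g = {i \<in> {1..n}. g i = 1}"

definition moved :: "nat \<Rightarrow> diag \<Rightarrow> nat set" where
  "moved n g = {1..n} - fixed n g"

definition x_fix :: "nat \<Rightarrow> diag \<Rightarrow> nat \<Rightarrow> nat mpoly" where
  "x_fix n g i = (if i \<in> fixed n g then Var i else 0)"

definition restr :: "nat \<Rightarrow> diag \<Rightarrow> nat mpoly \<Rightarrow> nat mpoly" where
  "restr n g = subst (x_fix n g)"

definition jac_fix :: "nat \<Rightarrow> nat mpoly \<Rightarrow> diag \<Rightarrow> (complex, nat mpoly set) module" where
  "jac_fix n f g = jac (fixed n g) (restr n g f)"

definition class_fix :: "nat \<Rightarrow> nat mpoly \<Rightarrow> diag \<Rightarrow> nat mpoly \<Rightarrow> nat mpoly set" where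
  "class_fix n f g p = jac_class (fixed n g) (restr n g f) (restr n g p)"

text \<open>The elements below of \<open>\<complex>[x] \<otimes> \<complex>[\<theta>] \<otimes> \<complex>[\<theta>]\<close> and \<open>\<complex>[x] \<otimes> \<complex>[\<theta>]\<close> are given by their coefficients at
  \<open>theta K \<otimes> theta L\<close> and \<open>theta K\<close>.\<close>

definition H2 :: "nat \<Rightarrow> nat mpoly \<Rightarrow> diag \<Rightarrow> nat set \<times> nat set \<Rightarrow> nat mpoly" where
  "H2 n f g = (\<lambda>(K, L). \<Sum>i = 1..n. \<Sum>j = 1..i.
     if K = {i} \<and> L = {j}
     then at_yz (\<lambda>k. Const (g k) * Var k) Var (nabla Y Z j (nabla X Y i (in_X f)))
     else 0)"

definition H1 :: "nat \<Rightarrow> nat mpoly \<Rightarrow> diag \<Rightarrow> nat set \<Rightarrow> nat mpoly" where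
  "H1 n f g K = (\<Sum>(i, j) \<in> {(i, j). i \<in> moved n g \<and> j \<in> moved n g \<and> j < i}.
     Const (1 / (1 - g j) * theta_coord n (theta {j} * theta {i}) K)
       * nabla_at (x_fix n g) j (nabla_at (\<lambda>k. Const (g k) * Var k) i f))"

definition tensor_one :: "(nat set \<Rightarrow> nat mpoly) \<Rightarrow> nat set \<times> nat set \<Rightarrow> nat mpoly" where
  "tensor_one p = (\<lambda>(K, L). if L = {} then p K else 0)"

definition one_tensor :: "(nat set \<Rightarrow> nat mpoly) \<Rightarrow> nat set \<times> nat set \<Rightarrow> nat mpoly" where
  "one_tensor p = (\<lambda>(K, L). if K = {} then p L else 0)"

definition floor_fix ::
    "nat \<Rightarrow> nat mpoly \<Rightarrow> diag \<Rightarrow> (nat set \<times> nat set \<Rightarrow> nat mpoly) \<Rightarrow> nat set \<times> nat set \<Rightarrow> nat mpoly set" where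
  "floor_fix n f g u = (\<lambda>b \<in> Pow {1..n} \<times> Pow {1..n}. class_fix n f g (u b))"

definition sigma :: "nat \<Rightarrow> nat mpoly \<Rightarrow> diag \<Rightarrow> diag \<Rightarrow> nat mpoly set" where
  "sigma n f g h =
    (let gh = g \<otimes>\<^bsub>torus n\<^esub> h;
         R = jac_fix n f gh;
         T = theta_square n R;
         d = (of_nat (card (moved n g)) + of_nat (card (moved n h)) - of_nat (card (moved n gh))) / 2 :: rat;
         m = nat \<lfloor>d\<rfloor>;
         u = floor_fix n f gh (H2 n f g)
             \<oplus>\<^bsub>T\<^esub> floor_fix n f gh (tensor_one (H1 n f g))
             \<oplus>\<^bsub>T\<^esub> floor_fix n f gh (one_tensor (\<lambda>K. diag_subst g (H1 n f h K)))
     in if d \<in> \<nat>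
        then (1 / fact m) \<odot>\<^bsub>R\<^esub> Upsilon_coeff n R (u [^]\<^bsub>T\<^esub> m) (moved n g) (moved n h) (moved n gh)
        else \<zero>\<^bsub>R\<^esub>)"

text \<open>The product of \<open>A \<xi>\<^sub>g\<close> and \<open>B \<xi>\<^sub>h\<close> and the action of \<open>h\<close> on \<open>A \<xi>\<^sub>g\<close> are defined on representatives.
  As for \<^const>\<open>rcoset_mult\<close>, the union over all representatives is the common value whenever it does
  not depend on them.\<close>

definition lifts :: "nat \<Rightarrow> nat mpoly \<Rightarrow> diag \<Rightarrow> nat mpoly set \<Rightarrow> nat mpoly set" where
  "lifts n f g A = {p \<in> carrier (poly_ring {1..n}). class_fix n f g p = A}"

definition cup :: "nat \<Rightarrow> nat mpoly \<Rightarrow> diag \<Rightarrow> diag \<Rightarrow> nat mpoly set \<Rightarrow> nat mpoly set \<Rightarrow> nat mpoly set" where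
  "cup n f g h A B = (let gh = g \<otimes>\<^bsub>torus n\<^esub> h in
     \<Union>p \<in> lifts n f g A. \<Union>q \<in> lifts n f h B.
       class_fix n f gh (p * q) \<otimes>\<^bsub>jac_fix n f gh\<^esub> sigma n f g h)"

definition diag_action :: "nat \<Rightarrow> nat mpoly \<Rightarrow> diag \<Rightarrow> diag \<Rightarrow> nat mpoly set \<Rightarrow> nat mpoly set" where
  "diag_action n f h g A =
     (\<Union>p \<in> lifts n f g A.
       (\<Prod>i \<in> moved n g. inverse (h i)) \<odot>\<^bsub>jac_fix n f g\<^esub> class_fix n f g (diag_subst h p))"

definition xi :: "nat \<Rightarrow> nat mpoly \<Rightarrow> diag set \<Rightarrow> nat mpoly \<Rightarrow> diag \<Rightarrow> diag \<Rightarrow> nat mpoly set" where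
  "xi n f G p g = (\<lambda>h \<in> G. if h = g then class_fix n f g p else \<zero>\<^bsub>jac_fix n f h\<^esub>)"

definition jac_pre :: "nat \<Rightarrow> nat mpoly \<Rightarrow> diag set \<Rightarrow> (complex, diag \<Rightarrow> nat mpoly set) module" where
  "jac_pre n f G =
     \<lparr>carrier = (\<Pi>\<^sub>E g \<in> G. carrier (jac_fix n f g)),
      mult = (\<lambda>u v. \<lambda>k \<in> G. finsum (jac_fix n f k) (\<lambda>(g, h). cup n f g h (u g) (v h))
        {(g, h) \<in> G \<times> G. g \<otimes>\<^bsub>torus n\<^esub> h = k}),
      one = xi n f G 1 \<one>\<^bsub>torus n\<^esub>,
      zero = (\<lambda>g \<in> G. \<zero>\<^bsub>jac_fix n f g\<^esub>),
      add = (\<lambda>u v. \<lambda>g \<in> G. u g \<oplus>\<^bsub>jac_fix n f g\<^esub> v g),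
      smult = (\<lambda>c u. \<lambda>g \<in> G. c \<odot>\<^bsub>jac_fix n f g\<^esub> u g)\<rparr>"

definition jac_inv :: "nat \<Rightarrow> nat mpoly \<Rightarrow> diag set \<Rightarrow> (complex, diag \<Rightarrow> nat mpoly set) module" where
  "jac_inv n f G = (jac_pre n f G)
     \<lparr>carrier := {u \<in> carrier (jac_pre n f G). \<forall>h \<in> G. \<forall>g \<in> G. diag_action n f h g (u g) = u g}\<rparr>"


section \<open>Loops with branches and the polynomials attached to them\<close>

definition arrows :: "nat set \<Rightarrow> (nat \<Rightarrow> nat) \<Rightarrow> (nat \<times> nat) set" where
  "arrows I \<kappa> = {(j, \<kappa> j) | j. j \<in> I \<and> \<kappa> j \<noteq> j}"

definition loop_list :: "(nat \<Rightarrow> nat) \<Rightarrow> nat list \<Rightarrow> bool" where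
  "loop_list \<kappa> vs \<longleftrightarrow> vs \<noteq> [] \<and> distinct vs \<and>
     (\<forall>i < length vs. \<kappa> (vs ! i) = vs ! (Suc i mod length vs))"

definition chain_to :: "(nat \<times> nat) set \<Rightarrow> nat set \<Rightarrow> nat list \<Rightarrow> bool" where
  "chain_to E L vs \<longleftrightarrow> vs \<noteq> [] \<and> distinct vs \<and>
     (\<forall>i. Suc i < length vs \<longrightarrow> (vs ! i, vs ! Suc i) \<in> E) \<and> (\<exists>l \<in> L. (last vs, l) \<in> E)"

definition loop_with_branches :: "nat set \<Rightarrow> (nat \<Rightarrow> nat) \<Rightarrow> nat set \<Rightarrow> bool" where
  "loop_with_branches I \<kappa> L \<longleftrightarrow>
     (\<forall>u \<in> I. \<forall>v \<in> I. (u, v) \<in> (arrows I \<kappa> \<union> (arrows I \<kappa>)\<inverse>)\<^sup>*) \<and>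
     (\<exists>vs C. loop_list \<kappa> vs \<and> L = set vs \<and>
        finite C \<and> (\<forall>c \<in> C. chain_to (arrows I \<kappa>) L c \<and> set c \<inter> L = {}) \<and>
        (\<forall>c \<in> C. \<forall>c' \<in> C. c \<noteq> c' \<longrightarrow> set c \<inter> set c' = {}) \<and>
        I = L \<union> (\<Union>c \<in> C. set c))"

definition leaf :: "nat set \<Rightarrow> (nat \<Rightarrow> nat) \<Rightarrow> nat set \<Rightarrow> nat \<Rightarrow> bool" where
  "leaf I \<kappa> L v \<longleftrightarrow> v \<in> I - L \<and> (\<forall>j. (j, v) \<notin> arrows I \<kappa>)"

definition pointing_sets :: "nat set \<Rightarrow> (nat \<Rightarrow> nat) \<Rightarrow> nat set \<Rightarrow> nat set set" where
  "pointing_sets I \<kappa> L = (\<Union>m \<in> L. {J. J \<subseteq> {j. (j, m) \<in> arrows I \<kappa>} \<and> 2 \<le> card J})"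

text \<open>The exponent \<open>e\<close> of the first variable takes the place of \<open>a 1\<close>.\<close>

definition f_kappa :: "nat \<Rightarrow> (nat \<Rightarrow> nat) \<Rightarrow> (nat \<Rightarrow> nat) \<Rightarrow> nat \<Rightarrow> nat mpoly" where
  "f_kappa N \<kappa> a e = Var 1 ^ e * Var 2 + (\<Sum>j = 2..N. Var j ^ a j * Var (\<kappa> j))"

definition f_add :: "nat set set \<Rightarrow> (nat set \<Rightarrow> nat \<Rightarrow> nat) \<Rightarrow> (nat set \<Rightarrow> complex) \<Rightarrow> nat mpoly" where
  "f_add A b \<epsilon> = (\<Sum>J \<in> A. Const (\<epsilon> J) * (\<Prod>s \<in> J. Var s ^ b J s))"

end

theory Submission
  imports Defs
begin

text \<open>
  Put \<open>n = N + 1\<close>. Invariance of \<open>f\<close> makes every exponent \<open>b J 1\<close> even, so there is a polynomial \<open>F\<close> in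
  \<open>x\<^sub>1, \<dots>, x\<^sub>N\<close> with \<open>f\<^sub>0 = F(x\<^sub>1\<^sup>2, x\<^sub>2, \<dots>, x\<^sub>N)\<close>, and then \<open>f = f\<^sub>0 + x\<^sub>n\<^sup>2\<close> and \<open>fbar = F + x\<^sub>n\<^sup>2 x\<^sub>1\<close>. Write
  \<open>F\<^sub>j\<close> for the partial derivatives of \<open>F\<close>. All computations below are in
  terms of \<open>F\<close>.

  Both algebras can be written down. The identity sector of the invariants consists of the
  polynomials that are even in \<open>x\<^sub>1\<close>, modulo \<open>x\<^sub>1 F\<^sub>1(x\<^sub>1\<^sup>2, \<dots>)\<close>, the \<open>F\<^sub>j(x\<^sub>1\<^sup>2, \<dots>)\<close> for \<open>1 < j\<close> and \<open>x\<^sub>n\<close>; in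
  terms of \<open>y = x\<^sub>1\<^sup>2\<close> it is \<open>\<complex>[y, x\<^sub>2, \<dots>, x\<^sub>N] / (y F\<^sub>1, F\<^sub>2, \<dots>, F\<^sub>N)\<close>. The sector of \<open>g\<close> is
  \<open>\<complex>[x\<^sub>2, \<dots>, x\<^sub>N] / (F\<^sub>j(0, x\<^sub>2, \<dots>))\<close>, all of it invariant because \<open>g\<close> moves two coordinates and
  \<open>(-1)\<^sup>2 = 1\<close>. The only product that is not forced is \<open>\<xi>\<^sub>g \<union> \<xi>\<^sub>g\<close>. Here \<open>H\<^bsub>f,g\<^esub> = 0\<close>, and among the terms of
  \<open>H\<^sub>f\<close> only \<open>F\<^sub>1(x\<^sub>1\<^sup>2, \<dots>) \<theta>\<^sub>1 \<otimes> \<theta>\<^sub>1\<close> and \<open>\<theta>\<^sub>n \<otimes> \<theta>\<^sub>n\<close> can be completed to \<open>\<theta>\<^sub>1\<theta>\<^sub>n \<otimes> \<theta>\<^sub>1\<theta>\<^sub>n\<close>; the Koszul sign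
  yields \<open>\<xi>\<^sub>g \<union> \<xi>\<^sub>g = - [F\<^sub>1(x\<^sub>1\<^sup>2, \<dots>)] \<xi>\<^sub>e\<close> (lemma \<open>sigma_g_g\<close>), where \<open>e\<close> is the identity. So the invariant algebra
  is generated by \<open>y, x\<^sub>2, \<dots>, x\<^sub>N\<close> and \<open>\<xi> = \<xi>\<^sub>g\<close> with \<open>\<xi>\<^sup>2 = - F\<^sub>1\<close>, \<open>y \<xi> = 0\<close> and \<open>F\<^sub>j = 0\<close>. With
  \<open>\<xi> = x\<^sub>n\<close> and \<open>y = x\<^sub>1\<close> these are the relations \<open>F\<^sub>1 + x\<^sub>n\<^sup>2\<close>, \<open>2 x\<^sub>n x\<^sub>1\<close>, \<open>F\<^sub>j\<close> of the Jacobian algebra of \<open>fbar\<close>.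

  The proof makes this exact without counting dimensions. The substitution \<open>x\<^sub>1 \<mapsto> x\<^sub>1\<^sup>2\<close>, \<open>x\<^sub>n \<mapsto> \<xi>\<^sub>g\<close>
  is realised as a map \<open>Psi\<close> from the polynomial ring to the invariants that is multiplicative
  (\<open>Psi_hom\<close>), onto (\<open>Psi_surj\<close>) and has the Jacobian ideal of \<open>fbar\<close> as its kernel (\<open>Psi_kernel\<close>). That the
  invariants form a commutative algebra at all is read off from \<open>Psi\<close>. Statements that an ideal is
  mapped into another one are obtained by exhibiting an ideal of good elements that contains the
  partial derivatives. The splitting of a polynomial into its even and odd part in one variable
  (\<open>halve\<close>) is used twice: for \<open>x\<^sub>n\<close> to separate the two sectors, and for \<open>x\<^sub>1\<close> to recover \<open>P\<close> from
  \<open>P(x\<^sub>1\<^sup>2, \<dots>)\<close>.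

  The coordinates with respect to \<open>\<theta>\<^sub>M\<close> and \<open>\<partial>\<theta>\<^sub>M\<close> are defined as the unique solution of a membership
  condition in the Clifford algebra. Uniqueness comes from the Fock representation and existence
  from reordering (\<open>coordinates_unique\<close>); afterwards every coordinate is computed by acting on the
  vacuum.
\<close>


section \<open>Polynomials, substitution and partial derivatives\<close>

abbreviation "single \<equiv> Poly_Mapping.single"
abbreviation "lookup \<equiv> Poly_Mapping.lookup"
abbreviation "keys \<equiv> Poly_Mapping.keys"

lemma Const_0 [simp]: "Const 0 = 0"
  by (simp add: Const_def)

lemma Const_1 [simp]: "Const 1 = 1"
  by (simp add: Const_def)

lemma Const_add: "Const (a + b) = Const a + Const b"
  by (simp add: Const_def single_add)

lemma Const_mult: "Const (a * b) = Const a * Const b"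
  by (simp add: Const_def mult_single)

lemma Const_uminus: "Const (- a) = - Const a"
  by (simp add: Const_def single_uminus)

lemma Const_numeral [simp]: "Const (numeral k) = numeral k"
  by (simp add: Const_def)

lemma Const_power: "Const (x ^ k) = Const x ^ k"
  by (induction k) (simp_all add: Const_mult)

lemma Const_prod: "Const (prod h S) = (\<Prod>i\<in>S. Const (h i))"
  by (induction S rule: infinite_finite_induct) (simp_all add: Const_mult)

lemma poly_mapping_eq_sum_single:
  fixes p :: "'a \<Rightarrow>\<^sub>0 'b::comm_monoid_add"
  shows "p = (\<Sum>m\<in>keys p. single m (lookup p m))"
proof (rule poly_mapping_eqI)
  fix k
  show "lookup p k =
    lookup (\<Sum>m\<in>keys p. single m (lookup p m)) k"
    by (simp add: lookup_sum lookup_single when_def in_keys_iff)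
qed

text \<open>A polynomial is a sum of terms, and a term is a constant multiplied successively by variables. The
  two induction rules reduce identities between additive operators to one of these cases.\<close>
lemma poly_mapping_induct_single [case_names single add]:
  fixes p :: "'a \<Rightarrow>\<^sub>0 'b::comm_monoid_add"
  assumes "\<And>m c. P (single m c)" and "\<And>p q. P p \<Longrightarrow> P q \<Longrightarrow> P (p + q)"
  shows "P p"
proof -
  have "P (\<Sum>m\<in>S. single m (lookup p m))" if "finite S" for S
    using that
  proof induction
    case empty
    then show ?case using assms(1)[of undefined 0] by simp
  next
    case (insert x F)
    then show ?case by (simp add: assms)
  qed
  then show ?thesis
    using poly_mapping_eq_sum_single[of p] by (metis finite_keys)
qed

lemma monomial_induct [case_names zero step]:
  fixes m :: "'v \<Rightarrow>\<^sub>0 nat"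
  assumes zero: "P 0" and step: "\<And>m v. P m \<Longrightarrow> P (single v 1 + m)"
  shows "P m"
proof -
  have shift: "P (single v c + k)" if "P k" for k v c
  proof (induction c)
    case 0
    then show ?case by (simp add: that)
  next
    case (Suc c)
    have "single v (Suc c) + k = single v 1 + (single v c + k)"
      by (metis add.assoc plus_1_eq_Suc single_add)
    then show ?case using step[OF Suc] by simp
  qed
  have "P (m + k)" if "P k" for k
    using that
  proof (induction m arbitrary: k rule: poly_mapping_induct_single)
    case (single m c)
    then show ?case by (rule shift)
  next
    case (add p q)
    then show ?case by (simp add: add.assoc)
  qed
  from this[OF zero] show ?thesis by simp
qed

lemma mpoly_induct [case_names Const add Var_mult]:
  fixes p :: "'v mpoly"
  assumes Const: "\<And>c. P (Const c)" and add: "\<And>p q. P p \<Longrightarrow> P q \<Longrightarrow> P (p + q)"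
    and Var_mult: "\<And>v p. P p \<Longrightarrow> P (Var v * p)"
  shows "P p"
proof (induction p rule: poly_mapping_induct_single)
  case (single m c)
  show ?case
  proof (induction m rule: monomial_induct)
    case zero
    then show ?case using Const[of c] by (simp add: Const_def)
  next
    case (step m v)
    have "single (single v 1 + m) c = Var v * single m c"
      by (simp add: Var_def mult_single)
    then show ?case using Var_mult[OF step] by simp
  qed
qed (rule add)

text \<open>The linear extension of a map on monomials. Substitution, partial derivatives and the operators
  \<open>halve\<close> below are all of this form, which gives their additivity at once.\<close>
definition mono_ext :: "(('v \<Rightarrow>\<^sub>0 nat) \<Rightarrow> 'w mpoly) \<Rightarrow> 'v mpoly \<Rightarrow> 'w mpoly" where
  "mono_ext \<phi> p = (\<Sum>m\<in>keys p. Const (lookup p m) * \<phi> m)"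

lemma mono_ext_single: "mono_ext \<phi> (single m c) = Const c * \<phi> m"
  by (cases "c = 0") (simp_all add: mono_ext_def)

lemma mono_ext_add: "mono_ext \<phi> (p + q) = mono_ext \<phi> p + mono_ext \<phi> q"
  unfolding mono_ext_def
  by (rule setsum_keys_plus_distrib) (simp_all add: Const_add algebra_simps)

lemma additive_uminus_diff:
  fixes F :: "'a::ab_group_add \<Rightarrow> 'b::ab_group_add"
  assumes "\<And>p q. F (p + q) = F p + F q"
  shows "F 0 = 0" "F (- p) = - F p" "F (p - q) = F p - F q" "F (sum h S) = (\<Sum>i\<in>S. F (h i))"
proof -
  show 0: "F 0 = 0" using assms[of 0 0] by simp
  show m: "F (- p) = - F p" for p
    using assms[of p "- p"] 0 by (simp add: eq_neg_iff_add_eq_0 add.commute)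
  show "F (p - q) = F p - F q" using assms[of p "- q"] m by simp
  show "F (sum h S) = (\<Sum>i\<in>S. F (h i))"
    by (induction S rule: infinite_finite_induct) (simp_all add: 0 assms)
qed

definition mono_val :: "('v \<Rightarrow> 'w mpoly) \<Rightarrow> ('v \<Rightarrow>\<^sub>0 nat) \<Rightarrow> 'w mpoly" where
  "mono_val s m = (\<Prod>v\<in>keys m. s v ^ lookup m v)"

lemma mono_val_superset:
  assumes "finite S" "keys m \<subseteq> S"
  shows "mono_val s m = (\<Prod>v\<in>S. s v ^ lookup m v)"
  unfolding mono_val_def
  by (rule prod.mono_neutral_left) (use assms in \<open>auto simp: in_keys_iff\<close>)

lemma mono_val_add: "mono_val s (m + m') = mono_val s m * mono_val s m'"
proof -
  let ?S = "keys m \<union> keys m'"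
  show ?thesis
    using mono_val_superset[of ?S "m + m'" s] mono_val_superset[of ?S m s] mono_val_superset[of ?S m' s]
      Poly_Mapping.keys_add[of m m']
    by (auto simp: lookup_add power_add prod.distrib)
qed

lemma subst_eq_mono_ext: "subst s = mono_ext (mono_val s)"
  by (auto simp: subst_def mono_ext_def mono_val_def fun_eq_iff)

lemma subst_single: "subst s (single m c) = Const c * mono_val s m"
  by (simp add: subst_eq_mono_ext mono_ext_single)

lemma subst_add [simp]: "subst s (p + q) = subst s p + subst s q"
  by (simp add: subst_eq_mono_ext mono_ext_add)

lemmas subst_0 [simp] = additive_uminus_diff(1)[of "subst s" for s, OF subst_add]
lemmas subst_uminus [simp] = additive_uminus_diff(2)[of "subst s" for s, OF subst_add]
lemmas subst_diff [simp] = additive_uminus_diff(3)[of "subst s" for s, OF subst_add]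
lemmas subst_sum [simp] = additive_uminus_diff(4)[of "subst s" for s, OF subst_add]

lemma subst_Const [simp]: "subst s (Const c) = Const c"
  unfolding Const_def[of c] subst_single by (simp add: mono_val_def Const_def)

lemma subst_Var [simp]: "subst s (Var v) = s v"
  by (simp add: Var_def subst_single mono_val_def)

lemma subst_mult [simp]: "subst s (p * q) = subst s p * subst s q"
proof (induction p rule: poly_mapping_induct_single)
  case (single m c)
  show ?case
  proof (induction q rule: poly_mapping_induct_single)
    case (single m' c')
    show ?case
      by (simp add: mult_single subst_single mono_val_add Const_mult mult_ac)
  qed (simp add: distrib_left)
qed (simp add: distrib_right)

lemma subst_1 [simp]: "subst s 1 = 1"
  using subst_Const[of s 1] by simp

lemma subst_power [simp]: "subst s (p ^ k) = subst s p ^ k"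
  by (induction k) simp_all

lemma subst_prod [simp]: "subst s (prod h S) = (\<Prod>i\<in>S. subst s (h i))"
  by (induction S rule: infinite_finite_induct) simp_all

lemma subst_numeral [simp]: "subst s (numeral k) = numeral k"
  using subst_Const[of s "numeral k"] by simp

lemma subst_subst: "subst s (subst t p) = subst (\<lambda>v. subst s (t v)) p"
  by (induction p rule: mpoly_induct) simp_all

lemma subst_Var_id [simp]: "subst Var p = p"
  by (induction p rule: mpoly_induct) simp_all

lemma subst_cong:
  assumes "\<And>v. v \<in> vars p \<Longrightarrow> s v = t v"
  shows "subst s p = subst t p"
proof -
  have "s v = t v" if "m \<in> keys p" "v \<in> keys m" for m v
    using assms[of v] that by (auto simp: vars_def)
  then show ?thesis
    unfolding subst_def by (intro sum.cong refl arg_cong2[where f = "(*)"] prod.cong) simp_all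
qed

lemma subst_ident:
  assumes "\<And>v. v \<in> vars p \<Longrightarrow> s v = Var v"
  shows "subst s p = p"
  using subst_cong[of p s Var] assms by simp

lemma vars_Const [simp]: "vars (Const c) = {}"
  by (cases "c = 0") (simp_all add: vars_def Const_def)

lemma vars_Var [simp]: "vars (Var v) = {v}"
  by (simp add: vars_def Var_def)

lemma vars_0 [simp]: "vars 0 = {}"
  by (simp add: vars_def)

lemma vars_1 [simp]: "vars 1 = {}"
  by (simp add: vars_def)

lemma vars_numeral [simp]: "vars (numeral k) = {}"
  using vars_Const[of "numeral k"] by simp

lemma vars_add: "vars (p + q) \<subseteq> vars p \<union> vars q"
  using Poly_Mapping.keys_add[of p q] by (auto simp: vars_def)

lemma vars_uminus [simp]: "vars (- p) = vars p"
  by (auto simp: vars_def in_keys_iff)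

lemma vars_diff: "vars (p - q) \<subseteq> vars p \<union> vars q"
  using vars_add[of p "- q"] by simp

lemma vars_mult: "vars (p * q) \<subseteq> vars p \<union> vars q"
proof
  fix v assume "v \<in> vars (p * q)"
  then obtain m where m: "m \<in> keys (p * q)" and v: "v \<in> keys m"
    by (auto simp: vars_def)
  from m keys_mult[of p q] obtain k l
    where "k \<in> keys p" "l \<in> keys q" "m = k + l" by auto
  then show "v \<in> vars p \<union> vars q"
    using v Poly_Mapping.keys_add[of k l] by (auto simp: vars_def)
qed

lemma vars_power: "vars (p ^ k) \<subseteq> vars p"
  by (induction k) (use vars_mult[of p] in auto)

lemma vars_sum: "vars (sum h S) \<subseteq> (\<Union>i\<in>S. vars (h i))"
  by (induction S rule: infinite_finite_induct) (use vars_add in fastforce)+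

lemma vars_prod: "vars (prod h S) \<subseteq> (\<Union>i\<in>S. vars (h i))"
  by (induction S rule: infinite_finite_induct) (use vars_mult in fastforce)+

lemma vars_subst: "vars (subst s p) \<subseteq> (\<Union>v\<in>vars p. vars (s v))"
proof -
  have "vars (subst s p) \<subseteq> (\<Union>m\<in>keys p.
    vars (Const (lookup p m) * (\<Prod>v\<in>keys m. s v ^ lookup m v)))"
    unfolding subst_def by (rule vars_sum)
  also have "\<dots> \<subseteq> (\<Union>m\<in>keys p. \<Union>v\<in>keys m. vars (s v))"
  proof (rule UN_mono[OF order_refl])
    fix m
    have "vars (Const (lookup p m) * (\<Prod>v\<in>keys m. s v ^ lookup m v))
      \<subseteq> vars (\<Prod>v\<in>keys m. s v ^ lookup m v)"
      using vars_mult[of "Const (lookup p m)"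
          "\<Prod>v\<in>keys m. s v ^ lookup m v"] by auto
    also have "\<dots> \<subseteq> (\<Union>v\<in>keys m. vars (s v ^ lookup m v))"
      by (rule vars_prod)
    also have "\<dots> \<subseteq> (\<Union>v\<in>keys m. vars (s v))"
      using vars_power by fast
    finally show "vars (Const (lookup p m) * (\<Prod>v\<in>keys m. s v ^ lookup m v))
      \<subseteq> (\<Union>v\<in>keys m. vars (s v))" .
  qed
  finally show ?thesis by (auto simp: vars_def)
qed

lemma vars_subst_subset:
  assumes "\<And>v. v \<in> vars p \<Longrightarrow> vars (s v) \<subseteq> V"
  shows "vars (subst s p) \<subseteq> V"
  using vars_subst[of s p] assms by blast

text \<open>Modulo \<open>d\<close> the two substitutions agree on variables, hence everywhere. This is why difference
  quotients of polynomials are polynomials.\<close>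
lemma dvd_subst_diff:
  assumes "\<And>v. d dvd s v - t v"
  shows "d dvd subst s p - subst t p"
proof (induction p rule: mpoly_induct)
  case (add p q)
  then show ?case
    using dvd_add[of d "subst s p - subst t p" "subst s q - subst t q"] by (simp add: algebra_simps)
next
  case (Var_mult v p)
  have "s v * subst s p - t v * subst t p = (s v - t v) * subst s p + t v * (subst s p - subst t p)"
    by (simp add: algebra_simps)
  then show ?case using assms[of v] Var_mult by simp
qed simp

lemma pderiv_eq_mono_ext:
  "pderiv v = mono_ext (\<lambda>m. single (m - single v 1) (of_nat (lookup m v)))"
  by (auto simp: pderiv_def mono_ext_def fun_eq_iff Const_def mult_single)

lemma pderiv_add [simp]: "pderiv v (p + q) = pderiv v p + pderiv v q"
  by (simp add: pderiv_eq_mono_ext mono_ext_add)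

lemmas pderiv_0 [simp] = additive_uminus_diff(1)[of "pderiv v" for v, OF pderiv_add]
lemmas pderiv_diff [simp] = additive_uminus_diff(3)[of "pderiv v" for v, OF pderiv_add]

lemma pderiv_Const [simp]: "pderiv v (Const c) = 0"
  unfolding pderiv_eq_mono_ext Const_def[of c] by (subst mono_ext_single) simp

lemma pderiv_Var: "pderiv v (Var u) = (if u = v then 1 else 0)"
  unfolding pderiv_eq_mono_ext Var_def
  by (subst mono_ext_single) (auto simp: lookup_single)

lemma pderiv_Var_mult: "pderiv v (Var u * p) = pderiv v (Var u) * p + Var u * pderiv v p"
proof (induction p rule: poly_mapping_induct_single)
  case (single m c)
  let ?e = "\<lambda>v. single v (1::nat)"
  have 1: "Var u * single m c = single (?e u + m) c"
    by (simp add: Var_def mult_single)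
  have 2: "pderiv v (single m c) =
    single (m - ?e v) (c * of_nat (lookup m v))" for m and c
    by (simp add: pderiv_eq_mono_ext mono_ext_single Const_def mult_single)
  show ?case
  proof (cases "u = v")
    case False
    have "?e u + m - ?e v = ?e u + (m - ?e v)" if "lookup m v \<noteq> 0"
      by (rule poly_mapping_eqI) (use False in \<open>auto simp: lookup_add lookup_minus lookup_single when_def\<close>)
    then show ?thesis
      using False by (cases "lookup m v = 0")
        (auto simp: 1 2 pderiv_Var lookup_add lookup_single Var_def mult_single)
  next
    case True
    have "?e v + (m - ?e v) = m" if "lookup m v \<noteq> 0"
      by (rule poly_mapping_eqI) (use that in \<open>auto simp: lookup_add lookup_minus lookup_single when_def\<close>)
    then show ?thesis
      using True by (cases "lookup m v = 0")
        (auto simp: 1 2 pderiv_Var lookup_add lookup_single Var_def mult_single single_add[symmetric] algebra_simps)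
  qed
next
  case (add p q)
  then show ?case by (simp add: algebra_simps)
qed

lemma pderiv_Const_mult [simp]: "pderiv v (Const c * p) = Const c * pderiv v p"
proof (induction p rule: mpoly_induct)
  case (Const d)
  then show ?case by (simp flip: Const_mult)
next
  case (add p q)
  then show ?case by (simp add: distrib_left)
next
  case (Var_mult u p)
  then show ?case
    by (metis (no_types, lifting) distrib_left mult.left_commute pderiv_Var_mult)
qed

lemma pderiv_mult: "pderiv v (p * q) = pderiv v p * q + p * pderiv v q"
proof (induction p rule: mpoly_induct)
  case (Var_mult u p)
  then show ?case
    by (simp add: pderiv_Var_mult mult.assoc) (simp add: algebra_simps)
qed (simp_all add: distrib_right add_ac)

lemma pderiv_power2: "pderiv v (p\<^sup>2) = 2 * p * pderiv v p"
  by (simp add: power2_eq_square pderiv_mult)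

text \<open>The chain rule. Only the variables whose substitute depends on \<open>i\<close> contribute, so the sum may run
  over any finite set containing these.\<close>
lemma pderiv_subst:
  assumes "finite V" "\<And>v. v \<notin> V \<Longrightarrow> pderiv i (s v) = 0"
  shows "pderiv i (subst s p) = (\<Sum>v\<in>V. subst s (pderiv v p) * pderiv i (s v))"
proof (induction p rule: mpoly_induct)
  case (add p q)
  then show ?case by (simp add: sum.distrib distrib_right)
next
  case (Var_mult u p)
  have "(\<Sum>v\<in>V. subst s (pderiv v (Var u * p)) * pderiv i (s v)) =
    (\<Sum>v\<in>V. (if u = v then subst s p * pderiv i (s v) else 0)) +
    s u * (\<Sum>v\<in>V. subst s (pderiv v p) * pderiv i (s v))"
    unfolding sum_distrib_left sum.distrib[symmetric]
    by (intro sum.cong refl) (simp add: pderiv_Var_mult pderiv_Var distrib_right mult.assoc)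
  also have "(\<Sum>v\<in>V. (if u = v then subst s p * pderiv i (s v) else 0)) = subst s p * pderiv i (s u)"
    using assms by simp
  finally show ?case
    using Var_mult by (simp add: pderiv_mult algebra_simps)
qed simp

lemma vars_pderiv: "vars (pderiv v p) \<subseteq> vars p"
proof -
  have "vars (pderiv v p) \<subseteq> (\<Union>m\<in>keys p. vars
     (single (m - single v 1)
       (lookup p m * of_nat (lookup m v))))"
    unfolding pderiv_def by (rule vars_sum)
  also have "\<dots> \<subseteq> (\<Union>m\<in>keys p. keys m)"
  proof (rule UN_mono[OF order_refl])
    fix m :: "'a \<Rightarrow>\<^sub>0 nat" and c
    have "keys (m - single v 1) \<subseteq> keys m"
      by (auto simp: in_keys_iff lookup_minus)
    then show "vars (single (m - single v 1)
       (lookup p m * of_nat (lookup m v))) \<subseteq> keys m"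
      by (auto simp: vars_def split: if_splits)
  qed
  finally show ?thesis by (simp add: vars_def)
qed

section \<open>Even and odd parts in one variable\<close>

text \<open>For \<open>e = 0\<close> and \<open>e = 1\<close> these are the polynomials \<open>p\<^sub>0\<close>, \<open>p\<^sub>1\<close> with \<open>p = p\<^sub>0(v\<^sup>2) + v p\<^sub>1(v\<^sup>2)\<close>: monomials
  with exponent \<open>2 k + e\<close> of \<open>v\<close> get the exponent \<open>k\<close>, the others are dropped. Lemma \<open>halve_decomp\<close>
  states the decomposition.\<close>
definition halve :: "'v \<Rightarrow> nat \<Rightarrow> 'v mpoly \<Rightarrow> 'v mpoly" where
  "halve v e = mono_ext (\<lambda>m. if lookup m v mod 2 = e
     then single (Poly_Mapping.update v (lookup m v div 2) m) 1 else 0)"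

lemma halve_add [simp]: "halve v e (p + q) = halve v e p + halve v e q"
  by (simp add: halve_def mono_ext_add)

lemmas halve_0 [simp] = additive_uminus_diff(1)[of "halve v e" for v e, OF halve_add]

lemma halve_Const [simp]: "halve v 0 (Const c) = Const c" "halve v (Suc 0) (Const c) = 0"
proof -
  have [simp]: "Poly_Mapping.update v 0 0 = 0"
    by (rule poly_mapping_eqI) (simp add: lookup_update)
  show "halve v 0 (Const c) = Const c" "halve v (Suc 0) (Const c) = 0"
    unfolding halve_def Const_def[of c]
    by (subst mono_ext_single; simp add: Const_def[symmetric])+
qed

lemma halve_Const_mult [simp]: "halve v e (Const c * p) = Const c * halve v e p"
proof (induction p rule: poly_mapping_induct_single)
  case (single m d)
  have "Const c * single m d = single m (c * d)"
    by (simp add: Const_def mult_single)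
  then show ?case
    by (simp add: halve_def mono_ext_single Const_mult mult.assoc)
qed (simp add: distrib_left)

lemma halve_1 [simp]: "halve v 0 1 = 1" "halve v (Suc 0) 1 = 0"
  using halve_Const[of v 1] by simp_all

lemma halve_Var_mult_other [simp]:
  assumes "u \<noteq> v"
  shows "halve v e (Var u * p) = Var u * halve v e p"
proof (induction p rule: poly_mapping_induct_single)
  case (single m c)
  have "Poly_Mapping.update v k (single u 1 + m) =
    single u 1 + Poly_Mapping.update v k m" for k
    by (rule poly_mapping_eqI) (use assms in \<open>auto simp add: lookup_update lookup_add lookup_single when_def\<close>)
  then show ?case
    using assms by (auto simp add: Var_def mult_single halve_def mono_ext_single lookup_add lookup_single mult.left_commute)
qed (simp add: distrib_left)

lemma halve_Var_mult_same [simp]: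
  "halve v 0 (Var v * p) = Var v * halve v (Suc 0) p"
  "halve v (Suc 0) (Var v * p) = halve v 0 p"
proof -
  have u: "Poly_Mapping.update v (Suc k) (single v (Suc 0) + m) =
    single v (Suc 0) + Poly_Mapping.update v k m" for k and m :: "'a \<Rightarrow>\<^sub>0 nat"
    by (rule poly_mapping_eqI) (simp add: lookup_update lookup_add lookup_single)
  have u': "Poly_Mapping.update v k (single v (Suc 0) + m) =
    Poly_Mapping.update v k m" for k and m :: "'a \<Rightarrow>\<^sub>0 nat"
    by (rule poly_mapping_eqI) (simp add: lookup_update lookup_add lookup_single)
  have p: "(Suc k mod 2 = 0) = (k mod 2 = Suc 0)" "(Suc k mod 2 = Suc 0) = (k mod 2 = 0)" for k :: nat
    by presburger+
  have d: "k mod 2 = Suc 0 \<Longrightarrow> Suc k div 2 = Suc (k div 2)" "k mod 2 = 0 \<Longrightarrow> Suc k div 2 = k div 2" for k :: nat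
    by presburger+
  show "halve v 0 (Var v * p) = Var v * halve v (Suc 0) p"
  proof (induction p rule: poly_mapping_induct_single)
    case (single m c)
    show ?case
      by (simp add: Var_def mult_single halve_def mono_ext_single lookup_add p d u mult.left_commute)
  qed (simp add: distrib_left)
  show "halve v (Suc 0) (Var v * p) = halve v 0 p"
  proof (induction p rule: poly_mapping_induct_single)
    case (single m c)
    show ?case
      by (simp add: Var_def mult_single halve_def mono_ext_single lookup_add p d u')
  qed (simp add: distrib_left)
qed

text \<open>The product of \<open>p\<^sub>0 + v p\<^sub>1\<close> and \<open>q\<^sub>0 + v q\<^sub>1\<close> when \<open>v\<^sup>2\<close> is renamed to \<open>v\<close>. The same formula, with \<open>v\<close>
  specialised to the structure constant, is the multiplication rule of the invariant algebra.\<close>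
lemma halve_mult:
  "halve v 0 (p * q) = halve v 0 p * halve v 0 q + Var v * (halve v (Suc 0) p * halve v (Suc 0) q)"
  "halve v (Suc 0) (p * q) = halve v 0 p * halve v (Suc 0) q + halve v (Suc 0) p * halve v 0 q"
proof (induction p rule: mpoly_induct)
  case (Var_mult u p)
  {
    case 1
    show ?case using Var_mult by (cases "u = v") (simp_all add: mult.assoc, simp_all add: algebra_simps)
  next
    case 2
    show ?case using Var_mult by (cases "u = v") (simp_all add: mult.assoc, simp_all add: algebra_simps)
  }
qed (simp_all add: distrib_right distrib_left add_ac)

lemma halve_Var [simp]:
  "u \<noteq> v \<Longrightarrow> halve v 0 (Var u) = Var u" "u \<noteq> v \<Longrightarrow> halve v (Suc 0) (Var u) = 0"
  "halve v 0 (Var v) = 0" "halve v (Suc 0) (Var v) = 1"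
  using halve_Var_mult_other[of u v _ 1] halve_Var_mult_same[of v 1] by simp_all

definition sq :: "'v \<Rightarrow> 'v mpoly \<Rightarrow> 'v mpoly" where
  "sq v = subst (Var(v := (Var v)\<^sup>2))"

lemma halve_decomp: "p = sq v (halve v 0 p) + Var v * sq v (halve v (Suc 0) p)"
proof (induction p rule: mpoly_induct)
  case (add p q)
  then show ?case by (simp add: sq_def) (simp add: algebra_simps)
next
  case (Var_mult u p)
  show ?case
  proof (cases "u = v")
    case True
    have "sq v (halve v 0 (Var v * p)) + Var v * sq v (halve v (Suc 0) (Var v * p)) =
      Var v * (sq v (halve v 0 p) + Var v * sq v (halve v (Suc 0) p))"
      by (simp add: sq_def) (simp add: algebra_simps power2_eq_square)
    then show ?thesis using True by (simp flip: Var_mult)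
  next
    case False
    have "sq v (halve v 0 (Var u * p)) + Var v * sq v (halve v (Suc 0) (Var u * p)) =
      Var u * (sq v (halve v 0 p) + Var v * sq v (halve v (Suc 0) p))"
      using False by (simp add: sq_def) (simp add: algebra_simps)
    then show ?thesis by (simp flip: Var_mult)
  qed
qed (simp add: sq_def)

lemma halve_sq [simp]: "halve v 0 (sq v p) = p" "halve v (Suc 0) (sq v p) = 0"
proof (induction p rule: mpoly_induct)
  case (Var_mult u p)
  {
    case 1
    show ?case using Var_mult by (cases "u = v") (simp_all add: sq_def power2_eq_square mult.assoc)
  next
    case 2
    show ?case using Var_mult by (cases "u = v") (simp_all add: sq_def power2_eq_square mult.assoc)
  }
qed (simp_all add: sq_def)

lemma halve_no_Var:
  assumes "v \<notin> vars p"
  shows "halve v 0 p = p" "halve v (Suc 0) p = 0"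
proof -
  have "sq v p = p"
    unfolding sq_def by (rule subst_ident) (use assms in auto)
  then show "halve v 0 p = p" "halve v (Suc 0) p = 0"
    using halve_sq[of v p] by simp_all
qed

lemma sq_simps [simp]: "sq v (p + q) = sq v p + sq v q" "sq v (p * q) = sq v p * sq v q"
  "sq v (p - q) = sq v p - sq v q" "sq v (- p) = - sq v p" "sq v (Const c) = Const c" "sq v 0 = 0" "sq v 1 = 1"
  "sq v (p ^ k) = sq v p ^ k" "sq v (Var u) = (if u = v then (Var v)\<^sup>2 else Var u)" "sq v (numeral m) = numeral m"
  by (simp_all add: sq_def)

lemma vars_sq: "vars p \<subseteq> V \<Longrightarrow> vars (sq v p) \<subseteq> V"
  unfolding sq_def using vars_power[of "Var v" 2]
  by (intro vars_subst_subset) (auto split: if_splits)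

lemma vars_halve: "vars (halve v e p) \<subseteq> vars p"
proof -
  have "vars (halve v e p) \<subseteq> (\<Union>m\<in>keys p. vars (Const (lookup p m) *
     (if lookup m v mod 2 = e
     then single (Poly_Mapping.update v (lookup m v div 2) m) 1 else 0)))"
    unfolding halve_def mono_ext_def by (rule vars_sum)
  also have "\<dots> \<subseteq> (\<Union>m\<in>keys p. keys m)"
  proof (rule UN_mono[OF order_refl])
    fix m :: "'a \<Rightarrow>\<^sub>0 nat"
    have "keys (Poly_Mapping.update v (lookup m v div 2) m) \<subseteq> keys m"
      by (auto simp: in_keys_iff lookup_update split: if_splits)
    then show "vars (Const (lookup p m) *
     (if lookup m v mod 2 = e
     then single (Poly_Mapping.update v (lookup m v div 2) m) 1 else 0)) \<subseteq> keys m"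
      by (auto simp: Const_def mult_single vars_def split: if_splits)
  qed
  finally show ?thesis by (simp add: vars_def)
qed

section \<open>Jacobian algebras\<close>

lemma poly_ring_simps [simp]:
  "carrier (poly_ring V) = {p. vars p \<subseteq> V}" "mult (poly_ring V) = (*)" "one (poly_ring V) = 1"
  "zero (poly_ring V) = 0" "add (poly_ring V) = (+)"
  by (simp_all add: poly_ring_def)

lemma complex_ring_simps [simp]:
  "carrier complex_ring = UNIV" "mult complex_ring = (*)" "one complex_ring = 1"
  "zero complex_ring = 0" "add complex_ring = (+)"
  by (simp_all add: complex_ring_def)

lemma cring_complex_ring: "cring complex_ring"
proof (rule cringI)
  show "abelian_group complex_ring"
  proof (rule abelian_groupI)
    fix x :: complex
    assume "x \<in> carrier complex_ring"
    show "\<exists>y\<in>carrier complex_ring. y \<oplus>\<^bsub>complex_ring\<^esub> x = \<zero>\<^bsub>complex_ring\<^esub>"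
      by (rule bexI[of _ "- x"]) simp_all
  qed simp_all
  show "comm_monoid complex_ring"
    by (rule comm_monoidI) simp_all
qed (simp add: distrib_right)

lemma vars_add_subset: "vars p \<subseteq> V \<Longrightarrow> vars q \<subseteq> V \<Longrightarrow> vars (p + q) \<subseteq> V"
  using vars_add[of p q] by blast

lemma vars_diff_subset: "vars p \<subseteq> V \<Longrightarrow> vars q \<subseteq> V \<Longrightarrow> vars (p - q) \<subseteq> V"
  using vars_diff[of p q] by blast

lemma vars_mult_subset: "vars p \<subseteq> V \<Longrightarrow> vars q \<subseteq> V \<Longrightarrow> vars (p * q) \<subseteq> V"
  using vars_mult[of p q] by blast

lemma vars_power_subset: "vars p \<subseteq> V \<Longrightarrow> vars (p ^ k) \<subseteq> V"
  using vars_power[of p k] by blast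

lemma vars_pderiv_subset: "vars p \<subseteq> V \<Longrightarrow> vars (pderiv v p) \<subseteq> V"
  using vars_pderiv[of v p] by blast

lemma vars_halve_subset: "vars p \<subseteq> V \<Longrightarrow> vars (halve v e p) \<subseteq> V"
  using vars_halve[of v e p] by blast

lemma vars_Var_mult: "v \<in> V \<Longrightarrow> vars p \<subseteq> V \<Longrightarrow> vars (Var v * p) \<subseteq> V"
  by (rule vars_mult_subset) auto

lemma vars_Const_mult: "vars p \<subseteq> V \<Longrightarrow> vars (Const c * p) \<subseteq> V"
  by (rule vars_mult_subset) auto

lemma cring_poly_ring: "cring (poly_ring V)"
proof (rule cringI)
  show "abelian_group (poly_ring V)"
  proof (rule abelian_groupI)
    fix x assume "x \<in> carrier (poly_ring V)"
    then show "\<exists>y\<in>carrier (poly_ring V). y \<oplus>\<^bsub>poly_ring V\<^esub> x = \<zero>\<^bsub>poly_ring V\<^esub>"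
      by (intro bexI[of _ "- x"]) simp_all
  qed (simp_all add: vars_add_subset add_ac)
  show "comm_monoid (poly_ring V)"
    by (rule comm_monoidI) (simp_all add: vars_mult_subset mult_ac)
qed (simp add: distrib_right)

text \<open>Induction on polynomials in the variables \<open>V\<close> only. Setting all other variables to zero turns it
  into the unrestricted induction.\<close>
lemma mpoly_induct_vars [consumes 1, case_names Const add Var_mult]:
  assumes "vars p \<subseteq> V" and Const: "\<And>c. P (Const c)"
    and add: "\<And>p q. vars p \<subseteq> V \<Longrightarrow> vars q \<subseteq> V \<Longrightarrow> P p \<Longrightarrow> P q \<Longrightarrow> P (p + q)"
    and Var_mult: "\<And>v p. v \<in> V \<Longrightarrow> vars p \<subseteq> V \<Longrightarrow> P p \<Longrightarrow> P (Var v * p)"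
  shows "P p"
proof -
  define s where "s v = (if v \<in> V then Var v else 0)" for v
  have v: "vars (subst s q) \<subseteq> V" for q
    by (rule vars_subst_subset) (simp add: s_def)
  have "P (subst s q)" for q
  proof (induction q rule: mpoly_induct)
    case (Var_mult u q)
    have "P (s u * subst s q)"
      using Const[of 0] assms(4)[OF _ v Var_mult] by (cases "u \<in> V") (simp_all add: s_def[of u])
    then show ?case by simp
  qed (simp_all add: Const add v)
  moreover have "subst s p = p"
    by (rule subst_ident) (use assms(1) in \<open>auto simp: s_def\<close>)
  ultimately show ?thesis by metis
qed

lemma pderiv_not_occurring: "v \<notin> vars p \<Longrightarrow> pderiv v p = 0"
proof -
  assume v: "v \<notin> vars p"
  have "vars p \<subseteq> vars p" by simp
  then have "v \<notin> vars p \<longrightarrow> pderiv v p = 0" if "v \<notin> vars p"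
    by (induction p rule: mpoly_induct_vars) (use v in \<open>auto simp: pderiv_Var_mult pderiv_Var\<close>)
  then show ?thesis using v by simp
qed

text \<open>Closure under constants and variables suffices, since these generate the polynomial ring. Together
  with \<open>jac_ideal_least\<close> this is the tool for transporting Jacobian ideals: to show that all of
  \<open>jac_ideal V h\<close> has some property, it is checked that the property defines an ideal and holds for
  the partial derivatives.\<close>
lemma ideal_poly_ringI:
  assumes sub: "\<And>p. p \<in> I \<Longrightarrow> vars p \<subseteq> V" and zero: "0 \<in> I"
    and add: "\<And>p q. p \<in> I \<Longrightarrow> q \<in> I \<Longrightarrow> p + q \<in> I"
    and Const: "\<And>c p. p \<in> I \<Longrightarrow> Const c * p \<in> I"
    and Var: "\<And>v p. v \<in> V \<Longrightarrow> p \<in> I \<Longrightarrow> Var v * p \<in> I"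
  shows "ideal I (poly_ring V)"
proof -
  interpret cring "poly_ring V" by (rule cring_poly_ring)
  have mult: "q * p \<in> I" if "vars q \<subseteq> V" "p \<in> I" for p q
    using that(1)
  proof (induction q rule: mpoly_induct_vars)
    case (Var_mult v q)
    then show ?case using Var by (simp add: mult.assoc)
  qed (use that(2) in \<open>simp_all add: Const add distrib_right\<close>)
  have minus: "- p \<in> I" if "p \<in> I" for p
    using Const[OF that, of "- 1"] by (simp add: Const_uminus)
  have inv: "inv\<^bsub>add_monoid (poly_ring V)\<^esub> p = - p" if "p \<in> I" for p
    using minus_equality[of "- p" p] that sub by (simp add: a_inv_def)
  show ?thesis
  proof (rule idealI[OF ring_axioms])
    show "subgroup I (add_monoid (poly_ring V))"
      by (rule subgroup.intro) (use sub zero add minus inv in auto)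
  next
    fix a x assume "a \<in> I" "x \<in> carrier (poly_ring V)"
    then show "x \<otimes>\<^bsub>poly_ring V\<^esub> a \<in> I" "a \<otimes>\<^bsub>poly_ring V\<^esub> x \<in> I"
      using mult[of x a] by (auto simp: mult.commute)
  qed
qed

lemma ideal_poly_ringD:
  assumes "ideal I (poly_ring V)"
  shows "p \<in> I \<Longrightarrow> vars p \<subseteq> V" "0 \<in> I" "p \<in> I \<Longrightarrow> q \<in> I \<Longrightarrow> p + q \<in> I"
    "p \<in> I \<Longrightarrow> q \<in> I \<Longrightarrow> p - q \<in> I" "p \<in> I \<Longrightarrow> - p \<in> I"
    "vars q \<subseteq> V \<Longrightarrow> p \<in> I \<Longrightarrow> q * p \<in> I" "vars q \<subseteq> V \<Longrightarrow> p \<in> I \<Longrightarrow> p * q \<in> I"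
proof -
  interpret ideal I "poly_ring V" by fact
  show v: "p \<in> I \<Longrightarrow> vars p \<subseteq> V" for p using a_subset by auto
  show "0 \<in> I" using additive_subgroup.zero_closed[OF is_additive_subgroup] by simp
  show a: "p \<in> I \<Longrightarrow> q \<in> I \<Longrightarrow> p + q \<in> I" for p q
    using additive_subgroup.a_closed[OF is_additive_subgroup, of p q] by simp
  show m: "vars q \<subseteq> V \<Longrightarrow> p \<in> I \<Longrightarrow> q * p \<in> I" for p q using I_l_closed[of p q] by simp
  show "vars q \<subseteq> V \<Longrightarrow> p \<in> I \<Longrightarrow> p * q \<in> I" using m[of q p] by (simp add: mult.commute)
  show n: "p \<in> I \<Longrightarrow> - p \<in> I" for p using m[of "Const (- 1)" p] by (simp add: Const_uminus)
  show "p \<in> I \<Longrightarrow> q \<in> I \<Longrightarrow> p - q \<in> I" using a[of p "- q"] n[of q] by simp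
qed

lemma ideal_half:
  fixes p :: "'v mpoly"
  assumes "ideal I (poly_ring V)" "2 * p \<in> I" shows "p \<in> I"
proof -
  have "Const (1/2) * (2 * p) \<in> I"
    by (rule ideal_poly_ringD(6)[OF assms(1) _ assms(2)]) simp
  moreover have "Const (1/2) * 2 = (1 :: 'v mpoly)"
    using Const_mult[of "1/2" 2, where 'a = 'v] by simp
  ultimately show ?thesis by (simp flip: mult.assoc)
qed

lemma ideal_colon:
  assumes I: "ideal I (poly_ring W)" and V: "V \<subseteq> W"
  shows "ideal {q. vars q \<subseteq> V \<and> c * q \<in> I} (poly_ring V)" (is "ideal ?K _")
proof (rule ideal_poly_ringI)
  note ID = ideal_poly_ringD[OF I]
  fix v p assume v: "v \<in> V" and p: "p \<in> ?K"
  have "Var v * (c * p) \<in> I" by (rule ID(6)) (use v p V in auto)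
  then show "Var v * p \<in> ?K" using v p vars_Var_mult[of v V p] by (simp add: mult_ac)
next
  note ID = ideal_poly_ringD[OF I]
  fix d p assume p: "p \<in> ?K"
  have "Const d * (c * p) \<in> I" by (rule ID(6)) (use p in simp_all)
  then show "Const d * p \<in> ?K" using p vars_Const_mult[of p V d] by (simp add: mult_ac)
next
  show "p + q \<in> ?K" if "p \<in> ?K" "q \<in> ?K" for p q
    using that ideal_poly_ringD(3)[OF I, of "c * p" "c * q"] by (simp add: distrib_left vars_add_subset)
qed (simp_all add: ideal_poly_ringD(2)[OF I])

lemma ideal_jac_ideal:
  assumes "vars h \<subseteq> V" shows "ideal (jac_ideal V h) (poly_ring V)"
proof -
  interpret cring "poly_ring V" by (rule cring_poly_ring)
  show ?thesis
    unfolding jac_ideal_def by (rule genideal_ideal) (use assms vars_pderiv in fastforce)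
qed

lemma pderiv_in_jac_ideal:
  assumes "vars h \<subseteq> V" "v \<in> V" shows "pderiv v h \<in> jac_ideal V h"
proof -
  interpret cring "poly_ring V" by (rule cring_poly_ring)
  have "(\<lambda>v. pderiv v h) ` V \<subseteq> jac_ideal V h"
    unfolding jac_ideal_def by (rule genideal_self) (use assms vars_pderiv in fastforce)
  then show ?thesis using assms(2) by auto
qed

lemma jac_ideal_least:
  assumes "ideal I (poly_ring V)" "\<And>v. v \<in> V \<Longrightarrow> pderiv v h \<in> I"
  shows "jac_ideal V h \<subseteq> I"
proof -
  interpret cring "poly_ring V" by (rule cring_poly_ring)
  show ?thesis unfolding jac_ideal_def by (rule genideal_minimal) (use assms in auto)
qed

lemma jac_class_eq_image: "jac_class V h p = (\<lambda>i. i + p) ` jac_ideal V h"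
  by (auto simp: jac_class_def a_r_coset_def' poly_ring_def)

lemma jac_class_eq_iff:
  assumes "vars h \<subseteq> V"
  shows "jac_class V h p = jac_class V h q \<longleftrightarrow> p - q \<in> jac_ideal V h"
proof
  note I = ideal_poly_ringD[OF ideal_jac_ideal[OF assms]]
  show "p - q \<in> jac_ideal V h" if "jac_class V h p = jac_class V h q"
  proof -
    have "p \<in> jac_class V h p" using I(2) by (force simp: jac_class_eq_image)
    then show ?thesis using that by (auto simp: jac_class_eq_image)
  qed
  show "jac_class V h p = jac_class V h q" if "p - q \<in> jac_ideal V h"
  proof -
    have "\<exists>j\<in>jac_ideal V h. i + p = j + q" if "i \<in> jac_ideal V h" for i
      using I(3)[OF that \<open>p - q \<in> _\<close>] by (intro bexI[of _ "i + (p - q)"]) auto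
    moreover have "\<exists>j\<in>jac_ideal V h. i + q = j + p" if "i \<in> jac_ideal V h" for i
      using I(4)[OF that \<open>p - q \<in> _\<close>] by (intro bexI[of _ "i - (p - q)"]) auto
    ultimately show ?thesis unfolding jac_class_eq_image image_def by blast
  qed
qed

lemma jac_ops:
  assumes h: "vars h \<subseteq> V"
  shows carrier_jac: "carrier (jac V h) = jac_class V h ` {p. vars p \<subseteq> V}"
    and one_jac: "one (jac V h) = jac_class V h 1"
    and zero_jac: "zero (jac V h) = jac_class V h 0"
    and mult_jac: "vars p \<subseteq> V \<Longrightarrow> vars q \<subseteq> V \<Longrightarrow>
      jac_class V h p \<otimes>\<^bsub>jac V h\<^esub> jac_class V h q = jac_class V h (p * q)"
    and add_jac: "vars p \<subseteq> V \<Longrightarrow> vars q \<subseteq> V \<Longrightarrow>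
      jac_class V h p \<oplus>\<^bsub>jac V h\<^esub> jac_class V h q = jac_class V h (p + q)"
    and smult_jac: "vars p \<subseteq> V \<Longrightarrow> c \<odot>\<^bsub>jac V h\<^esub> jac_class V h p = jac_class V h (Const c * p)"
proof -
  interpret ideal "jac_ideal V h" "poly_ring V" by (rule ideal_jac_ideal[OF h])
  note I = ideal_poly_ringD[OF ideal_jac_ideal[OF h]]
  have "carrier (jac V h) = a_rcosets\<^bsub>poly_ring V\<^esub> jac_ideal V h"
    by (simp add: jac_def Let_def FactRing_def)
  also have "\<dots> = jac_class V h ` {p. vars p \<subseteq> V}"
    unfolding A_RCOSETS_def' jac_class_def by force
  finally show "carrier (jac V h) = jac_class V h ` {p. vars p \<subseteq> V}" .
  show "one (jac V h) = jac_class V h 1"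
    by (simp add: jac_def Let_def FactRing_def jac_class_def)
  show "zero (jac V h) = jac_class V h 0"
    by (simp add: jac_def Let_def FactRing_def jac_class_eq_image)
  show "jac_class V h p \<otimes>\<^bsub>jac V h\<^esub> jac_class V h q = jac_class V h (p * q)"
    if "vars p \<subseteq> V" "vars q \<subseteq> V"
    using rcoset_mult_add[of p q] that by (simp add: jac_def Let_def FactRing_def jac_class_def)
  show "jac_class V h p \<oplus>\<^bsub>jac V h\<^esub> jac_class V h q = jac_class V h (p + q)"
    if "vars p \<subseteq> V" "vars q \<subseteq> V"
    using a_rcos_sum[of p q] that by (simp add: jac_def Let_def FactRing_def jac_class_def)
  show "c \<odot>\<^bsub>jac V h\<^esub> jac_class V h p = jac_class V h (Const c * p)" if "vars p \<subseteq> V"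
  proof -
    have "jac_class V h (Const c * r) = jac_class V h (Const c * p)" if "r \<in> jac_class V h p" for r
    proof -
      have "Const c * (r - p) \<in> jac_ideal V h"
        by (rule I(6)) (use that in \<open>auto simp: jac_class_eq_image\<close>)
      then show ?thesis by (simp add: jac_class_eq_iff[OF h] right_diff_distrib)
    qed
    moreover have "p \<in> jac_class V h p" using I(2) by (force simp: jac_class_eq_image)
    ultimately have "(\<Union>r\<in>jac_class V h p. jac_class V h (Const c * r)) = jac_class V h (Const c * p)"
      by blast
    then show ?thesis by (simp add: jac_def Let_def)
  qed
qed

text \<open>The image of a commutative algebra under a map compatible with all operations is one again. Thus
  associativity, commutativity and distributivity need not be checked in the target.\<close>
lemma algebra_of_poly_hom:
  fixes B :: "(complex, 'b, 'q) module_scheme"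
  assumes hom: "h \<in> ring_hom (poly_ring V) B"
    and surj: "h ` carrier (poly_ring V) = carrier B" and zero: "h 0 = \<zero>\<^bsub>B\<^esub>"
    and smult: "\<And>c p. vars p \<subseteq> V \<Longrightarrow> c \<odot>\<^bsub>B\<^esub> h p = h (Const c * p)"
  shows "algebra complex_ring B"
proof -
  interpret P: cring "poly_ring V" by (rule cring_poly_ring)
  have "ring (B\<lparr>carrier := h ` carrier (poly_ring V), zero := h \<zero>\<^bsub>poly_ring V\<^esub>\<rparr>)"
    by (rule P.ring_hom_imp_img_ring[OF hom])
  moreover have "B\<lparr>carrier := h ` carrier (poly_ring V), zero := h \<zero>\<^bsub>poly_ring V\<^esub>\<rparr> = B"
    unfolding surj using zero by simp
  ultimately have "ring B" by simp
  then interpret B: ring B .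
  have h_mult: "h p \<otimes>\<^bsub>B\<^esub> h q = h (p * q)" and h_add: "h p \<oplus>\<^bsub>B\<^esub> h q = h (p + q)"
    if "vars p \<subseteq> V" "vars q \<subseteq> V" for p q
    using that hom ring_hom_mult[OF hom, of p q] ring_hom_add[OF hom, of p q] by simp_all
  have hB: "h p \<in> carrier B" if "vars p \<subseteq> V" for p
    using surj that by auto
  have rep: "\<exists>p. vars p \<subseteq> V \<and> x = h p" if "x \<in> carrier B" for x
    using that surj by auto
  have cring: "cring B"
  proof
    fix x y assume "x \<in> carrier B" "y \<in> carrier B"
    then show "x \<otimes>\<^bsub>B\<^esub> y = y \<otimes>\<^bsub>B\<^esub> x"
      using rep[of x] rep[of y] h_mult by (metis mult.commute)
  qed
  have C: "vars (Const c * p) \<subseteq> V" if "vars p \<subseteq> V" for c p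
    using that by (intro vars_mult_subset) auto
  show ?thesis
  proof (rule algebraI[OF cring_complex_ring cring])
    fix a x assume "x \<in> carrier B"
    then obtain p where p: "vars p \<subseteq> V" "x = h p" using rep by blast
    show "a \<odot>\<^bsub>B\<^esub> x \<in> carrier B"
      using p C by (simp add: smult hB)
    show "\<one>\<^bsub>complex_ring\<^esub> \<odot>\<^bsub>B\<^esub> x = x"
      using p by (simp add: smult)
    fix b
    show "(a \<oplus>\<^bsub>complex_ring\<^esub> b) \<odot>\<^bsub>B\<^esub> x = a \<odot>\<^bsub>B\<^esub> x \<oplus>\<^bsub>B\<^esub> b \<odot>\<^bsub>B\<^esub> x"
      using p C by (simp add: smult h_add Const_add distrib_right)
    show "(a \<otimes>\<^bsub>complex_ring\<^esub> b) \<odot>\<^bsub>B\<^esub> x = a \<odot>\<^bsub>B\<^esub> (b \<odot>\<^bsub>B\<^esub> x)"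
      using p C by (simp add: smult Const_mult mult.assoc)
  next
    fix a x y assume "x \<in> carrier B" "y \<in> carrier B"
    then obtain p q where p: "vars p \<subseteq> V" "x = h p" and q: "vars q \<subseteq> V" "y = h q"
      using rep by blast
    show "a \<odot>\<^bsub>B\<^esub> (x \<oplus>\<^bsub>B\<^esub> y) = a \<odot>\<^bsub>B\<^esub> x \<oplus>\<^bsub>B\<^esub> a \<odot>\<^bsub>B\<^esub> y"
      using p q C by (simp add: smult h_add distrib_left vars_add_subset)
    show "(a \<odot>\<^bsub>B\<^esub> x) \<otimes>\<^bsub>B\<^esub> y = a \<odot>\<^bsub>B\<^esub> (x \<otimes>\<^bsub>B\<^esub> y)"
      using p q C by (simp add: smult h_mult mult.assoc vars_mult_subset)
  qed
qed

lemma jac_class_hom: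
  assumes "vars h \<subseteq> V"
  shows "jac_class V h \<in> ring_hom (poly_ring V) (jac V h)"
  by (rule ring_hom_memI) (auto simp: carrier_jac one_jac mult_jac add_jac assms)

lemma algebra_jac:
  assumes "vars h \<subseteq> V" shows "algebra complex_ring (jac V h)"
  by (rule algebra_of_poly_hom[OF jac_class_hom])
    (use assms in \<open>simp_all add: carrier_jac zero_jac smult_jac\<close>)

lemma finsum_jac:
  assumes "vars h \<subseteq> V" "finite S" "\<And>i. i \<in> S \<Longrightarrow> vars (F i) \<subseteq> V"
  shows "finsum (jac V h) (\<lambda>i. jac_class V h (F i)) S = jac_class V h (sum F S)"
proof -
  interpret algebra complex_ring "jac V h" by (rule algebra_jac[OF assms(1)])
  show ?thesis
    using assms(2,3)
  proof (induction S rule: finite_induct)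
    case empty
    then show ?case by (simp add: zero_jac assms)
  next
    case (insert x S)
    have "vars (sum F S) \<subseteq> V"
      by (rule subset_trans[OF vars_sum UN_least]) (use insert in blast)
    then show ?case
      using insert
      by (subst M.finsum_insert) (auto simp: carrier_jac add_jac assms)
  qed
qed

text \<open>The homomorphism theorem for Jacobian algebras.\<close>
lemma algebra_iso_jacI:
  fixes B :: "(complex, 'b, 'q) module_scheme"
  assumes f: "vars f \<subseteq> V" and hom: "h \<in> ring_hom (poly_ring V) B"
    and surj: "h ` carrier (poly_ring V) = carrier B" and zero: "h 0 = \<zero>\<^bsub>B\<^esub>"
    and smult: "\<And>c p. vars p \<subseteq> V \<Longrightarrow> c \<odot>\<^bsub>B\<^esub> h p = h (Const c * p)"
    and ker: "\<And>p. vars p \<subseteq> V \<Longrightarrow> h p = \<zero>\<^bsub>B\<^esub> \<longleftrightarrow> p \<in> jac_ideal V f"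
  shows "\<exists>\<psi> \<in> algebra_iso complex_ring (jac V f) B. \<forall>p. vars p \<subseteq> V \<longrightarrow> \<psi> (jac_class V f p) = h p"
proof -
  have alg: "algebra complex_ring B" by (rule algebra_of_poly_hom[OF hom surj zero smult])
  then interpret B: algebra complex_ring B .
  interpret P: cring "poly_ring V" by (rule cring_poly_ring)
  interpret H: ring_hom_cring "poly_ring V" B h
    by (intro ring_hom_cring.intro ring_hom_cring_axioms.intro hom cring_poly_ring) unfold_locales
  have hB: "h p \<in> carrier B" if "vars p \<subseteq> V" for p
    using surj that by auto
  have inj: "h p = h q \<longleftrightarrow> jac_class V f p = jac_class V f q" if "vars p \<subseteq> V" "vars q \<subseteq> V" for p q
  proof -
    have "h (p - q) \<oplus>\<^bsub>B\<^esub> h q = h p"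
      using ring_hom_add[OF hom, of "p - q" q] that by (simp add: vars_diff_subset)
    then have "h p = h q \<longleftrightarrow> h (p - q) = \<zero>\<^bsub>B\<^esub>"
      using hB[OF that(1)] hB[OF that(2)] hB[of "p - q"] that
      by (metis B.M.add.l_cancel_one' B.M.add.m_comm vars_diff_subset)
    then show ?thesis
      using that by (simp add: ker jac_class_eq_iff f vars_diff_subset)
  qed
  define \<psi> where "\<psi> A = h (SOME p. vars p \<subseteq> V \<and> jac_class V f p = A)" for A
  have \<psi>: "\<psi> (jac_class V f p) = h p" if "vars p \<subseteq> V" for p
  proof -
    have "vars (SOME q. vars q \<subseteq> V \<and> jac_class V f q = jac_class V f p) \<subseteq> V \<and>
      jac_class V f (SOME q. vars q \<subseteq> V \<and> jac_class V f q = jac_class V f p) = jac_class V f p"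
      by (rule someI[of _ p]) (use that in auto)
    then show ?thesis using that inj by (simp add: \<psi>_def)
  qed
  have "\<psi> \<in> ring_iso (jac V f) B"
  proof (rule ring_iso_memI)
    show "\<psi> \<one>\<^bsub>jac V f\<^esub> = \<one>\<^bsub>B\<^esub>"
      using ring_hom_one[OF hom] by (simp add: one_jac f \<psi>)
    have "inj_on \<psi> (carrier (jac V f))"
      by (auto simp: inj_on_def carrier_jac f \<psi> inj)
    moreover have "\<psi> ` carrier (jac V f) = carrier B"
      unfolding surj[symmetric] by (auto simp: carrier_jac f \<psi> image_image)
    ultimately show "bij_betw \<psi> (carrier (jac V f)) (carrier B)"
      by (simp add: bij_betw_def)
  qed (auto simp: carrier_jac f \<psi> hB mult_jac add_jac vars_mult_subset vars_add_subset
      ring_hom_mult[OF hom, simplified] ring_hom_add[OF hom, simplified])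
  then have "\<psi> \<in> algebra_iso complex_ring (jac V f) B"
    unfolding algebra_iso_def using alg algebra_jac[OF f]
    by (auto simp: carrier_jac f \<psi> smult_jac smult vars_mult_subset)
  then show ?thesis using \<psi> by blast
qed

section \<open>Jacobian algebras of fixed loci\<close>

lemma vars_restr: "vars (restr n k p) \<subseteq> fixed n k"
  unfolding restr_def by (rule vars_subst_subset) (simp add: x_fix_def)

lemma restr_simps [simp]:
  "restr n k (p + q) = restr n k p + restr n k q" "restr n k (p * q) = restr n k p * restr n k q"
  "restr n k (p - q) = restr n k p - restr n k q" "restr n k (- p) = - restr n k p"
  "restr n k (Const c) = Const c" "restr n k 0 = 0" "restr n k 1 = 1" "restr n k (p ^ e) = restr n k p ^ e"
  "restr n k (sum F S) = (\<Sum>i\<in>S. restr n k (F i))"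
  by (simp_all add: restr_def)

lemma restr_Var [simp]: "restr n k (Var i) = (if i \<in> fixed n k then Var i else 0)"
  by (simp add: restr_def x_fix_def)

lemma restr_ident: "vars p \<subseteq> fixed n k \<Longrightarrow> restr n k p = p"
  unfolding restr_def by (rule subst_ident) (auto simp: x_fix_def)

text \<open>Since \<open>class_fix\<close> restricts its argument to the fixed locus, it is a ring homomorphism on all
  polynomials, and every computation in the sectors can be done on polynomials without keeping track
  of variables.\<close>
lemma class_fix_ops:
  shows carrier_jac_fix: "carrier (jac_fix n f k) = range (class_fix n f k)"
    and one_jac_fix: "one (jac_fix n f k) = class_fix n f k 1"
    and zero_jac_fix: "zero (jac_fix n f k) = class_fix n f k 0"
    and mult_jac_fix: "class_fix n f k p \<otimes>\<^bsub>jac_fix n f k\<^esub> class_fix n f k q = class_fix n f k (p * q)"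
    and add_jac_fix: "class_fix n f k p \<oplus>\<^bsub>jac_fix n f k\<^esub> class_fix n f k q = class_fix n f k (p + q)"
    and smult_jac_fix: "c \<odot>\<^bsub>jac_fix n f k\<^esub> class_fix n f k p = class_fix n f k (Const c * p)"
    and finsum_jac_fix: "finite S \<Longrightarrow>
      finsum (jac_fix n f k) (\<lambda>i. class_fix n f k (F i)) S = class_fix n f k (sum F S)"
proof -
  have "jac_class (fixed n k) (restr n k f) p \<in> range (class_fix n f k)" if "vars p \<subseteq> fixed n k" for p
    using that by (auto simp: class_fix_def restr_ident intro!: image_eqI[of _ _ p])
  then show "carrier (jac_fix n f k) = range (class_fix n f k)"
    using vars_restr[of n k] by (auto simp: jac_fix_def carrier_jac[OF vars_restr] class_fix_def)
qed (simp_all add: jac_fix_def class_fix_def one_jac zero_jac mult_jac add_jac smult_jac finsum_jac vars_restr)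

lemma algebra_jac_fix: "algebra complex_ring (jac_fix n f k)"
  unfolding jac_fix_def by (rule algebra_jac[OF vars_restr])

lemma class_fix_eq_iff:
  "class_fix n f k p = class_fix n f k q \<longleftrightarrow>
    restr n k p - restr n k q \<in> jac_ideal (fixed n k) (restr n k f)"
  unfolding class_fix_def by (rule jac_class_eq_iff[OF vars_restr])

section \<open>Coordinates in the Clifford modules\<close>

text \<open>The sign acquired by \<open>\<theta>\<^sub>i\<close> when it is moved to its place in \<open>\<theta>\<^sub>M\<close>.\<close>
definition ksign :: "nat \<Rightarrow> nat set \<Rightarrow> complex" where
  "ksign i M = (\<Prod>j<i. if j \<in> M then -1 else 1)"

lemma ksign_insert:
  assumes "j \<notin> M" shows "ksign i (insert j M) = (if j < i then - ksign i M else ksign i M)"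
proof (cases "j < i")
  case True
  have "(\<Prod>k\<in>{..<i} - {j}. if k \<in> insert j M then -1 else 1) =
    (\<Prod>k\<in>{..<i} - {j}. if k \<in> M then -1 else (1 :: complex))"
    by (rule prod.cong) auto
  then show ?thesis
    using True assms prod.remove[of "{..<i}" j "\<lambda>k. if k \<in> insert j M then -1 else (1 :: complex)"]
      prod.remove[of "{..<i}" j "\<lambda>k. if k \<in> M then -1 else (1 :: complex)"]
    by (simp add: ksign_def)
next
  case False
  then show ?thesis unfolding ksign_def by (auto intro!: prod.cong)
qed

lemma ksign_remove:
  assumes "j \<in> M" shows "ksign i (M - {j}) = (if j < i then - ksign i M else ksign i M)"
  using ksign_insert[of j "M - {j}" i] assms by (simp add: insert_absorb split: if_splits)

lemma ksign_square [simp]: "ksign i M * ksign i M = 1"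
  unfolding ksign_def prod.distrib[symmetric] by (rule prod.neutral) auto

text \<open>The Fock representation of the Clifford algebra on functions of subsets, the value at \<open>M\<close> being the
  coefficient of \<open>\<theta>\<^sub>M\<close>: left multiplication by \<open>\<theta>\<^sub>i\<close> and contraction with it.\<close>
definition create :: "nat \<Rightarrow> (nat set \<Rightarrow> complex) \<Rightarrow> nat set \<Rightarrow> complex" where
  "create i v M = (if i \<in> M then ksign i M * v (M - {i}) else 0)"

definition annihilate :: "nat \<Rightarrow> (nat set \<Rightarrow> complex) \<Rightarrow> nat set \<Rightarrow> complex" where
  "annihilate i v M = (if i \<in> M then 0 else ksign i M * v (insert i M))"

definition vac :: "nat set \<Rightarrow> complex" where
  "vac M = (if M = {} then 1 else 0)"

lemma create_create: "create i (create j v) M + create j (create i v) M = 0"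
  by (cases i j rule: linorder_cases)
    (auto simp: create_def ksign_remove Diff_insert[symmetric] insert_commute)

lemma annihilate_annihilate: "annihilate i (annihilate j v) M + annihilate j (annihilate i v) M = 0"
  by (cases i j rule: linorder_cases) (auto simp: annihilate_def ksign_insert insert_commute)

lemma annihilate_create:
  "annihilate i (create j v) M + create j (annihilate i v) M = (if i = j then v M else 0)"
proof (cases "i = j")
  case True
  then show ?thesis
    by (auto simp: annihilate_def create_def ksign_insert ksign_remove insert_absorb)
next
  case False
  then have "insert i M - {j} = insert i (M - {j})" by auto
  with False show ?thesis
    by (cases "i < j") (auto simp: annihilate_def create_def ksign_insert ksign_remove)
qed

text \<open>The relations are symmetric in the two kinds of generators. The flag \<open>s\<close> selects the kind that
  creates: \<open>True\<close> gives the module with basis \<open>\<theta>\<^sub>M\<close> and \<open>False\<close> the one with basis \<open>\<partial>\<theta>\<^sub>M\<close>, so that both are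
  treated at once.\<close>
fun creator :: "bool \<Rightarrow> nat \<Rightarrow> cgen" where
  "creator True = Theta" | "creator False = DTheta"

fun letter_act :: "bool \<Rightarrow> cgen \<Rightarrow> (nat set \<Rightarrow> complex) \<Rightarrow> nat set \<Rightarrow> complex" where
  "letter_act s (Theta i) = (if s then create i else annihilate i)"
| "letter_act s (DTheta i) = (if s then annihilate i else create i)"

lemma letter_act_creator [simp]:
  "letter_act s (creator s i) = create i" "letter_act s (creator (\<not> s) i) = annihilate i"
  by (cases s; simp)+

definition word_act :: "bool \<Rightarrow> cgen word \<Rightarrow> (nat set \<Rightarrow> complex) \<Rightarrow> nat set \<Rightarrow> complex" where
  "word_act s w = foldr (letter_act s) (letters w)"

definition act :: "bool \<Rightarrow> free_elt \<Rightarrow> (nat set \<Rightarrow> complex) \<Rightarrow> nat set \<Rightarrow> complex" where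
  "act s p v M = (\<Sum>w\<in>keys p. lookup p w * word_act s w v M)"

lemma letter_act_linear:
  "letter_act s x (\<lambda>M. c * u M + d * v M) M = c * letter_act s x u M + d * letter_act s x v M"
  by (cases x) (simp_all add: create_def annihilate_def algebra_simps)

lemma word_act_linear:
  "word_act s w (\<lambda>M. c * u M + d * v M) M = c * word_act s w u M + d * word_act s w v M"
proof -
  have "foldr (letter_act s) xs (\<lambda>M. c * u M + d * v M) =
    (\<lambda>M. c * foldr (letter_act s) xs u M + d * foldr (letter_act s) xs v M)" for xs
  proof (induction xs)
    case (Cons a xs)
    show ?case by (rule ext) (simp add: Cons letter_act_linear)
  qed simp
  then show ?thesis by (simp add: word_act_def)
qed

lemma word_act_plus: "word_act s (u + w) v = word_act s u (word_act s w v)"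
  by (simp add: word_act_def plus_word_def)

lemma act_add: "act s (p + q) v M = act s p v M + act s q v M"
  unfolding act_def by (rule setsum_keys_plus_distrib) (simp_all add: distrib_right)

lemma act_0 [simp]: "act s 0 v M = 0"
  by (simp add: act_def)

lemma act_uminus: "act s (- p) v M = - act s p v M"
  using act_add[of s p "- p" v M] by (simp add: eq_neg_iff_add_eq_0 add.commute)

lemma act_diff: "act s (p - q) v M = act s p v M - act s q v M"
  using act_add[of s p "- q" v M] by (simp add: act_uminus)

lemma act_sum: "act s (sum p S) v M = (\<Sum>i\<in>S. act s (p i) v M)"
  by (induction S rule: infinite_finite_induct) (simp_all add: act_add)

lemma act_single: "act s (single w c) v M = c * word_act s w v M"
  by (cases "c = 0") (simp_all add: act_def)

lemma act_mult: "act s (p * q) v = act s p (act s q v)"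
proof
  fix M
  have 1: "act s (single w c * q) v M = act s (single w c) (act s q v) M" for w c
  proof (induction q rule: poly_mapping_induct_single)
    case (single m d)
    have "act s (single m d) v = (\<lambda>M. d * word_act s m v M)"
      by (rule ext) (rule act_single)
    then show ?case
      using word_act_linear[of s w d "word_act s m v" 0 v M]
      by (simp add: mult_single act_single word_act_plus)
  next
    case (add p q)
    have "act s (p + q) v = (\<lambda>M. 1 * act s p v M + 1 * act s q v M)"
      by (rule ext) (simp add: act_add)
    then have "word_act s w (act s (p + q) v) M = word_act s w (act s p v) M + word_act s w (act s q v) M"
      by (simp only: word_act_linear) simp
    then show ?case using add by (simp add: distrib_left act_add[of s "_ * _"] act_single)
  qed
  show "act s (p * q) v M = act s p (act s q v) M"
    by (induction p rule: poly_mapping_induct_single) (simp_all add: 1 distrib_right act_add)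
qed

lemma act_zero_vec [simp]: "act s p (\<lambda>_. 0) = (\<lambda>_. 0)"
proof
  fix M
  show "act s p (\<lambda>_. 0) M = 0"
    using word_act_linear[of s _ 0 vac 0 vac M] by (simp add: act_def)
qed

lemma act_1 [simp]: "act s 1 v = v"
  by (rule ext) (simp add: act_single[of s 0 1, simplified] word_act_def zero_word_def)

lemma act_fscalar: "act s (fscalar c) v M = c * v M"
  by (simp add: fscalar_def act_single word_act_def zero_word_def)

lemma act_fgen: "act s (fgen x) v = letter_act s x v"
  by (rule ext) (simp add: fgen_def act_single word_act_def)

lemma act_prod_list:
  "act s (prod_list (map (\<lambda>i. fgen (h i)) xs)) v = foldr (\<lambda>i. letter_act s (h i)) xs v"
  by (induction xs) (simp_all add: act_mult act_fgen)

subsection \<open>The left ideal of the annihilators\<close>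

definition gens :: "nat \<Rightarrow> cgen set" where
  "gens n = Theta ` {1..n} \<union> DTheta ` {1..n}"

definition free_carrier :: "nat \<Rightarrow> free_elt set" where
  "free_carrier n = {p. \<forall>w\<in>keys p. set (letters w) \<subseteq> gens n}"

lemma free_algebra_simps [simp]:
  "carrier (free_algebra n) = free_carrier n"
  "mult (free_algebra n) = (*)" "one (free_algebra n) = 1" "zero (free_algebra n) = 0"
  "add (free_algebra n) = (+)"
  by (simp_all add: free_algebra_def free_carrier_def gens_def)

lemma free_carrier_closed:
  shows free_carrier_add: "p \<in> free_carrier n \<Longrightarrow> q \<in> free_carrier n \<Longrightarrow> p + q \<in> free_carrier n"
    and free_carrier_mult: "p \<in> free_carrier n \<Longrightarrow> q \<in> free_carrier n \<Longrightarrow> p * q \<in> free_carrier n"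
    and free_carrier_uminus: "p \<in> free_carrier n \<Longrightarrow> - p \<in> free_carrier n"
    and free_carrier_0: "0 \<in> free_carrier n" and free_carrier_1: "1 \<in> free_carrier n"
    and free_carrier_fscalar: "fscalar c \<in> free_carrier n"
    and free_carrier_fgen: "x \<in> gens n \<Longrightarrow> fgen x \<in> free_carrier n"
proof -
  show "p + q \<in> free_carrier n" if "p \<in> free_carrier n" "q \<in> free_carrier n"
    using that Poly_Mapping.keys_add[of p q] by (fastforce simp: free_carrier_def)
  show "p * q \<in> free_carrier n" if "p \<in> free_carrier n" "q \<in> free_carrier n"
    using that keys_mult[of p q] by (fastforce simp: free_carrier_def plus_word_def)
  show "- p \<in> free_carrier n" if "p \<in> free_carrier n"
    using that by (auto simp: free_carrier_def in_keys_iff)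
qed (auto simp: free_carrier_def fscalar_def fgen_def zero_word_def)

lemma free_carrier_diff: "p \<in> free_carrier n \<Longrightarrow> q \<in> free_carrier n \<Longrightarrow> p - q \<in> free_carrier n"
  using free_carrier_add[of p n "- q"] free_carrier_uminus[of q n] by simp

lemma free_carrier_sum: "(\<And>i. i \<in> S \<Longrightarrow> p i \<in> free_carrier n) \<Longrightarrow> sum p S \<in> free_carrier n"
  by (induction S rule: infinite_finite_induct) (simp_all add: free_carrier_closed)

lemma ring_free_algebra: "ring (free_algebra n)"
proof (rule ringI)
  show "abelian_group (free_algebra n)"
  proof (rule abelian_groupI, unfold free_algebra_simps(1))
    fix x assume "x \<in> free_carrier n"
    then show "\<exists>y\<in>free_carrier n. y \<oplus>\<^bsub>free_algebra n\<^esub> x = \<zero>\<^bsub>free_algebra n\<^esub>"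
      by (intro bexI[of _ "- x"]) (simp_all add: free_carrier_uminus)
  qed (simp_all add: free_carrier_closed add_ac)
  show "monoid (free_algebra n)"
    by (rule monoidI) (simp_all add: free_carrier_closed mult.assoc)
qed (simp_all add: ring_distribs)

abbreviation cliff_ideal :: "nat \<Rightarrow> free_elt set" where
  "cliff_ideal n \<equiv> genideal (free_algebra n) (clifford_relations n)"

lemma relations_carrier: "clifford_relations n \<subseteq> free_carrier n"
proof -
  have "fgen (Theta i) \<in> free_carrier n" "fgen (DTheta i) \<in> free_carrier n" if "i \<in> {1..n}" for i
    using that by (auto intro!: free_carrier_fgen simp: gens_def)
  then show ?thesis
    unfolding clifford_relations_def
    by (auto intro!: free_carrier_add free_carrier_mult free_carrier_diff free_carrier_0 free_carrier_1
        free_carrier_uminus)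
qed

lemma cliff_ideal: "ideal (cliff_ideal n) (free_algebra n)"
proof -
  interpret ring "free_algebra n" by (rule ring_free_algebra)
  show ?thesis
    by (rule genideal_ideal) (use relations_carrier in simp)
qed

lemma clifford_class_hom: "clifford_class n \<in> ring_hom (free_algebra n) (clifford n)"
proof -
  interpret ideal "cliff_ideal n" "free_algebra n" by (rule cliff_ideal)
  have "clifford_class n = (+>\<^bsub>free_algebra n\<^esub>) (cliff_ideal n)"
    by (rule ext) (simp add: clifford_class_def)
  then show ?thesis using rcos_ring_hom by (simp add: clifford_def)
qed

lemma ring_clifford: "ring (clifford n)"
  unfolding clifford_def by (rule ideal.quotient_is_ring[OF cliff_ideal])

lemma carrier_clifford: "carrier (clifford n) = clifford_class n ` free_carrier n"
  unfolding clifford_def FactRing_def clifford_class_def A_RCOSETS_def' by auto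

text \<open>The operators of the Fock representation satisfy the Clifford relations, so the representation
  factors through the Clifford algebra.\<close>
lemma act_cliff_ideal:
  assumes "p \<in> cliff_ideal n" shows "act s p v = (\<lambda>_. 0)"
proof -
  interpret ring "free_algebra n" by (rule ring_free_algebra)
  let ?D = "{p \<in> free_carrier n. \<forall>v. act s p v = (\<lambda>_. 0)}"
  have "ideal ?D (free_algebra n)"
  proof (rule idealI[OF ring_axioms])
    have "\<ominus>\<^bsub>free_algebra n\<^esub> p = - p" if "p \<in> free_carrier n" for p
      using minus_equality[of "- p" p] that free_carrier_uminus[OF that] by simp
    then show "subgroup ?D (add_monoid (free_algebra n))"
      by (intro subgroup.intro)
        (auto simp: act_add act_uminus free_carrier_closed fun_eq_iff a_inv_def)
  next
    fix a x assume "a \<in> ?D" "x \<in> carrier (free_algebra n)"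
    then show "x \<otimes>\<^bsub>free_algebra n\<^esub> a \<in> ?D" "a \<otimes>\<^bsub>free_algebra n\<^esub> x \<in> ?D"
      by (auto simp: act_mult free_carrier_mult)
  qed
  moreover have "clifford_relations n \<subseteq> ?D"
  proof
    fix p assume p: "p \<in> clifford_relations n"
    then have "act s p v M = 0" for v M
      by (cases s) (auto simp: clifford_relations_def act_add act_diff act_mult act_fgen
          create_create annihilate_annihilate eq_diff_eq[THEN iffD2, OF annihilate_create])
    then show "p \<in> ?D" using relations_carrier p by auto
  qed
  ultimately have "cliff_ideal n \<subseteq> ?D" by (rule genideal_minimal)
  then show ?thesis using assms by auto
qed

text \<open>The elements of the free algebra that vanish in the quotient of the Clifford algebra by the left
  ideal of the annihilators.\<close>
definition killed :: "bool \<Rightarrow> nat \<Rightarrow> free_elt set" where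
  "killed s n = {p \<in> free_carrier n. clifford_class n p
     \<in> left_ideal (clifford n) ((\<lambda>i. clifford_class n (fgen (creator (\<not> s) i))) ` {1..n})}"

lemma creator_gens: "i \<in> {1..n} \<Longrightarrow> creator s i \<in> gens n"
  by (cases s) (auto simp: gens_def)

lemma left_ideal_closed:
  shows left_ideal_zero: "\<zero>\<^bsub>R\<^esub> \<in> left_ideal R S"
    and left_ideal_add: "x \<in> left_ideal R S \<Longrightarrow> y \<in> left_ideal R S \<Longrightarrow> x \<oplus>\<^bsub>R\<^esub> y \<in> left_ideal R S"
    and left_ideal_mult: "a \<in> carrier R \<Longrightarrow> x \<in> left_ideal R S \<Longrightarrow> a \<otimes>\<^bsub>R\<^esub> x \<in> left_ideal R S"
    and left_ideal_gen: "x \<in> S \<Longrightarrow> x \<in> left_ideal R S"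
  unfolding left_ideal_def
  by (auto simp: additive_subgroup.zero_closed intro: additive_subgroup.a_closed)

lemma clifford_class_ops:
  assumes "p \<in> free_carrier n" "q \<in> free_carrier n"
  shows "clifford_class n p \<oplus>\<^bsub>clifford n\<^esub> clifford_class n q = clifford_class n (p + q)"
    "clifford_class n p \<otimes>\<^bsub>clifford n\<^esub> clifford_class n q = clifford_class n (p * q)"
  using ring_hom_add[OF clifford_class_hom, of p n q] ring_hom_mult[OF clifford_class_hom, of p n q] assms
  by simp_all

lemma cliff_ideal_carrier: "p \<in> cliff_ideal n \<Longrightarrow> p \<in> free_carrier n"
  using additive_subgroup.a_subset[OF ideal.axioms(1)[OF cliff_ideal], of n] by auto

lemma clifford_class_ideal:
  assumes "p \<in> cliff_ideal n"
  shows "clifford_class n p = \<zero>\<^bsub>clifford n\<^esub>"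
proof -
  interpret F: ring "free_algebra n" by (rule ring_free_algebra)
  show ?thesis
    using F.a_coset_join2[of p "cliff_ideal n"] assms cliff_ideal_carrier
      additive_subgroup.a_subgroup[OF ideal.axioms(1)[OF cliff_ideal]]
    by (simp add: clifford_class_def clifford_def FactRing_def)
qed

lemma killed_closed:
  shows killed_add: "p \<in> killed s n \<Longrightarrow> q \<in> killed s n \<Longrightarrow> p + q \<in> killed s n"
    and killed_0: "0 \<in> killed s n"
    and killed_mult: "a \<in> free_carrier n \<Longrightarrow> p \<in> killed s n \<Longrightarrow> a * p \<in> killed s n"
    and killed_annihilator: "i \<in> {1..n} \<Longrightarrow> fgen (creator (\<not> s) i) \<in> killed s n"
    and killed_ideal: "p \<in> cliff_ideal n \<Longrightarrow> p \<in> killed s n"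
proof -
  let ?S = "(\<lambda>i. clifford_class n (fgen (creator (\<not> s) i))) ` {1..n}"
  show "p + q \<in> killed s n" if "p \<in> killed s n" "q \<in> killed s n"
    using that left_ideal_add[of "clifford_class n p" "clifford n" ?S "clifford_class n q"]
    by (simp add: killed_def free_carrier_add clifford_class_ops)
  show "a * p \<in> killed s n" if "a \<in> free_carrier n" "p \<in> killed s n"
    using that left_ideal_mult[of "clifford_class n a" "clifford n" "clifford_class n p" ?S]
    by (simp add: killed_def free_carrier_mult clifford_class_ops carrier_clifford)
  show "fgen (creator (\<not> s) i) \<in> killed s n" if "i \<in> {1..n}"
    unfolding killed_def
    by (intro CollectI conjI free_carrier_fgen creator_gens that left_ideal_gen imageI)
  show *: "p \<in> killed s n" if "p \<in> cliff_ideal n" for p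
    using that by (simp add: killed_def clifford_class_ideal left_ideal_zero cliff_ideal_carrier)
  show "0 \<in> killed s n"
    using *[of 0] additive_subgroup.zero_closed[OF ideal.axioms(1)[OF cliff_ideal], of n] by simp
qed

text \<open>The classes of elements killing the vacuum form a left ideal that contains the annihilators. This
  gives the linear independence of the monomials \<open>\<theta>\<^sub>M\<close> in the quotient module.\<close>
lemma killed_act:
  assumes "p \<in> killed s n" shows "act s p vac = (\<lambda>_. 0)"
proof -
  interpret F: ring "free_algebra n" by (rule ring_free_algebra)
  interpret C: ring "clifford n" by (rule ring_clifford)
  interpret I: ideal "cliff_ideal n" "free_algebra n" by (rule cliff_ideal)
  interpret h: ring_hom_ring "free_algebra n" "clifford n" "clifford_class n"
    by (rule ring_hom_ringI2[OF F.ring_axioms C.ring_axioms clifford_class_hom])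
  note hom = clifford_class_hom[of n]
  let ?K = "{p \<in> free_carrier n. act s p vac = (\<lambda>_. 0)}"
  let ?H = "clifford_class n ` ?K"
  have neg: "\<ominus>\<^bsub>clifford n\<^esub> clifford_class n q = clifford_class n (- q)" if "q \<in> free_carrier n" for q
    using F.minus_equality[of "- q" q] h.hom_a_inv[of q] that free_carrier_uminus[OF that]
    by simp
  have "additive_subgroup ?H (clifford n)"
  proof (rule additive_subgroup.intro, rule subgroup.intro)
    show "?H \<subseteq> carrier (add_monoid (clifford n))" by (auto simp: carrier_clifford)
    show "\<one>\<^bsub>add_monoid (clifford n)\<^esub> \<in> ?H"
      using h.hom_zero by (auto intro!: image_eqI[of _ _ 0] simp: free_carrier_0 fun_eq_iff)
    fix x assume "x \<in> ?H"
    then obtain q where q: "q \<in> free_carrier n" "act s q vac = (\<lambda>_. 0)" "x = clifford_class n q"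
      by auto
    have "inv\<^bsub>add_monoid (clifford n)\<^esub> x = clifford_class n (- q)"
      using neg[OF q(1)] q(3) unfolding a_inv_def by simp
    then show "inv\<^bsub>add_monoid (clifford n)\<^esub> x \<in> ?H"
      using q(1,2) by (auto simp: fun_eq_iff act_uminus intro!: imageI free_carrier_uminus)
    fix y assume "y \<in> ?H"
    then show "x \<otimes>\<^bsub>add_monoid (clifford n)\<^esub> y \<in> ?H"
      using \<open>x \<in> ?H\<close> by (auto simp: clifford_class_ops fun_eq_iff act_add intro!: imageI free_carrier_add)
  qed
  moreover have "(\<lambda>i. clifford_class n (fgen (creator (\<not> s) i))) ` {1..n} \<subseteq> ?H"
    by (auto intro!: imageI free_carrier_fgen creator_gens simp: act_fgen fun_eq_iff annihilate_def vac_def)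
  moreover have "\<forall>a\<in>carrier (clifford n). \<forall>h\<in>?H. a \<otimes>\<^bsub>clifford n\<^esub> h \<in> ?H"
    by (auto simp: carrier_clifford clifford_class_ops act_mult intro!: imageI free_carrier_mult)
  ultimately have "left_ideal (clifford n) ((\<lambda>i. clifford_class n (fgen (creator (\<not> s) i))) ` {1..n}) \<subseteq> ?H"
    unfolding left_ideal_def by blast
  then obtain q where q: "q \<in> free_carrier n" "act s q vac = (\<lambda>_. 0)" "clifford_class n p = clifford_class n q"
    and p: "p \<in> free_carrier n"
    using assms unfolding killed_def by auto
  have "p - q \<in> cliff_ideal n"
  proof -
    have "p \<in> cliff_ideal n +>\<^bsub>free_algebra n\<^esub> q"
      using q(3) additive_subgroup.zero_closed[OF I.is_additive_subgroup]
      by (auto simp: clifford_class_def a_r_coset_def' dest: equalityD1)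
    then show ?thesis by (auto simp: a_r_coset_def')
  qed
  then have "act s (p - q) vac M = 0" for M by (simp add: act_cliff_ideal)
  then show ?thesis using q(2) by (simp add: fun_eq_iff act_diff)
qed

subsection \<open>Ordered monomials span the quotient module\<close>

definition cprod :: "bool \<Rightarrow> nat list \<Rightarrow> free_elt" where
  "cprod s xs = prod_list (map (\<lambda>i. fgen (creator s i)) xs)"

lemma cprod_simps [simp]: "cprod s [] = 1" "cprod s (x # xs) = fgen (creator s x) * cprod s xs"
  by (simp_all add: cprod_def)

lemma cprod_carrier: "set xs \<subseteq> {1..n} \<Longrightarrow> cprod s xs \<in> free_carrier n"
  by (induction xs) (auto intro!: free_carrier_1 free_carrier_mult free_carrier_fgen creator_gens)

lemma fscalar_simps [simp]: "fscalar 0 = 0" "fscalar 1 = 1" "fscalar (- c) = - fscalar c"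
  "fscalar (c + d) = fscalar c + fscalar d" "fscalar (c * d) = fscalar c * fscalar d"
  by (simp_all add: fscalar_def single_uminus single_add mult_single)

lemma fscalar_commute: "p * fscalar c = fscalar c * p"
  by (induction p rule: poly_mapping_induct_single)
    (simp_all add: fscalar_def mult_single mult.commute distrib_left distrib_right)

lemma killed_scale: "p \<in> killed s n \<Longrightarrow> fscalar c * p \<in> killed s n"
  by (rule killed_mult[OF free_carrier_fscalar])

lemma killed_uminus: "p \<in> killed s n \<Longrightarrow> - p \<in> killed s n"
  using killed_scale[of p s n "- 1"] by simp

lemma killed_diff: "p \<in> killed s n \<Longrightarrow> q \<in> killed s n \<Longrightarrow> p - q \<in> killed s n"
  using killed_add[of p s n "- q"] killed_uminus[of q s n] by simp

text \<open>The Clifford relations in the form in which they act on a remaining factor \<open>p\<close>.\<close>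
lemma killed_relation:
  assumes "i \<in> {1..n}" "j \<in> {1..n}" "p \<in> free_carrier n"
  shows "fgen (creator s i) * (fgen (creator s j) * p) + fgen (creator s j) * (fgen (creator s i) * p)
      \<in> killed s n" (is ?A)
    and "fgen (creator (\<not> s) i) * (fgen (creator s j) * p) + fgen (creator s j) * (fgen (creator (\<not> s) i) * p)
      - (if i = j then p else 0) \<in> killed s n" (is ?B)
proof -
  interpret F: ring "free_algebra n" by (rule ring_free_algebra)
  interpret I: ideal "cliff_ideal n" "free_algebra n" by (rule cliff_ideal)
  have rel: "r * p \<in> killed s n" if "r \<in> clifford_relations n" for r
  proof -
    have "r \<in> cliff_ideal n"
      using F.genideal_self[of "clifford_relations n"] relations_carrier that by auto
    then have "r * p \<in> cliff_ideal n" using I.I_r_closed[of r p] assms(3) by simp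
    then show ?thesis by (rule killed_ideal)
  qed
  have 1: "fgen (Theta i) * fgen (Theta j) + fgen (Theta j) * fgen (Theta i) \<in> clifford_relations n"
    "fgen (DTheta i) * fgen (DTheta j) + fgen (DTheta j) * fgen (DTheta i) \<in> clifford_relations n"
    using assms unfolding clifford_relations_def by blast+
  have 2: "fgen (DTheta i) * fgen (Theta j) - ((if i = j then 1 else 0) - fgen (Theta j) * fgen (DTheta i))
      \<in> clifford_relations n" if "i \<in> {1..n}" "j \<in> {1..n}" for i j
    using that unfolding clifford_relations_def by blast
  show ?A
    using rel[OF 1(1)] rel[OF 1(2)] by (cases s) (simp_all add: distrib_right mult.assoc)
  show ?B
    using rel[OF 2[of i j]] rel[OF 2[of j i]] assms
    by (cases s; cases "i = j") (simp_all add: distrib_right left_diff_distrib mult.assoc algebra_simps)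
qed

text \<open>Insertion sort: the new creator is moved past the smaller ones, and a repeated one gives zero. The
  scalar \<open>c\<close> is left unspecified here because \<open>killed_act\<close> determines it afterwards; only the shape of
  the result matters.\<close>
lemma creator_cprod:
  assumes "i \<in> {1..n}" "sorted xs" "distinct xs" "set xs \<subseteq> {1..n}"
  shows "\<exists>c ys. sorted ys \<and> distinct ys \<and> set ys \<subseteq> insert i (set xs) \<and>
    fgen (creator s i) * cprod s xs - fscalar c * cprod s ys \<in> killed s n"
  using assms(2-4)
proof (induction xs)
  case Nil
  have "fgen (creator s i) * cprod s [] - fscalar 1 * cprod s [i] \<in> killed s n"
    by (simp add: killed_0)
  then show ?case by (intro exI[of _ 1] exI[of _ "[i]"]) simp
next
  case (Cons a xs)
  have P: "cprod s xs \<in> free_carrier n" and a: "a \<in> {1..n}"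
    using Cons.prems by (simp_all add: cprod_carrier)
  note rel = killed_relation(1)[OF assms(1) a P, of s]
  consider "i < a" | "i = a" | "a < i" by linarith
  then show ?case
  proof cases
    case 1
    have "fgen (creator s i) * cprod s (a # xs) - fscalar 1 * cprod s (i # a # xs) \<in> killed s n"
      by (simp add: killed_0)
    then show ?thesis using 1 Cons.prems by (intro exI[of _ 1] exI[of _ "i # a # xs"]) auto
  next
    case 2
    let ?p = "fgen (creator s i) * cprod s (a # xs)"
    have "fscalar (1/2) * (?p + ?p) \<in> killed s n"
      using killed_scale[OF rel, of "1/2"] 2 by simp
    also have "fscalar (1/2) * (?p + ?p) = fscalar (1/2 + 1/2) * ?p"
      by (simp only: fscalar_simps distrib_left distrib_right)
    finally have "?p - fscalar 0 * cprod s [] \<in> killed s n" by simp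
    then show ?thesis by (intro exI[of _ 0] exI[of _ "[]"]) simp
  next
    case 3
    obtain c ys where ys: "sorted ys" "distinct ys" "set ys \<subseteq> insert i (set xs)"
      "fgen (creator s i) * cprod s xs - fscalar c * cprod s ys \<in> killed s n"
      using Cons by auto
    have "fgen (creator s a) * (fgen (creator s i) * cprod s xs - fscalar c * cprod s ys) \<in> killed s n"
      by (intro killed_mult ys free_carrier_fgen creator_gens a)
    from killed_diff[OF rel this]
    have "fgen (creator s i) * cprod s (a # xs) - fscalar (- c) * cprod s (a # ys) \<in> killed s n"
      by (simp add: right_diff_distrib mult.assoc[symmetric] fscalar_commute)
    moreover have "sorted (a # ys)" "distinct (a # ys)" "set (a # ys) \<subseteq> insert i (set (a # xs))"
      using ys(1-3) 3 Cons.prems by (auto simp: less_imp_le)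
    ultimately show ?thesis by blast
  qed
qed

text \<open>An annihilator without partner moves to the right end, where it lies in the left ideal.\<close>
lemma annihilator_cprod_absent:
  assumes "i \<in> {1..n}" "i \<notin> set xs" "set xs \<subseteq> {1..n}"
  shows "fgen (creator (\<not> s) i) * cprod s xs \<in> killed s n"
  using assms(2,3)
proof (induction xs)
  case Nil
  then show ?case using killed_annihilator[OF assms(1)] by simp
next
  case (Cons a xs)
  have P: "cprod s xs \<in> free_carrier n" and a: "a \<in> {1..n}"
    using Cons.prems by (simp_all add: cprod_carrier)
  have "fgen (creator s a) * (fgen (creator (\<not> s) i) * cprod s xs) \<in> killed s n"
    by (intro killed_mult free_carrier_fgen creator_gens a Cons.IH) (use Cons.prems in simp_all)
  from killed_diff[OF killed_relation(2)[OF assms(1) a P, of s] this] Cons.prems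
  show ?case by (simp split: if_splits)
qed

lemma annihilator_cprod:
  assumes "i \<in> {1..n}" "sorted xs" "distinct xs" "set xs \<subseteq> {1..n}"
  shows "\<exists>c ys. sorted ys \<and> distinct ys \<and> set ys \<subseteq> set xs \<and>
    fgen (creator (\<not> s) i) * cprod s xs - fscalar c * cprod s ys \<in> killed s n"
  using assms(2-4)
proof (induction xs)
  case Nil
  have "fgen (creator (\<not> s) i) * cprod s [] - fscalar 0 * cprod s [] \<in> killed s n"
    using killed_annihilator[OF assms(1)] by simp
  then show ?case by (intro exI[of _ 0] exI[of _ "[]"]) simp
next
  case (Cons a xs)
  have P: "cprod s xs \<in> free_carrier n" and a: "a \<in> {1..n}"
    using Cons.prems by (simp_all add: cprod_carrier)
  note rel = killed_relation(2)[OF assms(1) a P, of s]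
  obtain c ys where ys: "sorted ys" "distinct ys" "set ys \<subseteq> set xs"
    "fgen (creator (\<not> s) i) * cprod s xs - fscalar c * cprod s ys \<in> killed s n"
    using Cons by auto
  have "fgen (creator s a) * (fgen (creator (\<not> s) i) * cprod s xs - fscalar c * cprod s ys) \<in> killed s n"
    by (intro killed_mult ys free_carrier_fgen creator_gens a)
  note rel' = killed_diff[OF rel this]
  have sd: "sorted (a # ys)" "distinct (a # ys)" "set (a # ys) \<subseteq> set (a # xs)"
    using ys(1-3) Cons.prems by auto
  show ?case
  proof (cases "i = a")
    case False
    have "fgen (creator (\<not> s) i) * cprod s (a # xs) - fscalar (- c) * cprod s (a # ys) \<in> killed s n"
      using rel' False by (simp add: right_diff_distrib mult.assoc[symmetric] fscalar_commute)
    then show ?thesis using sd by blast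
  next
    case True
    have "fgen (creator s a) * (fgen (creator (\<not> s) i) * cprod s xs) \<in> killed s n"
      using Cons.prems True a
      by (intro killed_mult free_carrier_fgen creator_gens annihilator_cprod_absent) auto
    from killed_diff[OF rel this]
    have "fgen (creator (\<not> s) i) * cprod s (a # xs) - fscalar 1 * cprod s xs \<in> killed s n"
      using True by (simp add: algebra_simps)
    then show ?thesis using Cons.prems by (intro exI[of _ 1] exI[of _ xs]) auto
  qed
qed

definition combination :: "bool \<Rightarrow> nat \<Rightarrow> (nat set \<Rightarrow> complex) \<Rightarrow> free_elt" where
  "combination s n c = (\<Sum>M\<in>Pow {1..n}. fscalar (c M) * cprod s (sorted_list_of_set M))"

definition expandable :: "bool \<Rightarrow> nat \<Rightarrow> free_elt set" where
  "expandable s n = {p. \<exists>c. (\<forall>M. \<not> M \<subseteq> {1..n} \<longrightarrow> c M = 0) \<and> p - combination s n c \<in> killed s n}"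

lemma combination_linear:
  "combination s n (\<lambda>M. a * c M + d M) = fscalar a * combination s n c + combination s n d"
  by (simp add: combination_def sum_distrib_left sum.distrib distrib_right mult.assoc)

lemma expandable_linear:
  assumes "p \<in> expandable s n" "q \<in> expandable s n" shows "fscalar a * p + q \<in> expandable s n"
proof -
  obtain c where c: "\<And>M. \<not> M \<subseteq> {1..n} \<Longrightarrow> c M = 0" "p - combination s n c \<in> killed s n"
    using assms(1) unfolding expandable_def by blast
  obtain d where d: "\<And>M. \<not> M \<subseteq> {1..n} \<Longrightarrow> d M = 0" "q - combination s n d \<in> killed s n"
    using assms(2) unfolding expandable_def by blast
  have "fscalar a * p + q - combination s n (\<lambda>M. a * c M + d M) \<in> killed s n"
    using killed_add[OF killed_scale[OF c(2), of a] d(2)]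
    unfolding combination_linear by (simp add: algebra_simps)
  then show ?thesis
    unfolding expandable_def using c(1) d(1) by (intro CollectI exI[of _ "\<lambda>M. a * c M + d M"]) simp
qed

lemma expandable_killed:
  assumes "p \<in> killed s n" shows "p \<in> expandable s n"
proof -
  have "p - combination s n (\<lambda>_. 0) \<in> killed s n" using assms by (simp add: combination_def)
  then show ?thesis unfolding expandable_def by (intro CollectI exI[of _ "\<lambda>_. 0"]) simp
qed

lemma expandable_add: "p \<in> expandable s n \<Longrightarrow> q \<in> expandable s n \<Longrightarrow> p + q \<in> expandable s n"
  using expandable_linear[of p s n q 1] by simp

lemma expandable_scale: "p \<in> expandable s n \<Longrightarrow> fscalar a * p \<in> expandable s n"
  using expandable_linear[of p s n 0 a] expandable_killed[OF killed_0] by simp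

lemma expandable_cprod:
  assumes "sorted xs" "distinct xs" "set xs \<subseteq> {1..n}"
  shows "cprod s xs \<in> expandable s n"
proof -
  have "combination s n (\<lambda>M. if M = set xs then 1 else 0) =
    (\<Sum>M\<in>Pow {1..n}. if M = set xs then cprod s (sorted_list_of_set M) else 0)"
    unfolding combination_def by (intro sum.cong) auto
  also have "\<dots> = cprod s xs"
    using assms by (simp add: sorted_list_of_set.idem_if_sorted_distinct)
  finally have "cprod s xs - combination s n (\<lambda>M. if M = set xs then 1 else 0) \<in> killed s n"
    by (simp add: killed_0)
  then show ?thesis
    unfolding expandable_def using assms
    by (intro CollectI exI[of _ "\<lambda>M. if M = set xs then 1 else 0"]) auto
qed

lemma expandable_sum: "(\<And>i. i \<in> S \<Longrightarrow> p i \<in> expandable s n) \<Longrightarrow> sum p S \<in> expandable s n"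
  by (induction S rule: infinite_finite_induct)
    (simp_all add: expandable_add expandable_killed killed_0)

lemma expandable_fgen:
  assumes "p \<in> expandable s n" "x \<in> gens n"
  shows "fgen x * p \<in> expandable s n"
proof -
  obtain c where c: "p - combination s n c \<in> killed s n"
    using assms unfolding expandable_def by blast
  have *: "fgen x * cprod s (sorted_list_of_set M) \<in> expandable s n" if M: "M \<subseteq> {1..n}" for M
  proof -
    let ?xs = "sorted_list_of_set M"
    have fin: "finite M" using M finite_subset by blast
    obtain t i where x: "x = creator t i" and i: "i \<in> {1..n}"
      using assms(2) creator.simps unfolding gens_def by (metis Un_iff imageE)
    have "\<exists>c ys. sorted ys \<and> distinct ys \<and> set ys \<subseteq> {1..n} \<and>
      fgen x * cprod s ?xs - fscalar c * cprod s ys \<in> killed s n"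
    proof (cases "t = s")
      case True
      then show ?thesis
        using creator_cprod[OF i, of ?xs s] M fin x i by (simp add: set_sorted_list_of_set)
          (meson insert_subset order_trans atLeastAtMost_iff One_nat_def)
    next
      case False
      then have "t = (\<not> s)" by auto
      then show ?thesis
        using annihilator_cprod[OF i, of ?xs s] M fin x by (simp add: set_sorted_list_of_set) (meson order_trans)
    qed
    then obtain d ys where ys: "sorted ys" "distinct ys" "set ys \<subseteq> {1..n}"
      "fgen x * cprod s ?xs - fscalar d * cprod s ys \<in> killed s n" by blast
    have "(fgen x * cprod s ?xs - fscalar d * cprod s ys) + fscalar d * cprod s ys \<in> expandable s n"
      by (intro expandable_add expandable_killed ys expandable_scale expandable_cprod)
    then show ?thesis by simp
  qed
  have "fgen x * combination s n c =
    (\<Sum>M\<in>Pow {1..n}. fscalar (c M) * (fgen x * cprod s (sorted_list_of_set M)))"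
    by (simp add: combination_def sum_distrib_left mult.assoc[symmetric] fscalar_commute)
  then have "fgen x * combination s n c \<in> expandable s n"
    by (simp only: expandable_sum expandable_scale * PowD)
  moreover have "fgen x * (p - combination s n c) \<in> expandable s n"
    by (intro expandable_killed killed_mult c free_carrier_fgen assms)
  ultimately have "fgen x * (p - combination s n c) + fgen x * combination s n c \<in> expandable s n"
    by (rule expandable_add[rotated])
  then show ?thesis by (simp add: right_diff_distrib)
qed

lemma expandable_free:
  assumes "p \<in> free_carrier n" shows "p \<in> expandable s n"
proof -
  have w: "set w \<subseteq> gens n \<Longrightarrow> single (Word w) 1 \<in> expandable s n" for w
  proof (induction w)
    case Nil
    have "cprod s [] \<in> expandable s n" by (rule expandable_cprod) simp_all
    then show ?case by (simp add: zero_word_def[symmetric])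
  next
    case (Cons x w)
    have "single (Word (x # w)) 1 = fgen x * single (Word w) 1"
      by (simp add: fgen_def mult_single plus_word_def)
    then show ?case using Cons by (simp add: expandable_fgen)
  qed
  have "fscalar (lookup p w) * single w 1 \<in> expandable s n"
    if "w \<in> keys p" for w
    using that assms w[of "letters w"] by (intro expandable_scale) (auto simp: free_carrier_def)
  then have "(\<Sum>w\<in>keys p. fscalar (lookup p w) * single w 1)
      \<in> expandable s n" by (rule expandable_sum)
  also have "(\<Sum>w\<in>keys p. fscalar (lookup p w) * single w 1) = p"
    by (simp add: fscalar_def mult_single poly_mapping_eq_sum_single[symmetric])
  finally show ?thesis .
qed

lemma act_cprod: "act s (cprod s xs) v = foldr create xs v"
  by (simp add: cprod_def act_prod_list)

lemma act_cprod_opposite: "act s (cprod (\<not> s) xs) v = foldr annihilate xs v"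
  by (simp add: cprod_def act_prod_list)

lemma foldr_create_sorted:
  "sorted xs \<Longrightarrow> distinct xs \<Longrightarrow> foldr create xs vac = (\<lambda>M. if M = set xs then 1 else 0)"
proof (induction xs)
  case Nil
  then show ?case by (simp add: vac_def fun_eq_iff)
next
  case (Cons a xs)
  have "ksign a (insert a (set xs)) = 1"
    unfolding ksign_def by (rule prod.neutral) (use Cons.prems in auto)
  then show ?case
    using Cons by (auto simp: create_def fun_eq_iff)
qed

lemma act_combination:
  assumes "\<And>M. \<not> M \<subseteq> {1..n} \<Longrightarrow> c M = 0"
  shows "act s (combination s n c) vac = c"
proof
  fix M
  have "act s (combination s n c) vac M =
    (\<Sum>K\<in>Pow {1..n}. c K * foldr create (sorted_list_of_set K) vac M)"
    by (simp add: combination_def act_sum act_mult act_fscalar act_cprod)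
  also have "\<dots> = (\<Sum>K\<in>Pow {1..n}. if K = M then c M else 0)"
    by (intro sum.cong refl) (auto simp: foldr_create_sorted finite_subset)
  also have "\<dots> = c M" using assms by auto
  finally show "act s (combination s n c) vac M = c M" .
qed

text \<open>Applying a combination of ordered monomials to the vacuum returns its coefficients, and elements of
  the left ideal kill the vacuum. Hence the coordinates, which exist because \<open>p\<close> is expandable, are
  read off from the action of \<open>p\<close> on the vacuum.\<close>
lemma coordinates_unique:
  assumes p: "p \<in> free_carrier n"
  shows "(THE c. (\<forall>M. \<not> M \<subseteq> {1..n} \<longrightarrow> c M = 0) \<and> p - combination s n c \<in> killed s n) = act s p vac"
proof -
  have *: "c = act s p vac" if "\<forall>M. \<not> M \<subseteq> {1..n} \<longrightarrow> c M = 0" "p - combination s n c \<in> killed s n" for c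
    using killed_act[OF that(2)] act_combination[of n c s] that(1) by (auto simp: fun_eq_iff act_diff)
  then obtain c where c: "\<forall>M. \<not> M \<subseteq> {1..n} \<longrightarrow> c M = 0" "p - combination s n c \<in> killed s n"
    using expandable_free[OF p, of s] unfolding expandable_def by blast
  show ?thesis
    by (rule the_equality) (use c * *[OF c] in blast)+
qed

lemma combination_carrier: "combination s n c \<in> free_carrier n"
  unfolding combination_def
  by (intro free_carrier_sum free_carrier_mult free_carrier_fscalar cprod_carrier)
    (simp add: finite_subset)

lemma theta_eq: "theta K = cprod True (sorted_list_of_set K)"
  by (simp add: theta_def cprod_def)

lemma dtheta_eq: "dtheta K = cprod False (sorted_list_of_set K)"
  by (simp add: dtheta_def cprod_def)

lemma theta_coord_eq:
  assumes "p \<in> free_carrier n" shows "theta_coord n p = act True p vac"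
proof -
  have "killed True n = {p \<in> free_carrier n. clifford_class n p
     \<in> left_ideal (clifford n) ((\<lambda>i. clifford_class n (fgen (DTheta i))) ` {1..n})}"
    by (simp add: killed_def)
  then show ?thesis
    unfolding coordinates_unique[OF assms, symmetric] theta_coord_def theta_eq
    using assms combination_carrier[unfolded combination_def] by (simp add: combination_def free_carrier_diff)
qed

lemma dtheta_coord_eq:
  assumes "p \<in> free_carrier n" shows "dtheta_coord n p = act False p vac"
proof -
  have "killed False n = {p \<in> free_carrier n. clifford_class n p
     \<in> left_ideal (clifford n) ((\<lambda>i. clifford_class n (fgen (Theta i))) ` {1..n})}"
    by (simp add: killed_def)
  then show ?thesis
    unfolding coordinates_unique[OF assms, symmetric] dtheta_coord_def dtheta_eq
    using assms combination_carrier[unfolded combination_def] by (simp add: combination_def free_carrier_diff)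
qed

lemma theta_carrier: "K \<subseteq> {1..n} \<Longrightarrow> theta K \<in> free_carrier n"
  unfolding theta_eq by (rule cprod_carrier) (simp add: finite_subset)

lemma dtheta_carrier: "K \<subseteq> {1..n} \<Longrightarrow> dtheta K \<in> free_carrier n"
  unfolding dtheta_eq by (rule cprod_carrier) (simp add: finite_subset)

lemma act_dtheta_vac:
  "finite K \<Longrightarrow> act False (dtheta K) vac = (\<lambda>M. if M = K then 1 else 0)"
  by (simp add: dtheta_eq act_cprod foldr_create_sorted)

lemma act_theta_vac:
  "finite K \<Longrightarrow> act True (theta K) vac = (\<lambda>M. if M = K then 1 else 0)"
  by (simp add: theta_eq act_cprod foldr_create_sorted)

subsection \<open>The coordinates entering the structure constants\<close>

lemma foldr_create_support:
  "foldr create xs vac M \<noteq> 0 \<Longrightarrow> M = set xs"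
proof (induction xs arbitrary: M)
  case Nil
  then show ?case by (simp add: vac_def split: if_splits)
next
  case (Cons a xs)
  then have "a \<in> M" "M - {a} = set xs" by (auto simp: create_def split: if_splits)
  then show ?case by auto
qed

text \<open>A product of distinct annihilators adds their indices to the argument, up to a sign. Only the square
  of the sign will be used.\<close>
lemma foldr_annihilate:
  "distinct xs \<Longrightarrow> \<exists>c. c * c = 1 \<and>
    (\<forall>v. foldr annihilate xs v M = (if set xs \<inter> M = {} then c * v (set xs \<union> M) else 0))"
proof (induction xs arbitrary: M)
  case Nil
  then show ?case by (auto intro: exI[of _ 1])
next
  case (Cons a xs)
  then obtain c where c: "c * c = 1" "\<And>v. foldr annihilate xs v (insert a M) =
    (if set xs \<inter> insert a M = {} then c * v (set xs \<union> insert a M) else 0)"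
    by (metis distinct.simps(2))
  show ?case
  proof (intro exI[of _ "ksign a M * c"] conjI allI)
    have "(ksign a M * c) * (ksign a M * c) = (ksign a M * ksign a M) * (c * c)" by (simp only: mult_ac)
    then show "(ksign a M * c) * (ksign a M * c) = 1" using c(1) by simp
    show "foldr annihilate (a # xs) v M =
      (if set (a # xs) \<inter> M = {} then ksign a M * c * v (set (a # xs) \<union> M) else 0)" for v
      using Cons.prems c(2)[of v] by (auto simp: annihilate_def)
  qed
qed


lemma theta_coord_product:
  assumes "K \<subseteq> {1..n}" "K' \<subseteq> {1..n}"
  shows "theta_coord n (theta K * theta K') M \<noteq> 0 \<Longrightarrow> M = K \<union> K'"
proof -
  have fin: "finite K" "finite K'" using assms finite_subset by blast+
  have "theta_coord n (theta K * theta K') =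
    foldr create (sorted_list_of_set K @ sorted_list_of_set K') vac"
    using assms by (simp add: theta_coord_eq free_carrier_mult theta_carrier act_mult)
      (simp add: theta_eq act_cprod)
  moreover have "set (sorted_list_of_set K @ sorted_list_of_set K') = K \<union> K'"
    using fin by simp
  ultimately show "M = K \<union> K'" if "theta_coord n (theta K * theta K') M \<noteq> 0"
    using foldr_create_support[of "sorted_list_of_set K @ sorted_list_of_set K'" M] that by metis
qed

text \<open>The coordinate is a sign, which enters squared because both tensor factors contribute it.\<close>
lemma theta_coord_pair:
  assumes "i \<in> {1..n}" "j \<in> {1..n}" "i \<noteq> j"
  shows "theta_coord n (theta {i} * theta {j}) {i, j} * theta_coord n (theta {i} * theta {j}) {i, j} = 1"
proof -
  have "theta_coord n (theta {i} * theta {j}) = foldr create [i, j] vac"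
    using assms by (simp add: theta_coord_eq free_carrier_mult theta_carrier act_mult)
      (simp add: theta_eq act_fgen)
  moreover have "{i, j} - {i} = {j}" using assms by auto
  ultimately have "theta_coord n (theta {i} * theta {j}) {i, j} = ksign i {i, j} * ksign j {j}"
    by (simp add: create_def vac_def)
  moreover have "ksign i A * ksign j B * (ksign i A * ksign j B) =
      (ksign i A * ksign i A) * (ksign j B * ksign j B)" for A B
    by (simp only: mult_ac)
  ultimately show ?thesis by simp
qed

lemma theta_coord_one_left:
  assumes "K \<subseteq> {1..n}"
  shows "theta_coord n (theta {} * theta K) M = (if M = K then 1 else 0)"
  using assms finite_subset[OF assms]
  by (simp add: theta_coord_eq free_carrier_mult theta_carrier act_mult act_theta_vac)
    (simp add: theta_eq act_cprod)

text \<open>Contracting \<open>\<partial>\<theta>\<^sub>P\<close> down to a scalar requires exactly the indices of \<open>P\<close>.\<close>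
lemma dtheta_coord_contract:
  assumes "P \<subseteq> {1..n}"
  shows "\<exists>c. c * c = 1 \<and>
    (\<forall>K. K \<subseteq> {1..n} \<longrightarrow> dtheta_coord n (theta K * dtheta P) {} = (if K = P then c else 0))"
proof -
  have fin: "finite K" if "K \<subseteq> {1..n}" for K using that finite_subset by blast
  have eq: "dtheta_coord n (theta K * dtheta P) {} =
    foldr annihilate (sorted_list_of_set K) (\<lambda>M. if M = P then 1 else 0) {}" if "K \<subseteq> {1..n}" for K
    using assms that fin act_cprod_opposite[of False]
    by (simp add: dtheta_coord_eq free_carrier_mult theta_carrier dtheta_carrier act_mult act_dtheta_vac)
      (simp add: theta_eq)
  have fa: "\<exists>c. c * c = 1 \<and> (\<forall>v. foldr annihilate (sorted_list_of_set K) v {} = c * v K)"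
    if "K \<subseteq> {1..n}" for K
    using foldr_annihilate[of "sorted_list_of_set K" "{}"] fin[OF that] by simp
  obtain c where c: "c * c = 1" "\<And>v. foldr annihilate (sorted_list_of_set P) v {} = c * v P"
    using fa[OF assms] by blast
  have "dtheta_coord n (theta K * dtheta P) {} = (if K = P then c else 0)" if "K \<subseteq> {1..n}" for K
  proof -
    obtain d where "\<And>v. foldr annihilate (sorted_list_of_set K) v {} = d * v K"
      using fa[OF \<open>K \<subseteq> {1..n}\<close>] by blast
    then show ?thesis using eq[OF that] c(2)[of "\<lambda>M. if M = P then 1 else 0"] by auto
  qed
  then show ?thesis using c(1) by blast
qed

lemma dtheta_coord_dtheta:
  assumes "P \<subseteq> {1..n}"
  shows "dtheta_coord n (theta {} * dtheta P) M = (if M = P then 1 else 0)"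
    and "dtheta_coord n (dtheta {} * dtheta P) M = (if M = P then 1 else 0)"
    and "dtheta_coord n (dtheta P * dtheta {}) M = (if M = P then 1 else 0)"
  using assms finite_subset[OF assms] dtheta_coord_eq[of "dtheta P" n]
  by (simp_all add: dtheta_carrier act_dtheta_vac) (simp_all add: theta_eq dtheta_eq)

lemma dtheta_coord_product_empty:
  assumes "A \<subseteq> {1..n}" "A' \<subseteq> {1..n}"
  shows "dtheta_coord n (dtheta A * dtheta A') {} = (if A = {} \<and> A' = {} then 1 else 0)"
proof -
  have fin: "finite A" "finite A'" using assms finite_subset by blast+
  have eq: "dtheta_coord n (dtheta A * dtheta A') =
    foldr create (sorted_list_of_set A @ sorted_list_of_set A') vac"
    using assms by (simp add: dtheta_coord_eq free_carrier_mult dtheta_carrier act_mult)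
      (simp add: dtheta_eq act_cprod)
  show ?thesis
  proof (cases "A = {} \<and> A' = {}")
    case False
    then show ?thesis
      using eq fin foldr_create_support[of "sorted_list_of_set A @ sorted_list_of_set A'" "{}"] by auto
  next
    case True
    have "foldr create (sorted_list_of_set A @ sorted_list_of_set A') vac {} = 1"
      using True by (simp add: vac_def)
    then show ?thesis using True unfolding eq[symmetric] by simp
  qed
qed

section \<open>Difference derivatives\<close>

(* The index 1 is kept in the form in which the definitions mention it. *)
declare One_nat_def [simp del]

text \<open>A linear order on the variables makes the polynomials in them an integral domain, so that difference
  quotients are unique.\<close>
fun xyz_code :: "xyz \<Rightarrow> nat \<times> nat" where
  "xyz_code (X i) = (0, i)" | "xyz_code (Y i) = (1, i)" | "xyz_code (Z i) = (2, i)"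

instantiation xyz :: linorder
begin

definition "a \<le> b \<longleftrightarrow> fst (xyz_code a) < fst (xyz_code b) \<or>
  fst (xyz_code a) = fst (xyz_code b) \<and> snd (xyz_code a) \<le> snd (xyz_code b)"
definition "(a :: xyz) < b \<longleftrightarrow> a \<le> b \<and> \<not> b \<le> a"

instance
proof
  fix a b :: xyz
  show "a \<le> b \<Longrightarrow> b \<le> a \<Longrightarrow> a = b"
    by (cases a; cases b) (auto simp: less_eq_xyz_def)
qed (auto simp: less_eq_xyz_def less_xyz_def)

end

lemma Var_eq_iff [simp]: "Var u = Var v \<longleftrightarrow> u = v"
  using vars_Var by (metis singleton_inject)

lemma Var_neq_0 [simp]: "Var v \<noteq> 0"
  using vars_Var[of v] vars_0 by (metis empty_not_insert)

lemma Const_eq_0_iff [simp]: "Const c = 0 \<longleftrightarrow> c = 0"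
  unfolding Const_def by (metis lookup_single_eq lookup_zero single_zero)

lemma nabla_eqI:
  assumes "(Var (s i) - Var (t i)) * q = rename s t {1..<i} p - rename s t {1..i} p" "s i \<noteq> t i"
  shows "nabla s t i p = q"
  unfolding nabla_def assms(1)[symmetric]
proof (rule the_equality)
  fix q' assume "(Var (s i) - Var (t i)) * q' = (Var (s i) - Var (t i)) * q"
  then show "q' = q" using assms(2) by simp
qed simp

lemma nabla_spec:
  assumes "inj s" "s i \<noteq> t i" "i \<ge> 1"
  shows "(Var (s i) - Var (t i)) * nabla s t i p = rename s t {1..<i} p - rename s t {1..i} p"
proof -
  have "Var (s i) - Var (t i) dvd rename s t {1..<i} p - rename s t {1..i} p"
    unfolding rename_def
  proof (rule dvd_subst_diff)
    fix v
    have "{1..i} = insert i {1..<i}" using assms(3) by auto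
    then consider "v \<in> s ` {1..<i}" | "v = s i" | "v \<notin> s ` {1..i}" by auto
    then show "Var (s i) - Var (t i) dvd
      (if v \<in> s ` {1..<i} then Var (t (the_inv s v)) else Var v) -
      (if v \<in> s ` {1..i} then Var (t (the_inv s v)) else Var v)"
    proof cases
      case 1
      moreover have "v \<in> s ` {1..i}" using 1 by force
      ultimately show ?thesis by simp
    next
      case 2
      moreover have "v \<notin> s ` {1..<i}" "v \<in> s ` {1..i}"
        using 2 assms by (auto dest: injD)
      ultimately show ?thesis using assms by (simp add: the_inv_f_f)
    next
      case 3
      moreover have "v \<notin> s ` {1..<i}" using 3 by force
      ultimately show ?thesis by simp
    qed
  qed
  then obtain q where "(Var (s i) - Var (t i)) * q = rename s t {1..<i} p - rename s t {1..i} p"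
    by (metis dvdE)
  then show ?thesis using nabla_eqI[of s i t q p] assms(2) by simp
qed

lemma inj_xyz [simp]: "inj X" "inj Y"
  by (auto simp: inj_def)

lemma rename_Var:
  assumes "inj s"
  shows "rename s t K (Var (s i)) = (if i \<in> K then Var (t i) else Var (s i))"
  using assms by (simp add: rename_def the_inv_f_f inj_image_mem_iff)

lemma rename_simps [simp]:
  "rename s t K (p + q) = rename s t K p + rename s t K q" "rename s t K (p * q) = rename s t K p * rename s t K q"
  "rename s t K 0 = 0" "rename s t K (p ^ e) = rename s t K p ^ e"
  by (simp_all add: rename_def)

lemma rename_in_X: "rename X t K (in_X p) = subst (\<lambda>i. Var (if i \<in> K then t i else X i)) p"
  unfolding rename_def in_X_def subst_subst
  by (intro arg_cong[of _ _ "\<lambda>s. subst s p"] ext) (simp add: the_inv_f_f inj_image_mem_iff)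

lemma nabla_0 [simp]: "s i \<noteq> t i \<Longrightarrow> nabla s t i 0 = 0"
  by (rule nabla_eqI) simp_all

text \<open>Let \<open>q(x, y) = (p(x) - p(y)) / (x - y)\<close> be the first difference derivative, the other variables being
  fixed. The second one is \<open>(q(x, y) - q(x, z)) / (y - z)\<close>, to be evaluated at \<open>y = -x\<close>, \<open>z = x\<close>. Evenness
  gives \<open>q(x, -x) = 0\<close>, whereas \<open>q(x, x)\<close> is the derivative \<open>2 x r\<close>; division by \<open>y - z = -2 x\<close>
  leaves \<open>r\<close>.\<close>
lemma second_difference_even:
  fixes p :: "nat mpoly"
  assumes even: "subst (Var(1 := - Var 1)) p = p" and y: "y 1 = - Var 1" and dp: "pderiv 1 p = 2 * Var 1 * r"
  shows "at_yz y Var (nabla Y Z 1 (nabla X Y 1 (in_X p))) = r"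
proof -
  define q where "q = nabla X Y 1 (in_X p)"
  let ?h = "nabla Y Z 1 q"
  have q: "(Var (X 1) - Var (Y 1)) * q = in_X p - rename X Y {1} (in_X p)"
    unfolding q_def using nabla_spec[of X 1 Y "in_X p"] by (simp add: rename_def)
  have h: "(Var (Y 1) - Var (Z 1)) * ?h = q - rename Y Z {1} q"
    using nabla_spec[of Y 1 Z q] by (simp add: rename_def)
  \<comment> \<open>\<open>E\<close> evaluates at \<open>y = -x\<close> and \<open>E'\<close> at \<open>y = x\<close>, in the first variable.\<close>
  define E where "E = at_yz y Var"
  have E: "E = subst (case_xyz Var y Var)" by (simp add: E_def at_yz_def)
  define E' where "E' = subst (case_xyz Var (y(1 := Var 1)) Var)"
  have EE': "E (rename Y Z {1} w) = E' w" for w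
    unfolding E E'_def rename_def subst_subst
    by (intro arg_cong[of _ _ "\<lambda>s. subst s w"] ext) (auto split: xyz.splits simp: the_inv_f_f)
  have "2 * Var 1 * E q = E ((Var (X 1) - Var (Y 1)) * q)"
    by (simp add: E y)
  also have "\<dots> = E (in_X p) - E (rename X Y {1} (in_X p))"
    unfolding q by (simp add: E)
  also have "E (in_X p) = p"
    by (simp add: E in_X_def subst_subst)
  also have "E (rename X Y {1} (in_X p)) = subst (Var(1 := - Var 1)) p"
    unfolding rename_in_X E subst_subst
    by (intro arg_cong[of _ _ "\<lambda>s. subst s p"] ext) (simp add: y)
  finally have Eq: "E q = 0" using even by simp
  \<comment> \<open>The value of \<open>q\<close> on the diagonal is found by differentiating \<open>(x - y) q = p(x) - p(y)\<close>.\<close>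
  have "pderiv (X 1) (in_X p - rename X Y {1} (in_X p)) = in_X (pderiv 1 p)"
  proof -
    have "pderiv (X 1) (in_X p) = (\<Sum>v\<in>{1}. subst (\<lambda>i. Var (X i)) (pderiv v p) * pderiv (X 1) (Var (X v)))"
      unfolding in_X_def by (rule pderiv_subst) (auto simp: pderiv_Var)
    moreover have "pderiv (X 1) (rename X Y {1} (in_X p)) = (\<Sum>v\<in>{}. subst (\<lambda>i. Var (if i \<in> {1} then Y i else X i)) (pderiv v p)
      * pderiv (X 1) (Var (if v \<in> {1} then Y v else X v)))"
      unfolding rename_in_X by (rule pderiv_subst) (auto simp: pderiv_Var)
    ultimately show ?thesis by (simp add: pderiv_Var in_X_def)
  qed
  then have "q + (Var (X 1) - Var (Y 1)) * pderiv (X 1) q = in_X (pderiv 1 p)"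
    unfolding q[symmetric] by (simp add: pderiv_mult pderiv_Var)
  then have "E' (q + (Var (X 1) - Var (Y 1)) * pderiv (X 1) q) = E' (in_X (pderiv 1 p))" by simp
  then have E'q: "E' q = pderiv 1 p"
    by (simp add: E'_def in_X_def subst_subst)
  have "- (2 * Var 1) * E ?h = E ((Var (Y 1) - Var (Z 1)) * ?h)"
    by (simp add: E y)
  also have "\<dots> = E q - E' q"
    unfolding h by (simp add: EE'[symmetric]) (simp add: E)
  finally have "2 * Var 1 * E ?h = 2 * Var 1 * r"
    by (simp add: Eq E'q dp)
  then have "E ?h = r" by simp
  then show ?thesis by (simp add: E_def q_def)
qed

text \<open>The variable \<open>x\<^sub>n\<close> occurs only in its square, so the difference derivative is that of \<open>x\<^sub>n\<^sup>2\<close>.\<close>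
lemma difference_separate_square:
  assumes "vars p \<subseteq> {1..<n}" "n \<ge> 1"
  shows "nabla X Y n (in_X (p + (Var n)\<^sup>2)) = Var (X n) + Var (Y n)"
proof (rule nabla_eqI)
  have "rename X Y {1..<n} (in_X p) = rename X Y {1..n} (in_X p)"
    unfolding rename_in_X by (rule subst_cong) (use assms in auto)
  moreover have "in_X (p + (Var n)\<^sup>2) = in_X p + (Var (X n))\<^sup>2"
    by (simp add: in_X_def)
  ultimately show "(Var (X n) - Var (Y n)) * (Var (X n) + Var (Y n)) =
    rename X Y {1..<n} (in_X (p + (Var n)\<^sup>2)) - rename X Y {1..n} (in_X (p + (Var n)\<^sup>2))"
    using assms(2) by (simp add: rename_Var algebra_simps power2_eq_square)
qed simp

lemma second_difference_separate_square:
  assumes "vars p \<subseteq> {1..<n}" "n \<ge> 1"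
  shows "nabla Y Z n (nabla X Y n (in_X (p + (Var n)\<^sup>2))) = 1"
  unfolding difference_separate_square[OF assms]
proof (rule nabla_eqI)
  have "rename Y Z K (Var (X n)) = Var (X n)" for K
    by (simp add: rename_def image_iff)
  then show "(Var (Y n) - Var (Z n)) * 1 =
    rename Y Z {1..<n} (Var (X n) + Var (Y n)) - rename Y Z {1..n} (Var (X n) + Var (Y n))"
    using assms(2) by (simp add: rename_Var)
qed simp

section \<open>The graded tensor square and the structure constants\<close>

abbreviation theta_basis :: "nat \<Rightarrow> (nat set \<times> nat set) set" where
  "theta_basis n \<equiv> Pow {1..n} \<times> Pow {1..n}"

text \<open>The coefficients of the multiplication table of the graded tensor square, so that \<open>theta_mult\<close> is its
  multiplication with polynomial entries.\<close>
definition sq_coeff :: "nat \<Rightarrow> nat set \<times> nat set \<Rightarrow> nat set \<times> nat set \<Rightarrow> nat set \<times> nat set \<Rightarrow> complex" where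
  "sq_coeff n b b' c = (-1) ^ (card (snd b) * card (fst b')) *
     theta_coord n (theta (fst b) * theta (fst b')) (fst c) *
     theta_coord n (theta (snd b) * theta (snd b')) (snd c)"

definition theta_mult ::
    "nat \<Rightarrow> (nat set \<times> nat set \<Rightarrow> nat mpoly) \<Rightarrow> (nat set \<times> nat set \<Rightarrow> nat mpoly) \<Rightarrow> nat set \<times> nat set \<Rightarrow> nat mpoly" where
  "theta_mult n U V c = (\<Sum>(b, b')\<in>theta_basis n \<times> theta_basis n. Const (sq_coeff n b b' c) * (U b * V b'))"

lemma finsum_class:
  assumes "finite S" "\<And>i. i \<in> S \<Longrightarrow> G i = class_fix n f k (F i)"
  shows "finsum (jac_fix n f k) G S = class_fix n f k (sum F S)"
proof -
  interpret algebra complex_ring "jac_fix n f k" by (rule algebra_jac_fix)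
  have "finsum (jac_fix n f k) G S = finsum (jac_fix n f k) (\<lambda>i. class_fix n f k (F i)) S"
    by (rule M.finsum_cong') (use assms(2) in \<open>auto simp: carrier_jac_fix\<close>)
  then show ?thesis using assms(1) by (simp add: finsum_jac_fix)
qed

text \<open>Taking classes commutes with the products of \<open>\<complex>[x] \<otimes> \<complex>[\<theta>] \<otimes> \<complex>[\<theta>]\<close>. This and the next two lemmas move
  the whole computation of the structure constants to polynomials.\<close>
lemma theta_square_mult:
  "floor_fix n f k U \<otimes>\<^bsub>theta_square n (jac_fix n f k)\<^esub> floor_fix n f k V = floor_fix n f k (theta_mult n U V)"
proof
  fix c
  show "(floor_fix n f k U \<otimes>\<^bsub>theta_square n (jac_fix n f k)\<^esub> floor_fix n f k V) c =
    floor_fix n f k (theta_mult n U V) c"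
  proof (cases "c \<in> theta_basis n")
    case True
    then obtain M M' where c: "c = (M, M')" "M \<subseteq> {1..n}" "M' \<subseteq> {1..n}" by auto
    have "finsum (jac_fix n f k) (\<lambda>((K, L), (K', L')).
        ((-1) ^ (card L * card K') * theta_coord n (theta K * theta K') M
           * theta_coord n (theta L * theta L') M')
          \<odot>\<^bsub>jac_fix n f k\<^esub> (floor_fix n f k U (K, L) \<otimes>\<^bsub>jac_fix n f k\<^esub> floor_fix n f k V (K', L')))
          (theta_basis n \<times> theta_basis n)
      = class_fix n f k (\<Sum>(b, b')\<in>theta_basis n \<times> theta_basis n. Const (sq_coeff n b b' c) * (U b * V b'))"
      by (rule finsum_class)
        (auto simp: floor_fix_def mult_jac_fix smult_jac_fix sq_coeff_def c)
    then show ?thesis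
      using c by (simp add: theta_square_def Let_def floor_fix_def theta_mult_def)
  qed (auto simp: theta_square_def Let_def floor_fix_def)
qed

lemma theta_square_add:
  "floor_fix n f k U \<oplus>\<^bsub>theta_square n (jac_fix n f k)\<^esub> floor_fix n f k V = floor_fix n f k (\<lambda>b. U b + V b)"
  by (auto simp: theta_square_def Let_def floor_fix_def fun_eq_iff add_jac_fix)

lemma theta_square_one:
  "\<one>\<^bsub>theta_square n (jac_fix n f k)\<^esub> = floor_fix n f k (\<lambda>b. if b = ({}, {}) then 1 else 0)"
  by (auto simp: theta_square_def Let_def floor_fix_def fun_eq_iff one_jac_fix zero_jac_fix)

definition ups_coeff :: "nat \<Rightarrow> nat set \<Rightarrow> nat set \<Rightarrow> nat set \<Rightarrow> nat set \<times> nat set \<Rightarrow> complex" where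
  "ups_coeff n P Q M b = (-1) ^ (card P * card (snd b)) *
       (\<Sum>A \<in> Pow {1..n}. \<Sum>A' \<in> Pow {1..n}.
          dtheta_coord n (theta (fst b) * dtheta P) A * dtheta_coord n (theta (snd b) * dtheta Q) A'
            * dtheta_coord n (dtheta A * dtheta A') M)"

lemma Upsilon_coeff_class:
  "Upsilon_coeff n (jac_fix n f k) (floor_fix n f k U) P Q M =
    class_fix n f k (\<Sum>b\<in>theta_basis n. Const (ups_coeff n P Q M b) * U b)"
  unfolding Upsilon_coeff_def
  by (rule finsum_class) (auto simp: floor_fix_def smult_jac_fix ups_coeff_def)

lemma sum_delta_delta:
  fixes F :: "'a \<Rightarrow> 'b \<Rightarrow> complex"
  assumes "finite S" "finite T" "a \<in> S" "b \<in> T"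
  shows "(\<Sum>x\<in>S. \<Sum>y\<in>T. (if x = a then 1 else 0) * (if y = b then 1 else 0) * F x y) = F a b"
proof -
  have "(\<Sum>y\<in>T. (if x = a then 1 else 0) * (if y = b then 1 else 0) * F x y) =
    (if x = a then F x b else 0)" for x
  proof -
    have "(\<Sum>y\<in>T. (if x = a then 1 else 0) * (if y = b then 1 else 0) * F x y) =
      (\<Sum>y\<in>T. if y = b then (if x = a then F x b else 0) else 0)"
      by (intro sum.cong) auto
    then show ?thesis using assms by simp
  qed
  then show ?thesis using assms by simp
qed

lemma ups_coeff_unit:
  assumes "P \<subseteq> {1..n}"
  shows "ups_coeff n {} P P ({}, {}) = 1" "ups_coeff n P {} P ({}, {}) = 1"
  using assms
  by (simp_all add: ups_coeff_def dtheta_coord_dtheta sum_delta_delta)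

text \<open>For the scalar coefficient of \<open>\<Upsilon>\<close> both factors have to be contracted completely. The resulting sign
  occurs twice, and the Koszul sign is trivial as \<open>card P\<close> is even.\<close>
lemma ups_coeff_contract:
  assumes "P \<subseteq> {1..n}" "even (card P)" "b \<in> theta_basis n"
  shows "ups_coeff n P P {} b = (if b = (P, P) then 1 else 0)"
proof -
  obtain c where c: "c * c = 1" and
    con: "\<And>K. K \<subseteq> {1..n} \<Longrightarrow> dtheta_coord n (theta K * dtheta P) {} = (if K = P then c else 0)"
    using dtheta_coord_contract[OF assms(1)] by blast
  obtain K L where b: "b = (K, L)" "K \<subseteq> {1..n}" "L \<subseteq> {1..n}" using assms(3) by auto
  have "(\<Sum>A \<in> Pow {1..n}. \<Sum>A' \<in> Pow {1..n}.
      dtheta_coord n (theta K * dtheta P) A * dtheta_coord n (theta L * dtheta P) A'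
        * dtheta_coord n (dtheta A * dtheta A') {}) =
    (\<Sum>A \<in> Pow {1..n}. \<Sum>A' \<in> Pow {1..n}. (if A = {} then 1 else 0) * (if A' = {} then 1 else 0) *
      (dtheta_coord n (theta K * dtheta P) A * dtheta_coord n (theta L * dtheta P) A'))"
    by (intro sum.cong refl) (auto simp: dtheta_coord_product_empty)
  also have "\<dots> = dtheta_coord n (theta K * dtheta P) {} * dtheta_coord n (theta L * dtheta P) {}"
    by (rule sum_delta_delta) auto
  also have "\<dots> = (if K = P \<and> L = P then 1 else 0)"
    using c con[OF b(2)] con[OF b(3)] by simp
  finally show ?thesis using assms(2) b by (simp add: ups_coeff_def)
qed

lemma theta_mult_one_left:
  assumes "c \<in> theta_basis n"
  shows "theta_mult n (\<lambda>b. if b = ({}, {}) then 1 else 0) U c = U c"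
proof -
  obtain M M' where c: "c = (M, M')" "M \<subseteq> {1..n}" "M' \<subseteq> {1..n}" using assms by auto
  have "theta_mult n (\<lambda>b. if b = ({}, {}) then 1 else 0) U c =
    (\<Sum>b\<in>theta_basis n. \<Sum>b'\<in>theta_basis n. if b = ({}, {}) then (if b' = c then U c else 0) else 0)"
    unfolding theta_mult_def sum.cartesian_product[symmetric]
    by (intro sum.cong refl) (auto simp: sq_coeff_def theta_coord_one_left c split: if_splits)
  also have "\<dots> = (\<Sum>b\<in>theta_basis n. if b = ({}, {}) then U c else 0)"
    by (intro sum.cong refl) (use assms in auto)
  also have "\<dots> = U c" by simp
  finally show ?thesis .
qed

lemma theta_mult_cong:
  "(\<And>b. b \<in> theta_basis n \<Longrightarrow> U b = U' b) \<Longrightarrow> theta_mult n U V c = theta_mult n U' V c"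
  unfolding theta_mult_def by (intro sum.cong refl) auto

lemma floor_fix_cong:
  "(\<And>b. b \<in> theta_basis n \<Longrightarrow> U b = U' b) \<Longrightarrow> floor_fix n f k U = floor_fix n f k U'"
  unfolding floor_fix_def by (auto simp: fun_eq_iff)

lemma fixed_one: "fixed n (\<lambda>_. 1) = {1..n}" and moved_one: "moved n (\<lambda>_. 1) = {}"
  by (auto simp: fixed_def moved_def)

text \<open>For the identity the exponent is \<open>0\<close>, and \<open>\<Upsilon>\<close> of the unit returns \<open>\<partial>\<theta>\<^sub>Q\<close> itself.\<close>
lemma Upsilon_one:
  assumes "ups_coeff n P Q M ({}, {}) = 1"
  shows "Upsilon_coeff n (jac_fix n f k) \<one>\<^bsub>theta_square n (jac_fix n f k)\<^esub> P Q M = class_fix n f k 1"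
proof -
  have "(\<Sum>b\<in>theta_basis n. Const (ups_coeff n P Q M b) * (if b = ({}, {}) then 1 else 0)) =
    (\<Sum>b\<in>theta_basis n. if b = ({}, {}) then 1 else 0 :: nat mpoly)"
    by (intro sum.cong refl) (auto simp: assms)
  also have "\<dots> = 1" by simp
  finally show ?thesis by (simp only: theta_square_one Upsilon_coeff_class)
qed

lemma sigma_one_left: "sigma n f (\<lambda>_. 1) k = class_fix n f k 1"
  and sigma_one_right: "sigma n f k (\<lambda>_. 1) = class_fix n f k 1"
  using ups_coeff_unit[of "moved n k" n]
  by (simp_all add: sigma_def Let_def torus_def moved_one nat_pow_def smult_jac_fix Upsilon_one moved_def)

text \<open>If only terms \<open>\<theta>\<^sub>k \<otimes> \<theta>\<^sub>l\<close> with \<open>l \<le> k\<close> occur in \<open>U\<close>, then \<open>\<theta>\<^sub>i\<theta>\<^sub>j \<otimes> \<theta>\<^sub>i\<theta>\<^sub>j\<close> arises in \<open>U\<^sup>2\<close> only from the two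
  diagonal terms: an entry \<open>\<theta>\<^sub>j \<otimes> \<theta>\<^sub>i\<close> would need the partner \<open>\<theta>\<^sub>i \<otimes> \<theta>\<^sub>j\<close>. Each of the two orders gives the
  Koszul sign \<open>-1\<close>, the signs of reordering in the two tensor factors being equal.\<close>
lemma theta_mult_square_diagonal:
  assumes ij: "i \<in> {1..n}" "j \<in> {1..n}" "i < j"
    and supp: "\<And>K L. U (K, L) \<noteq> 0 \<Longrightarrow> \<exists>k l. K = {k} \<and> L = {l} \<and> l \<le> k"
  shows "theta_mult n U U ({i, j}, {i, j}) = - (2 * (U ({i}, {i}) * U ({j}, {j})))"
proof -
  let ?b = "({i}, {i})" and ?b' = "({j}, {j})" and ?c = "({i, j}, {i, j})"
  let ?t = "\<lambda>(b, b'). Const (sq_coeff n b b' ?c) * (U b * U b')"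
  have "theta_mult n U U ?c = (\<Sum>x\<in>{(?b, ?b'), (?b', ?b)}. ?t x)"
    unfolding theta_mult_def
  proof (rule sum.mono_neutral_right)
    show "\<forall>x\<in>theta_basis n \<times> theta_basis n - {(?b, ?b'), (?b', ?b)}. ?t x = 0"
    proof (rule ballI, rule ccontr)
      fix x assume x: "x \<in> theta_basis n \<times> theta_basis n - {(?b, ?b'), (?b', ?b)}" and nz: "?t x \<noteq> 0"
      obtain K L K' L' where x_eq: "x = ((K, L), (K', L'))" by (metis surj_pair)
      have sub: "K \<subseteq> {1..n}" "L \<subseteq> {1..n}" "K' \<subseteq> {1..n}" "L' \<subseteq> {1..n}" using x x_eq by auto
      have "U (K, L) \<noteq> 0" "U (K', L') \<noteq> 0" using nz x_eq by auto
      then obtain k l k' l' where kl: "K = {k}" "L = {l}" "l \<le> k" "K' = {k'}" "L' = {l'}" "l' \<le> k'"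
        using supp by meson
      have "{i, j} = {k} \<union> {k'}"
        using theta_coord_product[OF sub(1,3)] nz x_eq kl by (simp add: sq_coeff_def)
      moreover have "{i, j} = {l} \<union> {l'}"
        using theta_coord_product[OF sub(2,4)] nz x_eq kl by (simp add: sq_coeff_def)
      ultimately have "k = i \<and> l = i \<and> k' = j \<and> l' = j \<or> k = j \<and> l = j \<and> k' = i \<and> l' = i"
        using kl ij(3) by (auto simp: doubleton_eq_iff)
      then show False using x x_eq kl by auto
    qed
  qed (use ij in auto)
  moreover have "(\<Sum>x\<in>{(?b, ?b'), (?b', ?b)}. ?t x) = ?t (?b, ?b') + ?t (?b', ?b)"
    using ij by simp
  moreover have "sq_coeff n ?b ?b' ?c = -1"
    using theta_coord_pair[OF ij(1,2)] ij(3) by (simp add: sq_coeff_def)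
  moreover have "sq_coeff n ?b' ?b ?c = -1"
    using theta_coord_pair[OF ij(2,1)] ij(3) by (simp add: sq_coeff_def insert_commute)
  ultimately show ?thesis by (simp add: Const_uminus)
qed

section \<open>The product in the algebra of a function even in its first variable\<close>

text \<open>The general situation behind the theorem: \<open>F(x\<^sub>1\<^sup>2, x\<^sub>2, \<dots>) + x\<^sub>n\<^sup>2\<close> with the involution changing the signs of
  \<open>x\<^sub>1\<close> and \<open>x\<^sub>n\<close>.\<close>
locale square_cover =
  fixes n :: nat and F :: "nat mpoly"
  assumes n: "2 \<le> n" and vars_F: "vars F \<subseteq> {1..<n}"
begin

definition f :: "nat mpoly" where
  "f = sq 1 F + (Var n)\<^sup>2"

definition g :: diag where
  "g = (\<lambda>i. if i \<in> {1, n} then -1 else 1)"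

abbreviation cls :: "diag \<Rightarrow> nat mpoly \<Rightarrow> nat mpoly set" where
  "cls \<equiv> class_fix n f"

abbreviation e :: diag where
  "e \<equiv> (\<lambda>_. 1)"

lemma moved_g: "moved n g = {1, n}" and fixed_g: "fixed n g = {1<..<n}"
  using n by (auto simp: moved_def fixed_def g_def)

lemma g_g: "g \<otimes>\<^bsub>torus n\<^esub> g = e" and e_g: "e \<otimes>\<^bsub>torus n\<^esub> g = g" and g_e: "g \<otimes>\<^bsub>torus n\<^esub> e = g"
  and e_e: "e \<otimes>\<^bsub>torus n\<^esub> e = e"
  by (auto simp: torus_def g_def)

lemma g_neq_e [simp]: "g \<noteq> e" "e \<noteq> g"
  by (auto simp: g_def fun_eq_iff intro!: exI[of _ 1])

lemma vars_f: "vars f \<subseteq> {1..n}"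
  unfolding f_def
  by (intro vars_add_subset vars_sq vars_power_subset) (use vars_F n in auto)

lemma pderiv_1_f: "pderiv 1 f = 2 * Var 1 * sq 1 (pderiv 1 F)"
proof -
  have "pderiv 1 (sq 1 F) = (\<Sum>v\<in>{1}. subst (Var(1 := (Var 1)\<^sup>2)) (pderiv v F) * pderiv 1 ((Var(1 := (Var 1)\<^sup>2)) v))"
    unfolding sq_def by (rule pderiv_subst) (auto simp: pderiv_Var)
  then have "pderiv 1 (sq 1 F) = sq 1 (pderiv 1 F) * (2 * Var 1)"
    by (simp add: sq_def pderiv_power2 pderiv_Var)
  then show ?thesis using n by (simp add: f_def pderiv_power2 pderiv_Var mult_ac)
qed

lemma pderiv_f:
  assumes "j \<in> {1<..<n}" shows "pderiv j f = sq 1 (pderiv j F)"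
proof -
  have "pderiv j (sq 1 F) = (\<Sum>v\<in>{j}. subst (Var(1 := (Var 1)\<^sup>2)) (pderiv v F) * pderiv j ((Var(1 := (Var 1)\<^sup>2)) v))"
    unfolding sq_def by (rule pderiv_subst) (use assms in \<open>auto simp: pderiv_Var pderiv_power2\<close>)
  then show ?thesis using assms by (simp add: f_def sq_def pderiv_power2 pderiv_Var)
qed

lemma pderiv_n_f: "pderiv n f = 2 * Var n"
proof -
  have "n \<notin> vars (sq 1 F)" using vars_sq[OF vars_F, of 1] by auto
  then show ?thesis by (simp add: f_def pderiv_not_occurring pderiv_power2 pderiv_Var)
qed

lemma f_even: "subst (Var(1 := - Var 1)) f = f"
proof -
  have "subst (Var(1 := - Var 1)) (sq 1 F) = sq 1 F"
    unfolding sq_def subst_subst by (intro arg_cong[of _ _ "\<lambda>s. subst s F"] ext) simp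
  then show ?thesis using n by (simp add: f_def)
qed

lemma H2_supp: "H2 n f g (K, L) \<noteq> 0 \<Longrightarrow> \<exists>k l. K = {k} \<and> L = {l} \<and> l \<le> k"
  unfolding H2_def by (auto elim!: sum.not_neutral_contains_not_neutral split: if_splits)

lemma H2_diag:
  assumes "i \<in> {1..n}"
  shows "H2 n f g ({i}, {i}) = at_yz (\<lambda>k. Const (g k) * Var k) Var (nabla Y Z i (nabla X Y i (in_X f)))"
proof -
  have delta: "(\<Sum>i' = 1..n. \<Sum>j = 1..i'. if {i} = {i'} \<and> {i} = {j} then h i' j else 0) = h i i"
    for h :: "nat \<Rightarrow> nat \<Rightarrow> nat mpoly"
  proof -
    have "(\<Sum>j = 1..i'. if {i} = {i'} \<and> {i} = {j} then h i' j else 0) = (if i' = i then h i i else 0)" for i'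
      using assms by (cases "i' = i") auto
    then show ?thesis using assms by simp
  qed
  show ?thesis unfolding H2_def prod.case by (rule delta)
qed

lemma vars_sqF: "vars (sq 1 F) \<subseteq> {1..<n}"
  by (rule vars_sq[OF vars_F])

lemma H2_11: "H2 n f g ({1}, {1}) = sq 1 (pderiv 1 F)"
  using n by (subst H2_diag) (auto intro!: second_difference_even f_even pderiv_1_f simp: g_def Const_uminus)

lemma H2_nn: "H2 n f g ({n}, {n}) = 1"
  using n by (subst H2_diag)
    (auto simp: f_def second_difference_separate_square[OF vars_sqF] at_yz_def)

text \<open>The inner difference derivative is \<open>x\<^sub>n + y\<^sub>n\<close>, and this vanishes at \<open>y = g(x)\<close>.\<close>
lemma H1_g: "H1 n f g K = 0"
proof -
  have "nabla_at (\<lambda>k. Const (g k) * Var k) n f = 0"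
    using n by (simp add: nabla_at_def f_def difference_separate_square[OF vars_sqF] at_yz_def g_def Const_uminus)
  moreover have "nabla_at y j 0 = 0" for y j
    by (simp add: nabla_at_def in_X_def at_yz_def)
  ultimately show ?thesis
    unfolding H1_def moved_g by (intro sum.neutral) (use n in auto)
qed

text \<open>The exponent is \<open>2\<close>, and half the coefficient of \<open>\<theta>\<^sub>1\<theta>\<^sub>n \<otimes> \<theta>\<^sub>1\<theta>\<^sub>n\<close> in the square of \<open>H\<^sub>f\<close> is minus the
  product of the two diagonal entries of \<open>H\<^sub>f\<close>.\<close>
lemma sigma_g_g: "sigma n f g g = cls e (- sq 1 (pderiv 1 F))"
proof -
  let ?R = "jac_fix n f e" and ?U = "H2 n f g"
  let ?T = "theta_square n ?R" and ?one = "\<lambda>b. if b = ({}, {}) then 1 else 0 :: nat mpoly"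
  let ?UU = "theta_mult n (theta_mult n ?one ?U) ?U"
  have PP: "({1, n}, {1, n}) \<in> theta_basis n" using n by auto
  have card: "card {1, n} = 2" using n by simp
  have u: "floor_fix n f e ?U \<oplus>\<^bsub>?T\<^esub> floor_fix n f e (tensor_one (H1 n f g)) \<oplus>\<^bsub>?T\<^esub>
      floor_fix n f e (one_tensor (\<lambda>K. diag_subst g (H1 n f g K))) = floor_fix n f e ?U"
    unfolding theta_square_add
    by (rule floor_fix_cong) (auto simp: tensor_one_def one_tensor_def H1_g diag_subst_def)
  have pow: "floor_fix n f e ?U [^]\<^bsub>?T\<^esub> (2 :: nat) = floor_fix n f e ?UU"
    by (simp add: numeral_2_eq_2 nat_pow_def theta_square_one theta_square_mult)
  have "?UU ({1, n}, {1, n}) = theta_mult n ?U ?U ({1, n}, {1, n})"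
    by (rule theta_mult_cong) (rule theta_mult_one_left)
  also have "\<dots> = - (2 * (?U ({1}, {1}) * ?U ({n}, {n})))"
    by (rule theta_mult_square_diagonal) (use n H2_supp in auto)
  also have "\<dots> = - (2 * sq 1 (pderiv 1 F))"
    by (simp add: H2_11 H2_nn)
  finally have UU: "?UU ({1, n}, {1, n}) = - (2 * sq 1 (pderiv 1 F))" .
  have "(\<Sum>b\<in>theta_basis n. Const (ups_coeff n {1, n} {1, n} {} b) * ?UU b) =
    (\<Sum>b\<in>theta_basis n. if b = ({1, n}, {1, n}) then ?UU b else 0)"
    by (intro sum.cong refl, subst ups_coeff_contract) (use n card in auto)
  also have "\<dots> = ?UU ({1, n}, {1, n})" using PP by simp
  finally have ups: "Upsilon_coeff n ?R (floor_fix n f e ?UU) {1, n} {1, n} {} =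
    cls e (- (2 * sq 1 (pderiv 1 F)))"
    by (simp only: Upsilon_coeff_class UU)
  have "Const (1/2) * 2 = (1 :: nat mpoly)"
    using Const_mult[of "1/2" 2, where 'a = nat] by simp
  then have half: "Const (1/2) * (2 * p) = p" for p :: "nat mpoly"
    by (simp flip: mult.assoc)
  have "sigma n f g g = (1/2) \<odot>\<^bsub>?R\<^esub> Upsilon_coeff n ?R (floor_fix n f e ?UU) {1, n} {1, n} {}"
    unfolding sigma_def Let_def g_g moved_g moved_one u using card by (simp add: pow)
  also have "\<dots> = cls e (- sq 1 (pderiv 1 F))"
    by (simp add: ups smult_jac_fix half)
  finally show ?thesis .
qed


text \<open>The ideals of the two sectors, and the polynomial \<open>w\<close> with \<open>\<xi>\<^sub>g \<union> \<xi>\<^sub>g = [w] \<xi>\<^sub>e\<close>.\<close>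
abbreviation J :: "nat mpoly set" where "J \<equiv> jac_ideal {1..n} f"
abbreviation Jg :: "nat mpoly set" where "Jg \<equiv> jac_ideal {1<..<n} (restr n g f)"

definition w :: "nat mpoly" where "w = - sq 1 (pderiv 1 F)"

lemma restr_e [simp]: "vars p \<subseteq> {1..n} \<Longrightarrow> restr n e p = p"
  by (rule restr_ident) (simp add: fixed_one)

lemmas J_ideal = ideal_jac_ideal[OF vars_f]
lemmas JD = ideal_poly_ringD[OF J_ideal]

lemma vars_restr_g: "vars (restr n g p) \<subseteq> {1<..<n}"
  using vars_restr[of n g p] by (simp add: fixed_g)

lemmas Jg_ideal = ideal_jac_ideal[OF vars_restr_g]
lemmas JgD = ideal_poly_ringD[OF Jg_ideal]

declare fixed_g [simp]

lemma class_e_eq_iff: "vars p \<subseteq> {1..n} \<Longrightarrow> vars q \<subseteq> {1..n} \<Longrightarrow>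
    cls e p = cls e q \<longleftrightarrow> p - q \<in> J"
  by (simp add: class_fix_eq_iff fixed_one vars_f)

lemma class_g_eq_iff: "cls g p = cls g q \<longleftrightarrow> restr n g (p - q) \<in> Jg"
  by (simp add: class_fix_eq_iff fixed_g)

lemma pderiv_restr_g:
  assumes "j \<in> {1<..<n}" shows "pderiv j (restr n g p) = restr n g (pderiv j p)"
proof -
  have "pderiv j (restr n g p) = (\<Sum>v\<in>{j}. subst (x_fix n g) (pderiv v p) * pderiv j (x_fix n g v))"
    unfolding restr_def by (rule pderiv_subst) (auto simp: x_fix_def pderiv_Var)
  then show ?thesis using assms by (simp add: x_fix_def fixed_g pderiv_Var restr_def)
qed

lemma index_cases:
  assumes "v \<in> {1..n}" obtains "v = 1" | "v = n" | "v \<in> {1<..<n}"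
  using assms by fastforce

text \<open>Makes the product of the identity sector with the sector of \<open>g\<close> well defined.\<close>
lemma restr_J:
  assumes "p \<in> J" shows "restr n g p \<in> Jg"
proof -
  let ?K = "{p. vars p \<subseteq> {1..n} \<and> restr n g p \<in> Jg}"
  have "ideal ?K (poly_ring {1..n})"
  proof (rule ideal_poly_ringI)
    fix v p assume "v \<in> {1..n}" "p \<in> ?K"
    then show "Var v * p \<in> ?K"
      by (simp add: JgD(2) JgD(6)[of "Var v"] vars_Var_mult)
  qed (simp_all add: JgD(2,3) JgD(6)[of "Const _"] vars_add_subset vars_Const_mult)
  then have "J \<subseteq> ?K"
  proof (rule jac_ideal_least)
    fix v assume v: "v \<in> {1..n}"
    then have "restr n g (pderiv v f) \<in> Jg"
    proof (cases rule: index_cases)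
      case 3
      then show ?thesis using pderiv_in_jac_ideal[OF vars_restr_g 3] by (simp add: pderiv_restr_g)
    qed (simp_all add: pderiv_1_f pderiv_n_f JgD(2))
    then show "pderiv v f \<in> ?K" by (auto intro!: vars_pderiv_subset vars_f)
  qed
  then show ?thesis using assms by auto
qed

lemma Var_n_J: "Var n \<in> J"
  using ideal_half[OF J_ideal, of "Var n"] pderiv_in_jac_ideal[OF vars_f, of n] n by (simp add: pderiv_n_f)

lemma w_Var_1_J: "w * Var 1 \<in> J"
  using JD(5)[OF ideal_half[OF J_ideal, of "Var 1 * sq 1 (pderiv 1 F)"]] pderiv_in_jac_ideal[OF vars_f, of 1] n
  by (simp add: pderiv_1_f w_def mult_ac)

lemma vars_w: "vars w \<subseteq> {1..<n}"
  unfolding w_def by (simp, intro vars_sq vars_pderiv_subset vars_F)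

lemma subset_n: "vars p \<subseteq> {1..<n} \<Longrightarrow> vars p \<subseteq> {1..n}" "vars p \<subseteq> {1<..<n} \<Longrightarrow> vars p \<subseteq> {1..n}"
  "vars p \<subseteq> {1<..<n} \<Longrightarrow> vars p \<subseteq> {1..<n}"
  using n by force+

lemmas vars_w' = subset_n(1)[OF vars_w]

text \<open>Both \<open>w x\<^sub>1\<close> and \<open>x\<^sub>n\<close> are multiples of partial derivatives of \<open>f\<close>.\<close>
lemma w_restr:
  assumes "vars r \<subseteq> {1..n}" shows "w * (r - restr n g r) \<in> J"
  using assms
proof (induction rule: mpoly_induct_vars)
  case (add p q)
  then show ?case using JD(3)[OF add(3,4)] by (simp add: algebra_simps)
next
  case (Var_mult v p)
  show ?case using Var_mult(1)
  proof (cases rule: index_cases)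
    case 1
    have "p * (w * Var 1) \<in> J" by (rule JD(6)[OF Var_mult(2) w_Var_1_J])
    then show ?thesis using 1 by (simp add: mult_ac)
  next
    case 2
    have "(w * p) * Var n \<in> J"
      by (rule JD(6)[OF vars_mult_subset[OF vars_w' Var_mult(2)] Var_n_J])
    then show ?thesis using 2 by (simp add: mult_ac)
  next
    case 3
    have "Var v * (w * (p - restr n g p)) \<in> J" by (rule JD(6)[OF _ Var_mult(3)]) (use Var_mult(1) in simp)
    then show ?thesis using 3 by (simp add: algebra_simps)
  qed
qed (simp add: JD(2))

text \<open>Makes the product of the sector of \<open>g\<close> with itself well defined: modulo \<open>J\<close>, multiplication by \<open>w\<close>
  depends only on the restriction to the fixed locus.\<close>
lemma w_Jg:
  assumes "vars r \<subseteq> {1..n}" "restr n g r \<in> Jg" shows "w * r \<in> J"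
proof -
  let ?K = "{q. vars q \<subseteq> {1<..<n} \<and> w * q \<in> J}"
  have "ideal ?K (poly_ring {1<..<n})"
    by (rule ideal_colon[OF J_ideal]) auto
  then have "Jg \<subseteq> ?K"
  proof (rule jac_ideal_least)
    fix v assume v: "v \<in> {1<..<n}"
    have "w * pderiv v f \<in> J"
      by (rule JD(6)[OF vars_w' pderiv_in_jac_ideal[OF vars_f]]) (use v in simp)
    from JD(4)[OF this w_restr[of "pderiv v f"]]
    have "w * restr n g (pderiv v f) \<in> J"
      using vars_pderiv_subset[OF vars_f] by (simp add: algebra_simps)
    then show "pderiv v (restr n g f) \<in> ?K"
      using v vars_restr_g by (simp add: pderiv_restr_g)
  qed
  then have "w * restr n g r \<in> J" using assms(2) by auto
  from JD(3)[OF this w_restr[OF assms(1)]] show ?thesis by (simp add: algebra_simps)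
qed

text \<open>The product, a union over all representatives, equals the class computed from one pair of
  representatives as soon as this class does not depend on their choice.\<close>
lemma cup_class:
  assumes sigma: "sigma n f k h = cls (k \<otimes>\<^bsub>torus n\<^esub> h) s"
    and left: "\<And>p p' q. vars p \<subseteq> {1..n} \<Longrightarrow> vars p' \<subseteq> {1..n} \<Longrightarrow> vars q \<subseteq> {1..n} \<Longrightarrow>
      cls k p = cls k p' \<Longrightarrow>
      cls (k \<otimes>\<^bsub>torus n\<^esub> h) (p * q * s) = cls (k \<otimes>\<^bsub>torus n\<^esub> h) (p' * q * s)"
    and right: "\<And>p q q'. vars p \<subseteq> {1..n} \<Longrightarrow> vars q \<subseteq> {1..n} \<Longrightarrow> vars q' \<subseteq> {1..n} \<Longrightarrow>
      cls h q = cls h q' \<Longrightarrow>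
      cls (k \<otimes>\<^bsub>torus n\<^esub> h) (p * q * s) = cls (k \<otimes>\<^bsub>torus n\<^esub> h) (p * q' * s)"
    and p: "vars p \<subseteq> {1..n}" and q: "vars q \<subseteq> {1..n}"
  shows "cup n f k h (cls k p) (cls h q) = cls (k \<otimes>\<^bsub>torus n\<^esub> h) (p * q * s)"
proof -
  let ?kh = "k \<otimes>\<^bsub>torus n\<^esub> h"
  have "cls ?kh (p' * q') \<otimes>\<^bsub>jac_fix n f ?kh\<^esub> sigma n f k h = cls ?kh (p * q * s)"
    if "p' \<in> lifts n f k (cls k p)" "q' \<in> lifts n f h (cls h q)" for p' q'
    using that left[of p' p q'] right[of p q' q] p q by (simp add: lifts_def sigma mult_jac_fix)
  moreover have "p \<in> lifts n f k (cls k p)" "q \<in> lifts n f h (cls h q)"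
    using p q by (simp_all add: lifts_def)
  ultimately show ?thesis unfolding cup_def Let_def by blast
qed

lemma class_mult_cong:
  "cls k p = cls k p' \<Longrightarrow> cls k q = cls k q' \<Longrightarrow>
    cls k (p * q) = cls k (p' * q')"
  unfolding mult_jac_fix[symmetric] by simp

lemma class_e_imp_g:
  "vars p \<subseteq> {1..n} \<Longrightarrow> vars q \<subseteq> {1..n} \<Longrightarrow> cls e p = cls e q \<Longrightarrow>
    cls g p = cls g q"
  using restr_J[of "p - q"] by (simp only: class_e_eq_iff class_g_eq_iff)

lemma cup_e_e:
  assumes "vars p \<subseteq> {1..n}" "vars q \<subseteq> {1..n}"
  shows "cup n f e e (cls e p) (cls e q) = cls e (p * q)"
  using cup_class[of e e 1 p q, unfolded e_e mult_1_right, OF sigma_one_left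
      class_mult_cong[OF _ refl] class_mult_cong[OF refl] assms] .

lemma cup_e_g:
  assumes "vars p \<subseteq> {1..n}" "vars q \<subseteq> {1..n}"
  shows "cup n f e g (cls e p) (cls g q) = cls g (p * q)"
  using cup_class[of e g 1 p q, unfolded e_g mult_1_right, OF sigma_one_left
      class_mult_cong[OF class_e_imp_g refl] class_mult_cong[OF refl] assms] .

lemma cup_g_e:
  assumes "vars p \<subseteq> {1..n}" "vars q \<subseteq> {1..n}"
  shows "cup n f g e (cls g p) (cls e q) = cls g (p * q)"
  using cup_class[of g e 1 p q, unfolded g_e mult_1_right, OF sigma_one_right
      class_mult_cong[OF _ refl] class_mult_cong[OF refl class_e_imp_g] assms] .

lemma class_g_imp_e_w:
  assumes "vars p \<subseteq> {1..n}" "vars p' \<subseteq> {1..n}" "vars q \<subseteq> {1..n}" "cls g p = cls g p'"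
  shows "cls e (p * q * w) = cls e (p' * q * w)"
proof -
  have "w * (p - p') \<in> J"
    using assms(4) by (intro w_Jg vars_diff_subset assms) (simp only: class_g_eq_iff)
  then have "q * (w * (p - p')) \<in> J" by (rule JD(6)[OF assms(3)])
  then have "p * q * w - p' * q * w \<in> J" by (simp add: algebra_simps)
  then show ?thesis by (subst class_e_eq_iff) (intro vars_mult_subset assms vars_w')+
qed

lemma cup_g_g:
  assumes "vars p \<subseteq> {1..n}" "vars q \<subseteq> {1..n}"
  shows "cup n f g g (cls g p) (cls g q) = cls e (p * q * w)"
proof -
  have right: "cls e (p * q * w) = cls e (p * q' * w)"
    if "vars p \<subseteq> {1..n}" "vars q \<subseteq> {1..n}" "vars q' \<subseteq> {1..n}" "cls g q = cls g q'"
    for p q q'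
    using class_g_imp_e_w[OF that(2,3,1,4)] by (simp only: mult.commute[of p])
  show ?thesis
    using cup_class[of g g w p q, unfolded g_g, OF sigma_g_g[folded w_def] class_g_imp_e_w right assms] .
qed


lemma diag_subst_e [simp]: "diag_subst e p = p"
  by (simp add: diag_subst_def)

lemma diag_subst_simps [simp]: "diag_subst g (p + q) = diag_subst g p + diag_subst g q"
  "diag_subst g (p * q) = diag_subst g p * diag_subst g q" "diag_subst g (p - q) = diag_subst g p - diag_subst g q"
  "diag_subst g (Const c) = Const c" "diag_subst g 0 = 0" "diag_subst g (Var i) = Const (g i) * Var i"
  "diag_subst g (numeral k) = numeral k"
  by (simp_all add: diag_subst_def)

lemma g_apply [simp]: "g 1 = -1" "g n = -1" "i \<in> {1<..<n} \<Longrightarrow> g i = 1"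
  by (auto simp: g_def)

lemma vars_diag_subst: "vars p \<subseteq> V \<Longrightarrow> vars (diag_subst h p) \<subseteq> V"
  unfolding diag_subst_def by (intro vars_subst_subset vars_Const_mult) auto

lemma diag_subst_sq:
  assumes "vars p \<subseteq> {1..<n}" shows "diag_subst g (sq 1 p) = sq 1 p"
  unfolding diag_subst_def sq_def subst_subst
proof (rule subst_cong)
  fix v assume "v \<in> vars p"
  then show "subst (\<lambda>i. Const (g i) * Var i) ((Var(1 := (Var 1)\<^sup>2)) v) = (Var(1 := (Var 1)\<^sup>2)) v"
    using assms by (cases "v = 1") (auto simp: g_def Const_uminus)
qed

lemma diag_subst_J:
  assumes "p \<in> J" shows "diag_subst g p \<in> J"
proof -
  let ?K = "{p. vars p \<subseteq> {1..n} \<and> diag_subst g p \<in> J}"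
  have "ideal ?K (poly_ring {1..n})"
  proof (rule ideal_poly_ringI)
    fix v p assume v: "v \<in> {1..n}" and p: "p \<in> ?K"
    then have "(Const (g v) * Var v) * diag_subst g p \<in> J"
      by (intro JD(6)[OF vars_Const_mult]) simp_all
    then show "Var v * p \<in> ?K" using v p by (simp add: vars_Var_mult)
  qed (simp_all add: JD(2,3) JD(6)[of "Const _"] vars_add_subset vars_Const_mult)
  then have "J \<subseteq> ?K"
  proof (rule jac_ideal_least)
    fix v assume v: "v \<in> {1..n}"
    have "diag_subst g (pderiv v f) = (if v \<in> {1, n} then - pderiv v f else pderiv v f)"
      using v
    proof (cases rule: index_cases)
      case 3
      then show ?thesis by (simp add: pderiv_f diag_subst_sq vars_pderiv_subset[OF vars_F])
    qed (simp_all add: pderiv_1_f pderiv_n_f diag_subst_sq vars_pderiv_subset[OF vars_F] Const_uminus)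
    moreover have "pderiv v f \<in> J" by (rule pderiv_in_jac_ideal[OF vars_f v])
    ultimately show "pderiv v f \<in> ?K" using JD(1) JD(5) by auto
  qed
  then show ?thesis using assms by auto
qed

lemma restr_g_diag_subst: "restr n g (diag_subst g p) = restr n g p"
  unfolding restr_def diag_subst_def subst_subst
  by (intro arg_cong[of _ _ "\<lambda>s. subst s p"] ext) (auto simp: x_fix_def fixed_def)

text \<open>The scalar factor of the action is \<open>1\<close> in all cases, since \<open>g\<close> changes the sign of two coordinates.\<close>
lemma diag_action_class:
  assumes p: "vars p \<subseteq> {1..n}" and h: "h \<in> {e, g}" and k: "k \<in> {e, g}"
  shows "diag_action n f h k (cls k p) = cls k (diag_subst h p)"
proof -
  have one: "(\<Prod>i\<in>moved n k. inverse (h i)) = 1"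
    using h k n by (auto simp: moved_one moved_g)
  have eq: "cls k (diag_subst h p') = cls k (diag_subst h p)"
    if p': "vars p' \<subseteq> {1..n}" "cls k p' = cls k p" for p'
  proof (cases "h = e")
    case False
    then have h: "h = g" using h by simp
    show ?thesis
    proof (cases "k = e")
      case True
      then have "diag_subst g (p' - p) \<in> J"
        using p' p by (intro diag_subst_J) (simp add: class_e_eq_iff)
      then show ?thesis using True h p p' by (simp add: class_e_eq_iff vars_diag_subst)
    next
      case False
      then have "k = g" using k by simp
      then show ?thesis
        using h p' by (simp add: class_g_eq_iff restr_g_diag_subst)
    qed
  qed (use p' in simp)
  have "p \<in> lifts n f k (cls k p)" using p by (simp add: lifts_def)
  moreover have "(1::complex) \<odot>\<^bsub>jac_fix n f k\<^esub> cls k (diag_subst h p') = cls k (diag_subst h p)"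
    if "p' \<in> lifts n f k (cls k p)" for p'
    using that eq[of p'] by (simp add: lifts_def smult_jac_fix)
  ultimately show ?thesis unfolding diag_action_def one by blast
qed


subsection \<open>The homomorphism onto the invariants\<close>

abbreviation A :: "(complex, diag \<Rightarrow> nat mpoly set) module" where "A \<equiv> jac_inv n f {e, g}"

text \<open>The element \<open>[a] \<xi>\<^sub>e + [b] \<xi>\<^sub>g\<close>.\<close>
definition elem :: "nat mpoly \<Rightarrow> nat mpoly \<Rightarrow> diag \<Rightarrow> nat mpoly set" where
  "elem a b = (\<lambda>k\<in>{e, g}. cls k (if k = e then a else b))"

lemma elem_apply [simp]: "elem a b e = cls e a" "elem a b g = cls g b"
  by (simp_all add: elem_def)

lemma elem_eqI:
  assumes "u \<in> extensional {e, g}" "u e = cls e a" "u g = cls g b"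
  shows "u = elem a b"
proof
  fix k show "u k = elem a b k"
    using assms by (cases "k = e"; cases "k = g") (simp_all add: elem_def extensional_def)
qed

lemma carrier_A: "u \<in> carrier A \<longleftrightarrow> u \<in> extensional {e, g} \<and>
    u e \<in> carrier (jac_fix n f e) \<and> u g \<in> carrier (jac_fix n f g) \<and>
    (\<forall>h\<in>{e, g}. \<forall>k\<in>{e, g}. diag_action n f h k (u k) = u k)"
  by (auto simp: jac_inv_def jac_pre_def PiE_iff)

lemma elem_ops:
  assumes "vars a \<subseteq> {1..n}" "vars b \<subseteq> {1..n}" "vars c \<subseteq> {1..n}" "vars d \<subseteq> {1..n}"
  shows elem_mult: "elem a b \<otimes>\<^bsub>A\<^esub> elem c d = elem (a * c + b * d * w) (a * d + b * c)"
    and elem_add: "elem a b \<oplus>\<^bsub>A\<^esub> elem c d = elem (a + c) (b + d)"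
    and elem_smult: "r \<odot>\<^bsub>A\<^esub> elem a b = elem (Const r * a) (Const r * b)"
proof -
  have "{(x, y) \<in> {e, g} \<times> {e, g}. x \<otimes>\<^bsub>torus n\<^esub> y = e} = {(e, e), (g, g)}"
    by (auto simp: e_e e_g g_e g_g)
  moreover have "finsum (jac_fix n f e) (\<lambda>(x, y). cup n f x y (elem a b x) (elem c d y)) {(e, e), (g, g)} =
    cls e (\<Sum>x\<in>{(e, e), (g, g)}. if x = (e, e) then a * c else b * d * w)"
    by (rule finsum_class) (auto simp: cup_e_e cup_g_g assms)
  ultimately have 1: "(elem a b \<otimes>\<^bsub>A\<^esub> elem c d) e = cls e (a * c + b * d * w)"
    by (simp add: jac_inv_def jac_pre_def)
  have "{(x, y) \<in> {e, g} \<times> {e, g}. x \<otimes>\<^bsub>torus n\<^esub> y = g} = {(e, g), (g, e)}"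
    by (auto simp: e_e e_g g_e g_g)
  moreover have "finsum (jac_fix n f g) (\<lambda>(x, y). cup n f x y (elem a b x) (elem c d y)) {(e, g), (g, e)} =
    cls g (\<Sum>x\<in>{(e, g), (g, e)}. if x = (e, g) then a * d else b * c)"
    by (rule finsum_class) (auto simp: cup_e_g cup_g_e assms)
  ultimately have 2: "(elem a b \<otimes>\<^bsub>A\<^esub> elem c d) g = cls g (a * d + b * c)"
    by (simp add: jac_inv_def jac_pre_def)
  show "elem a b \<otimes>\<^bsub>A\<^esub> elem c d = elem (a * c + b * d * w) (a * d + b * c)"
    by (rule elem_eqI[OF _ 1 2]) (simp add: jac_inv_def jac_pre_def extensional_def)
  show "elem a b \<oplus>\<^bsub>A\<^esub> elem c d = elem (a + c) (b + d)"
    by (rule elem_eqI) (simp_all add: jac_inv_def jac_pre_def extensional_def add_jac_fix)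
  show "r \<odot>\<^bsub>A\<^esub> elem a b = elem (Const r * a) (Const r * b)"
    by (rule elem_eqI) (simp_all add: jac_inv_def jac_pre_def extensional_def smult_jac_fix)
qed

lemma torus_one: "\<one>\<^bsub>torus n\<^esub> = e"
  by (simp add: torus_def)

lemma xi_e: "xi n f {e, g} p e = elem p 0" and xi_g: "xi n f {e, g} p g = elem 0 p"
  by (rule elem_eqI; simp add: xi_def extensional_def zero_jac_fix)+

lemma one_A: "\<one>\<^bsub>A\<^esub> = elem 1 0"
  by (simp add: jac_inv_def jac_pre_def torus_one xi_e)

lemma zero_A: "\<zero>\<^bsub>A\<^esub> = elem 0 0"
  by (rule elem_eqI) (simp_all add: jac_inv_def jac_pre_def extensional_def zero_jac_fix)

lemma elem_eq_zero_iff: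
  assumes "vars a \<subseteq> {1..n}"
  shows "elem a b = \<zero>\<^bsub>A\<^esub> \<longleftrightarrow> a \<in> J \<and> restr n g b \<in> Jg"
proof -
  have "elem a b = elem 0 0 \<longleftrightarrow> cls e a = cls e 0 \<and> cls g b = cls g 0"
  proof
    assume eq: "elem a b = elem 0 0"
    show "cls e a = cls e 0 \<and> cls g b = cls g 0"
      using fun_cong[OF eq, of e] fun_cong[OF eq, of g] by simp
  next
    assume "cls e a = cls e 0 \<and> cls g b = cls g 0"
    then show "elem a b = elem 0 0" by (intro elem_eqI) (simp_all add: elem_def extensional_def)
  qed
  then show ?thesis using assms by (simp add: zero_A class_e_eq_iff class_g_eq_iff)
qed

definition fbar :: "nat mpoly" where "fbar = F + (Var n)\<^sup>2 * Var 1"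

abbreviation Jb :: "nat mpoly set" where "Jb \<equiv> jac_ideal {1..n} fbar"

lemma vars_fbar: "vars fbar \<subseteq> {1..n}"
  unfolding fbar_def
  by (intro vars_add_subset vars_mult_subset vars_power_subset) (use vars_F n in auto)

lemmas JbD = ideal_poly_ringD[OF ideal_jac_ideal[OF vars_fbar]]

lemma vars_dF: "vars (pderiv j F) \<subseteq> {1..<n}"
  by (rule vars_pderiv_subset[OF vars_F])

lemma pderiv_fbar:
  "pderiv 1 fbar = pderiv 1 F + (Var n)\<^sup>2" "j \<in> {1<..<n} \<Longrightarrow> pderiv j fbar = pderiv j F"
  "pderiv n fbar = 2 * Var n * Var 1"
proof -
  have "pderiv n F = 0" using vars_F by (intro pderiv_not_occurring) auto
  then show "pderiv n fbar = 2 * Var n * Var 1"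
    using n by (simp add: fbar_def pderiv_mult pderiv_power2 pderiv_Var)
qed (use n in \<open>auto simp: fbar_def pderiv_mult pderiv_power2 pderiv_Var\<close>)

text \<open>The substitution \<open>x\<^sub>n \<mapsto> - F\<^sub>1\<close>. It is applied to halved polynomials, where \<open>x\<^sub>n\<close> stands for \<open>x\<^sub>n\<^sup>2\<close>, and so
  implements the relation \<open>x\<^sub>n\<^sup>2 = - F\<^sub>1\<close>. Composed with \<open>x\<^sub>1 \<mapsto> x\<^sub>1\<^sup>2\<close> it sends \<open>x\<^sub>n\<close> to \<open>w\<close>.\<close>
definition reduce :: "nat mpoly \<Rightarrow> nat mpoly" where
  "reduce = subst (Var(n := - pderiv 1 F))"

definition lift :: "nat mpoly \<Rightarrow> nat mpoly" where
  "lift p = sq 1 (reduce p)"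

lemma reduce_simps [simp]: "reduce (p + q) = reduce p + reduce q" "reduce (p * q) = reduce p * reduce q"
  "reduce (Const c) = Const c" "reduce 0 = 0" "reduce 1 = 1" "reduce (numeral m) = numeral m"
  "reduce (Var u) = (if u = n then - pderiv 1 F else Var u)"
  by (simp_all add: reduce_def)

lemma vars_reduce: "vars p \<subseteq> {1..n} \<Longrightarrow> vars (reduce p) \<subseteq> {1..<n}"
  unfolding reduce_def
proof (rule vars_subst_subset)
  fix v assume "vars p \<subseteq> {1..n}" "v \<in> vars p"
  then have "v \<noteq> n \<Longrightarrow> v \<in> {1..<n}" by force
  then show "vars ((Var(n := - pderiv 1 F)) v) \<subseteq> {1..<n}" by (simp add: vars_dF)
qed

lemma reduce_ident: "vars p \<subseteq> {1..<n} \<Longrightarrow> reduce p = p"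
  unfolding reduce_def by (rule subst_ident) auto

lemma lift_simps [simp]: "lift (p + q) = lift p + lift q" "lift (p * q) = lift p * lift q"
  "lift (Const c) = Const c" "lift 0 = 0" "lift 1 = 1" "lift (Var n) = w" "lift (numeral m) = numeral m"
  by (simp_all add: lift_def w_def)

lemma lift_Var: "u \<noteq> n \<Longrightarrow> lift (Var u) = (if u = 1 then (Var 1)\<^sup>2 else Var u)"
  by (simp add: lift_def)

lemma vars_lift: "vars p \<subseteq> {1..n} \<Longrightarrow> vars (lift p) \<subseteq> {1..n}"
  unfolding lift_def by (rule vars_sq[OF subset_n(1)[OF vars_reduce]])

lemma diag_subst_lift: "vars p \<subseteq> {1..n} \<Longrightarrow> diag_subst g (lift p) = lift p"
  unfolding lift_def by (intro diag_subst_sq vars_reduce)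

text \<open>The substitution \<open>x\<^sub>1 \<mapsto> x\<^sub>1\<^sup>2\<close>, \<open>x\<^sub>n \<mapsto> \<xi>\<^sub>g\<close>: powers \<open>x\<^sub>n\<^bsup>2k\<^esup>\<close> go to \<open>[w\<^sup>k] \<xi>\<^sub>e\<close> and \<open>x\<^sub>n\<^bsup>2k+1\<^esup>\<close> to \<open>[w\<^sup>k] \<xi>\<^sub>g\<close>.\<close>
definition Psi :: "nat mpoly \<Rightarrow> diag \<Rightarrow> nat mpoly set" where
  "Psi p = elem (lift (halve n 0 p)) (lift (halve n (Suc 0) p))"

lemma vars_lift_halve: "vars p \<subseteq> {1..n} \<Longrightarrow> vars (lift (halve n i p)) \<subseteq> {1..n}"
  by (intro vars_lift vars_halve_subset)

lemma Psi_carrier: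
  assumes "vars p \<subseteq> {1..n}" shows "Psi p \<in> carrier A"
proof -
  have "diag_action n f h k (cls k (lift (halve n i p))) = cls k (lift (halve n i p))"
    if "h \<in> {e, g}" "k \<in> {e, g}" for h k i
  proof -
    have "diag_subst h (lift (halve n i p)) = lift (halve n i p)"
      using that(1) assms by (auto simp: diag_subst_lift vars_halve_subset)
    then show ?thesis using that assms by (simp add: diag_action_class vars_lift_halve)
  qed
  then show ?thesis
    unfolding carrier_A Psi_def by (auto simp: carrier_jac_fix elem_def)
qed

lemma Psi_hom: "Psi \<in> ring_hom (poly_ring {1..n}) A"
proof (rule ring_hom_memI)
  fix p q assume "p \<in> carrier (poly_ring {1..n})" "q \<in> carrier (poly_ring {1..n})"
  then have v: "vars p \<subseteq> {1..n}" "vars q \<subseteq> {1..n}" by simp_all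
  show "Psi p \<in> carrier A" using v by (simp add: Psi_carrier)
  show "Psi (p \<otimes>\<^bsub>poly_ring {1..n}\<^esub> q) = Psi p \<otimes>\<^bsub>A\<^esub> Psi q"
    unfolding Psi_def
    by (subst elem_mult) (simp_all add: vars_lift_halve v halve_mult mult_ac)
  show "Psi (p \<oplus>\<^bsub>poly_ring {1..n}\<^esub> q) = Psi p \<oplus>\<^bsub>A\<^esub> Psi q"
    unfolding Psi_def by (subst elem_add) (simp_all add: vars_lift_halve v)
qed (simp add: Psi_def one_A)

lemma Psi_smult: "vars p \<subseteq> {1..n} \<Longrightarrow> c \<odot>\<^bsub>A\<^esub> Psi p = Psi (Const c * p)"
  unfolding Psi_def by (subst elem_smult[where c = 0 and d = 0]) (simp_all add: vars_lift_halve)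

lemma Psi_zero: "Psi 0 = \<zero>\<^bsub>A\<^esub>"
  by (simp add: Psi_def zero_A)

lemma Psi_Var: "Psi (Var i) = (if i = 1 then xi n f {e, g} ((Var 1)\<^sup>2) \<one>\<^bsub>torus n\<^esub>
    else if i = n then xi n f {e, g} 1 g else xi n f {e, g} (Var i) \<one>\<^bsub>torus n\<^esub>)"
  using n by (auto simp: Psi_def torus_one xi_e xi_g lift_Var)


subsection \<open>The kernel is the Jacobian ideal\<close>

text \<open>The kernel is an ideal by \<open>restr_J\<close> and \<open>w_Jg\<close>, which handle multiplication by \<open>x\<^sub>n\<close>, the variable that
  exchanges the sectors. Of the generators, \<open>F\<^sub>1 + x\<^sub>n\<^sup>2\<close> is sent to \<open>- w + w\<close>, and \<open>2 x\<^sub>n x\<^sub>1\<close> to a multiple of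
  \<open>x\<^sub>1\<close> in the sector where \<open>x\<^sub>1 = 0\<close>.\<close>
lemma Psi_kills_Jb:
  assumes "p \<in> Jb" shows "lift (halve n 0 p) \<in> J \<and> restr n g (lift (halve n (Suc 0) p)) \<in> Jg"
proof -
  let ?K = "{p. vars p \<subseteq> {1..n} \<and> lift (halve n 0 p) \<in> J \<and> restr n g (lift (halve n (Suc 0) p)) \<in> Jg}"
  have "ideal ?K (poly_ring {1..n})"
  proof (rule ideal_poly_ringI)
    fix v p assume v: "v \<in> {1..n}" and p: "p \<in> ?K"
    show "Var v * p \<in> ?K"
    proof (cases "v = n")
      case True
      have "restr n g (lift (halve n 0 p)) \<in> Jg" by (rule restr_J) (use p in simp)
      moreover have "w * lift (halve n (Suc 0) p) \<in> J"
        by (rule w_Jg) (use p in \<open>simp_all add: vars_lift_halve\<close>)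
      ultimately show ?thesis using True p n by (simp add: vars_Var_mult)
    next
      case False
      have "lift (Var v) * lift (halve n 0 p) \<in> J"
        by (rule JD(6)) (use p v in \<open>simp_all add: vars_lift\<close>)
      moreover have "restr n g (lift (Var v)) * restr n g (lift (halve n (Suc 0) p)) \<in> Jg"
        by (rule JgD(6)[OF vars_restr_g]) (use p in simp)
      ultimately show ?thesis using False p v by (simp add: vars_Var_mult)
    qed
  next
    fix c p assume p: "p \<in> ?K"
    then show "Const c * p \<in> ?K"
      by (simp add: JD(6)[of "Const _"] JgD(6)[of "Const _"] vars_Const_mult)
  next
    show "p + q \<in> ?K" if "p \<in> ?K" "q \<in> ?K" for p q
      using that by (simp add: JD(3) JgD(3) vars_add_subset)
  qed (simp_all add: JD(2) JgD(2))
  then have "Jb \<subseteq> ?K"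
  proof (rule jac_ideal_least)
    fix v assume v: "v \<in> {1..n}"
    have nF: "n \<notin> vars (pderiv j F)" for j using vars_dF[of j] by auto
    have lF: "lift (pderiv j F) = sq 1 (pderiv j F)" for j
      unfolding lift_def by (simp add: reduce_ident vars_dF)
    have "lift (halve n 0 (pderiv v fbar)) \<in> J \<and> restr n g (lift (halve n (Suc 0) (pderiv v fbar))) \<in> Jg"
      using v
    proof (cases rule: index_cases)
      case 1
      have "lift (halve n 0 (pderiv 1 fbar)) = 0"
        by (simp add: pderiv_fbar halve_no_Var[OF nF] power2_eq_square lF w_def)
      moreover have "halve n (Suc 0) (pderiv 1 fbar) = 0"
        by (simp add: pderiv_fbar halve_no_Var[OF nF] power2_eq_square)
      ultimately show ?thesis using 1 by (simp add: JD(2) JgD(2))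
    next
      case 2
      have "pderiv n fbar = Var n * (Const 2 * Var 1)" by (simp add: pderiv_fbar)
      then have "lift (halve n 0 (pderiv n fbar)) = 0" "halve n (Suc 0) (pderiv n fbar) = Const 2 * Var 1"
        using n by (simp_all only: halve_Var_mult_same halve_Const_mult) simp_all
      then show ?thesis using 2 n by (simp add: JD(2) JgD(2) lift_Var)
    next
      case 3
      then have "lift (halve n 0 (pderiv v fbar)) = pderiv v f" "halve n (Suc 0) (pderiv v fbar) = 0"
        by (simp_all add: pderiv_fbar halve_no_Var[OF nF] lF pderiv_f)
      then show ?thesis using v by (simp add: JgD(2) pderiv_in_jac_ideal vars_f)
    qed
    then show "pderiv v fbar \<in> ?K" by (simp add: vars_pderiv_subset vars_fbar)
  qed
  then show ?thesis using assms by auto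
qed

lemma Jb_gens:
  shows Jb_1: "pderiv 1 F + (Var n)\<^sup>2 \<in> Jb" and Jb_n: "Var n * Var 1 \<in> Jb"
    and Jb_mid: "j \<in> {1<..<n} \<Longrightarrow> pderiv j F \<in> Jb"
proof -
  show "pderiv 1 F + (Var n)\<^sup>2 \<in> Jb" "j \<in> {1<..<n} \<Longrightarrow> pderiv j F \<in> Jb"
    using pderiv_in_jac_ideal[OF vars_fbar] n pderiv_fbar(1) pderiv_fbar(2)[of j]
    by (metis atLeastAtMost_iff less_imp_le_nat one_le_numeral order.refl order.trans greaterThanLessThan_iff)+
  show "Var n * Var 1 \<in> Jb"
    by (rule ideal_half[OF ideal_jac_ideal[OF vars_fbar]]) (use pderiv_in_jac_ideal[OF vars_fbar, of n] n in \<open>simp add: pderiv_fbar mult.assoc\<close>)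
qed

text \<open>Modulo \<open>Jb\<close>, \<open>x\<^sub>n\<^sup>2 = - F\<^sub>1\<close>.\<close>
lemma sq_reduce:
  assumes "vars p \<subseteq> {1..n}" shows "sq n p - reduce p \<in> Jb"
  using assms
proof (induction rule: mpoly_induct_vars)
  case (add p q)
  then show ?case using JbD(3)[OF add(3,4)] by (simp add: algebra_simps)
next
  case (Var_mult v p)
  have vsq: "vars (sq n p) \<subseteq> {1..n}" by (rule vars_sq[OF Var_mult(2)])
  show ?case
  proof (cases "v = n")
    case True
    have "sq n p * (pderiv 1 F + (Var n)\<^sup>2) \<in> Jb" by (rule JbD(6)[OF vsq Jb_1])
    moreover have "pderiv 1 F * (sq n p - reduce p) \<in> Jb"
      by (rule JbD(6)[OF subset_n(1)[OF vars_dF] Var_mult(3)])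
    ultimately have "sq n p * (pderiv 1 F + (Var n)\<^sup>2) - pderiv 1 F * (sq n p - reduce p) \<in> Jb"
      by (rule JbD(4))
    then show ?thesis using True by (simp add: algebra_simps)
  next
    case False
    have "Var v * (sq n p - reduce p) \<in> Jb" by (rule JbD(6)[OF _ Var_mult(3)]) (use Var_mult(1) in simp)
    then show ?thesis using False by (simp add: algebra_simps)
  qed
qed (simp add: JbD(2))

text \<open>Taking the even part in \<open>x\<^sub>1\<close> after setting \<open>x\<^sub>n = 0\<close> recovers \<open>P\<close> from its lift and maps \<open>J\<close> into \<open>Jb\<close>. The
  only generator that could fail is \<open>2 x\<^sub>1 F\<^sub>1(x\<^sub>1\<^sup>2, \<dots>)\<close>, which is odd; multiplied by \<open>x\<^sub>1\<close> it gives \<open>2 x\<^sub>1 F\<^sub>1\<close>, and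
  \<open>x\<^sub>1 F\<^sub>1 = x\<^sub>1 (F\<^sub>1 + x\<^sub>n\<^sup>2) - x\<^sub>n (x\<^sub>n x\<^sub>1)\<close>.\<close>
lemma sq_J_imp_Jb:
  assumes P: "vars P \<subseteq> {1..<n}" and "sq 1 P \<in> J" shows "P \<in> Jb"
proof -
  define E where "E i q = halve 1 i (subst (Var(n := 0)) q)" for i q
  \<comment> \<open>The odd part is included, multiplied by \<open>x\<^sub>1\<close>, to make this set closed under multiplication by \<open>x\<^sub>1\<close>.\<close>
  let ?K = "{q. vars q \<subseteq> {1..n} \<and> E 0 q \<in> Jb \<and> Var 1 * E (Suc 0) q \<in> Jb}"
  have E_mult: "E i (Var v * q) = Var v * E i q" if "v \<noteq> n" "v \<noteq> 1" for i v q
    using that by (simp add: E_def)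
  have E_1: "E 0 (Var 1 * q) = Var 1 * E (Suc 0) q" "E (Suc 0) (Var 1 * q) = E 0 q" for q
    using n by (simp_all add: E_def)
  have E_n: "E i (Var n * q) = 0" for i q by (simp add: E_def)
  have "ideal ?K (poly_ring {1..n})"
  proof (rule ideal_poly_ringI)
    fix v q assume v: "v \<in> {1..n}" and q: "q \<in> ?K"
    then show "Var v * q \<in> ?K"
    proof (cases rule: index_cases)
      case 1
      have "Var 1 * E 0 q \<in> Jb" by (rule JbD(6)) (use q n in simp_all)
      then show ?thesis using 1 q n by (simp add: E_1 vars_Var_mult)
    next
      case 2
      then show ?thesis using q n by (simp add: E_n vars_Var_mult JbD(2))
    next
      case 3
      have "Var v * E 0 q \<in> Jb" "Var v * (Var 1 * E (Suc 0) q) \<in> Jb"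
        by (rule JbD(6); use q v in simp)+
      then show ?thesis using 3 q v by (simp add: E_mult vars_Var_mult mult.left_commute)
    qed
  next
    fix c q assume q: "q \<in> ?K"
    have "Const c * E 0 q \<in> Jb" "Const c * (Var 1 * E (Suc 0) q) \<in> Jb"
      by (rule JbD(6); use q in simp)+
    then show "Const c * q \<in> ?K" using q by (simp add: E_def vars_Const_mult mult.left_commute)
  next
    show "p + q \<in> ?K" if "p \<in> ?K" "q \<in> ?K" for p q
      using that by (simp add: JbD(3) vars_add_subset E_def distrib_left)
  qed (simp_all add: JbD(2) E_def)
  then have "J \<subseteq> ?K"
  proof (rule jac_ideal_least)
    fix v assume v: "v \<in> {1..n}"
    have E_sq: "E 0 (sq 1 q) = q" "E (Suc 0) (sq 1 q) = 0" if "vars q \<subseteq> {1..<n}" for q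
    proof -
      have "subst (Var(n := 0)) (sq 1 q) = sq 1 q"
        by (rule subst_ident) (use vars_sq[OF that, of 1] in auto)
      then show "E 0 (sq 1 q) = q" "E (Suc 0) (sq 1 q) = 0" by (simp_all add: E_def)
    qed
    have E2: "E i (2 * q) = 2 * E i q" for i q
      using halve_Const_mult[of 1 i 2] by (simp add: E_def)
    have "E 0 (pderiv v f) \<in> Jb \<and> Var 1 * E (Suc 0) (pderiv v f) \<in> Jb"
      using v
    proof (cases rule: index_cases)
      case 1
      have eq: "pderiv 1 f = Var 1 * (2 * sq 1 (pderiv 1 F))" by (simp add: pderiv_1_f mult_ac)
      have "Var 1 * (pderiv 1 F + (Var n)\<^sup>2) - Var n * (Var n * Var 1) \<in> Jb"
        by (intro JbD(4) JbD(6)[OF _ Jb_1] JbD(6)[OF _ Jb_n]) (use n in simp_all)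
      then have "Var 1 * pderiv 1 F \<in> Jb" by (simp add: algebra_simps power2_eq_square)
      then have "2 * (Var 1 * pderiv 1 F) \<in> Jb" by (rule JbD(6)[rotated]) simp
      then show ?thesis unfolding 1 eq E_1 by (simp add: E2 E_sq vars_dF JbD(2) mult.left_commute)
    next
      case 2
      have eq: "pderiv n f = Var n * 2" by (simp add: pderiv_n_f)
      show ?thesis unfolding 2 eq E_n by (simp add: JbD(2))
    next
      case 3
      then show ?thesis by (simp add: pderiv_f E_sq vars_dF JbD(2) Jb_mid)
    qed
    then show "pderiv v f \<in> ?K" by (simp add: vars_pderiv_subset vars_f)
  qed
  moreover have "E 0 (sq 1 P) = P"
  proof -
    have "subst (Var(n := 0)) (sq 1 P) = sq 1 P"
      by (rule subst_ident) (use vars_sq[OF P, of 1] in auto)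
    then show ?thesis by (simp add: E_def)
  qed
  ultimately show ?thesis using assms(2) by auto
qed

text \<open>The difference is a multiple of \<open>x\<^sub>1\<close>, and \<open>x\<^sub>n x\<^sub>1\<close> lies in \<open>Jb\<close>.\<close>
lemma Var_n_restr:
  assumes "vars q \<subseteq> {1..<n}" shows "Var n * (q - restr n g q) \<in> Jb"
  using assms
proof (induction rule: mpoly_induct_vars)
  case (add p q)
  then show ?case using JbD(3)[OF add(3,4)] by (simp add: algebra_simps)
next
  case (Var_mult v p)
  show ?case
  proof (cases "v = 1")
    case True
    have "p * (Var n * Var 1) \<in> Jb" by (rule JbD(6)[OF subset_n(1)[OF Var_mult(2)] Jb_n])
    then show ?thesis using True by (simp add: mult_ac)
  next
    case False
    have "Var v * (Var n * (p - restr n g p)) \<in> Jb"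
      by (rule JbD(6)[OF _ Var_mult(3)]) (use Var_mult(1) in simp)
    then show ?thesis using False Var_mult(1) by (simp add: algebra_simps)
  qed
qed (simp add: JbD(2))

lemma restr_g_sq: "restr n g (sq 1 p) = restr n g p"
  unfolding restr_def sq_def subst_subst
  by (intro arg_cong[of _ _ "\<lambda>s. subst s p"] ext) (simp add: x_fix_def)

lemma Var_n_Jg:
  assumes "r \<in> Jg" shows "Var n * r \<in> Jb"
proof -
  let ?K = "{q. vars q \<subseteq> {1<..<n} \<and> Var n * q \<in> Jb}"
  have "ideal ?K (poly_ring {1<..<n})"
    by (rule ideal_colon[OF ideal_jac_ideal[OF vars_fbar]]) auto
  then have "Jg \<subseteq> ?K"
  proof (rule jac_ideal_least)
    fix v assume v: "v \<in> {1<..<n}"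
    have eq: "pderiv v (restr n g f) = restr n g (pderiv v F)"
      using v by (simp add: pderiv_restr_g pderiv_f restr_g_sq)
    have "Var n * pderiv v F \<in> Jb" by (rule JbD(6)[OF _ Jb_mid[OF v]]) (use n in simp)
    from JbD(4)[OF this Var_n_restr[OF vars_dF[of v]]]
    have "Var n * restr n g (pderiv v F) \<in> Jb" by (simp add: algebra_simps)
    then show "pderiv v (restr n g f) \<in> ?K" unfolding eq using vars_restr_g by simp
  qed
  then show ?thesis using assms by auto
qed

text \<open>For the converse inclusion write \<open>p = p\<^sub>0 + x\<^sub>n p\<^sub>1\<close> with \<open>p\<^sub>0, p\<^sub>1\<close> even in \<open>x\<^sub>n\<close> and replace \<open>x\<^sub>n\<^sup>2\<close> by \<open>- F\<^sub>1\<close>. The two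
  components of \<open>Psi p\<close> then put \<open>p\<^sub>0\<close> and \<open>x\<^sub>n p\<^sub>1\<close> into \<open>Jb\<close> separately.\<close>
lemma Psi_kernel:
  assumes p: "vars p \<subseteq> {1..n}" shows "Psi p = \<zero>\<^bsub>A\<^esub> \<longleftrightarrow> p \<in> Jb"
proof
  assume "p \<in> Jb"
  then show "Psi p = \<zero>\<^bsub>A\<^esub>"
    unfolding Psi_def by (subst elem_eq_zero_iff) (simp_all add: Psi_kills_Jb vars_lift_halve p)
next
  assume "Psi p = \<zero>\<^bsub>A\<^esub>"
  then have 0: "sq 1 (reduce (halve n 0 p)) \<in> J" and 1: "restr n g (sq 1 (reduce (halve n (Suc 0) p))) \<in> Jg"
    unfolding Psi_def by (simp_all add: elem_eq_zero_iff vars_lift_halve p) (simp_all add: lift_def)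
  have vh: "vars (halve n i p) \<subseteq> {1..n}" for i by (rule vars_halve_subset[OF p])
  let ?R = "reduce (halve n (Suc 0) p)"
  have "reduce (halve n 0 p) \<in> Jb" by (rule sq_J_imp_Jb[OF vars_reduce[OF vh] 0])
  from JbD(3)[OF sq_reduce[OF vh[of 0]] this] have a: "sq n (halve n 0 p) \<in> Jb" by simp
  have "Var n * restr n g ?R \<in> Jb" using Var_n_Jg[OF 1] by (simp add: restr_g_sq)
  from JbD(3)[OF this Var_n_restr[OF vars_reduce[OF vh[of "Suc 0"]]]] have "Var n * ?R \<in> Jb"
    by (simp add: algebra_simps)
  moreover have "Var n * (sq n (halve n (Suc 0) p) - ?R) \<in> Jb"
    by (rule JbD(6)[OF _ sq_reduce[OF vh]]) (use n in simp)
  ultimately have "Var n * ?R + Var n * (sq n (halve n (Suc 0) p) - ?R) \<in> Jb" by (rule JbD(3))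
  then have "Var n * sq n (halve n (Suc 0) p) \<in> Jb" by (simp add: algebra_simps)
  from JbD(3)[OF a this] show "p \<in> Jb" using halve_decomp[of p n] by simp
qed


subsection \<open>Every invariant is attained\<close>

text \<open>Modulo \<open>J\<close> the variable \<open>x\<^sub>n\<close> vanishes, and an invariant class is that of the average of \<open>p\<close> and its image
  under \<open>g\<close>, which is even in \<open>x\<^sub>1\<close>.\<close>
lemma class_e_even:
  assumes p: "vars p \<subseteq> {1..n}" and inv: "cls e (diag_subst g p) = cls e p"
  obtains P where "vars P \<subseteq> {1..<n}" "cls e (sq 1 P) = cls e p"
proof -
  define p0 where "p0 = subst (Var(n := 0)) p"
  have v0: "vars p0 \<subseteq> {1..<n}" unfolding p0_def
  proof (rule vars_subst_subset)
    fix v assume "v \<in> vars p"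
    then have "v \<noteq> n \<Longrightarrow> v \<in> {1..<n}" using p by force
    then show "vars ((Var(n := 0)) v) \<subseteq> {1..<n}" by simp
  qed
  have p0: "p - p0 \<in> J"
    using p unfolding p0_def
  proof (induction rule: mpoly_induct_vars)
    case (add p q)
    then show ?case using JD(3)[OF add(3,4)] by (simp add: algebra_simps)
  next
    case (Var_mult v p)
    show ?case
    proof (cases "v = n")
      case True
      have "p * Var n \<in> J" by (rule JD(6)[OF Var_mult(2) Var_n_J])
      then show ?thesis using True by (simp add: mult_ac)
    next
      case False
      have "Var v * (p - subst (Var(n := 0)) p) \<in> J"
        by (rule JD(6)[OF _ Var_mult(3)]) (use Var_mult(1) in simp)
      moreover have "(Var(n := 0)) v = Var v" using False by simp
      ultimately show ?thesis by (simp only: subst_mult subst_Var right_diff_distrib)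
    qed
  qed (simp add: JD(2))
  define P Q where "P = halve 1 0 p0" and "Q = halve 1 (Suc 0) p0"
  have P: "vars P \<subseteq> {1..<n}" and Q: "vars Q \<subseteq> {1..<n}"
    unfolding P_def Q_def by (intro vars_halve_subset v0)+
  have dec: "p0 = sq 1 P + Var 1 * sq 1 Q" unfolding P_def Q_def by (rule halve_decomp)
  have "diag_subst g p0 = sq 1 P - Var 1 * sq 1 Q"
    by (subst dec) (simp add: diag_subst_sq P Q Const_uminus)
  then have sum: "p0 + diag_subst g p0 = 2 * sq 1 P" using dec by simp
  have "(p - p0) + (diag_subst g (p - p0) + (p - diag_subst g p)) \<in> J"
    using inv p p0 by (intro JD(3) diag_subst_J) (simp_all add: class_e_eq_iff[symmetric] vars_diag_subst)
  also have "(p - p0) + (diag_subst g (p - p0) + (p - diag_subst g p)) = 2 * (p - sq 1 P)"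
    using sum by (simp add: algebra_simps)
  finally have "p - sq 1 P \<in> J" by (rule ideal_half[OF J_ideal])
  then have "cls e p = cls e (sq 1 P)"
    using p vars_sq[OF subset_n(1)[OF P]] by (simp add: class_e_eq_iff)
  then show ?thesis using that P by metis
qed

lemma Psi_surj: "Psi ` carrier (poly_ring {1..n}) = carrier A"
proof
  show "Psi ` carrier (poly_ring {1..n}) \<subseteq> carrier A" by (auto simp: Psi_carrier)
  show "carrier A \<subseteq> Psi ` carrier (poly_ring {1..n})"
  proof
    fix u assume u: "u \<in> carrier A"
    then obtain p r where pr: "u e = cls e p" "u g = cls g r"
      by (auto simp: carrier_A carrier_jac_fix)
    define p' r' where "p' = restr n e p" and "r' = restr n g r"
    have v: "vars p' \<subseteq> {1..n}" "vars r' \<subseteq> {1<..<n}"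
      using vars_restr[of n e p] vars_restr_g by (simp_all add: p'_def r'_def fixed_one)
    have u': "u e = cls e p'" "u g = cls g r'"
      using restr_ident[of p' n e] restr_ident[of r' n g] v pr
      by (simp_all add: class_fix_def p'_def[symmetric] r'_def[symmetric] fixed_one)
    have "diag_action n f g e (u e) = u e" using u by (simp add: carrier_A)
    then have "cls e (diag_subst g p') = cls e p'"
      using u'(1) v(1) by (simp add: diag_action_class)
    then obtain P where P: "vars P \<subseteq> {1..<n}" "cls e (sq 1 P) = cls e p'"
      using class_e_even[OF v(1)] by blast
    have nP: "n \<notin> vars P" "n \<notin> vars r'" using P v(2) by auto
    have r'sq: "sq 1 r' = r'" unfolding sq_def by (rule subst_ident) (use v(2) in auto)
    have "Psi (P + Var n * r') = elem (sq 1 P) r'"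
      using halve_no_Var[OF nP(1)] halve_no_Var[OF nP(2)]
      by (simp add: Psi_def lift_def reduce_ident P(1) subset_n(3)[OF v(2)] r'sq)
    also have "\<dots> = u"
      by (rule elem_eqI[symmetric]) (use u u' P in \<open>simp_all add: carrier_A\<close>)
    finally show "u \<in> Psi ` carrier (poly_ring {1..n})"
      using P(1) v(2) n
      by (intro image_eqI[of _ _ "P + Var n * r'"])
        (simp_all add: vars_add_subset vars_Var_mult subset_n(1) subset_n(2))
  qed
qed

theorem jac_fbar_iso:
  "\<exists>\<psi> \<in> algebra_iso complex_ring (jac {1..n} fbar) (jac_inv n f {e, g}).
    \<forall>i \<in> {1..n}. \<psi> (jac_class {1..n} fbar (Var i)) =
      (if i = 1 then xi n f {e, g} ((Var 1)\<^sup>2) \<one>\<^bsub>torus n\<^esub>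
       else if i = n then xi n f {e, g} 1 g
       else xi n f {e, g} (Var i) \<one>\<^bsub>torus n\<^esub>)"
proof -
  obtain \<psi> where "\<psi> \<in> algebra_iso complex_ring (jac {1..n} fbar) A"
    and "\<And>p. vars p \<subseteq> {1..n} \<Longrightarrow> \<psi> (jac_class {1..n} fbar p) = Psi p"
    using algebra_iso_jacI[OF vars_fbar Psi_hom Psi_surj Psi_zero Psi_smult Psi_kernel] by blast
  then show ?thesis
    by (intro bexI[of _ \<psi>] ballI) (simp_all only: Psi_Var vars_Var empty_subsetI insert_subset simp_thms)
qed

end

section \<open>The polynomials of loops with branches\<close>

lemma leaf_not_image:
  assumes "leaf I \<kappa> L v" "\<kappa> v \<noteq> v" "j \<in> I" shows "\<kappa> j \<noteq> v"
  using assms by (auto simp: leaf_def arrows_def)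

lemma generate_involution:
  assumes g: "g \<in> carrier (torus n)" and gg: "g \<otimes>\<^bsub>torus n\<^esub> g = \<one>\<^bsub>torus n\<^esub>"
  shows "generate (torus n) {g} = {\<one>\<^bsub>torus n\<^esub>, g}"
proof -
  have "group (torus n)"
  proof (rule groupI)
    fix x assume "x \<in> carrier (torus n)"
    then show "\<exists>y\<in>carrier (torus n). y \<otimes>\<^bsub>torus n\<^esub> x = \<one>\<^bsub>torus n\<^esub>"
      by (intro bexI[of _ "\<lambda>i. inverse (x i)"]) (auto simp: torus_def)
  qed (auto simp: torus_def)
  then interpret group "torus n" .
  have inv: "inv\<^bsub>torus n\<^esub> g = g" by (rule inv_equality) (use g gg in auto)
  show ?thesis
  proof
    show "generate (torus n) {g} \<subseteq> {\<one>\<^bsub>torus n\<^esub>, g}"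
    proof
      fix h assume "h \<in> generate (torus n) {g}"
      then show "h \<in> {\<one>\<^bsub>torus n\<^esub>, g}"
        by (induction rule: generate.induct) (use g gg inv in auto)
    qed
    show "{\<one>\<^bsub>torus n\<^esub>, g} \<subseteq> generate (torus n) {g}"
      by (auto intro: generate.one generate.incl)
  qed
qed

text \<open>The exponent vector of the monomial \<open>\<Prod> s \<in> S. x\<^sub>s ^ b s\<close>.\<close>
definition exponents :: "nat set \<Rightarrow> (nat \<Rightarrow> nat) \<Rightarrow> (nat \<Rightarrow>\<^sub>0 nat)" where
  "exponents S b = (\<Sum>s\<in>S. single s (b s))"

lemma lookup_exponents: "finite S \<Longrightarrow> lookup (exponents S b) s = (if s \<in> S then b s else 0)"
  by (simp add: exponents_def lookup_sum lookup_single when_def)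

lemma Var_power: "Var v ^ k = single (single v k) 1"
proof (induction k)
  case 0
  then show ?case by simp
next
  case (Suc k)
  then show ?case by (simp add: Var_def mult_single single_add[symmetric] One_nat_def)
qed

lemma prod_Var_power:
  "finite S \<Longrightarrow> (\<Prod>s\<in>S. Var s ^ b s) = single (exponents S b) 1"
  by (induction S rule: finite_induct) (simp_all add: exponents_def Var_power mult_single)

text \<open>Since all exponents are positive, the monomials of \<open>f_add\<close> have the distinct supports \<open>J \<in> A\<close>, so they
  cannot cancel and the symmetry fixes each of them.\<close>
lemma diag_symmetric_exponent_even:
  assumes "finite A" and fin: "\<And>J. J \<in> A \<Longrightarrow> finite J"
    and pos: "\<And>J s. J \<in> A \<Longrightarrow> s \<in> J \<Longrightarrow> b J s > 0" and eps: "\<And>J. J \<in> A \<Longrightarrow> \<epsilon> J \<noteq> 0"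
    and sym: "diag_subst g (f_add A b \<epsilon>) = f_add A b \<epsilon>"
    and J: "J \<in> A" "v \<in> J" and g: "g v = -1" "\<And>s. s \<in> J \<Longrightarrow> s \<noteq> v \<Longrightarrow> g s = 1"
  shows "even (b J v)"
proof -
  let ?m = "\<lambda>J. exponents J (b J)"
  have inj: "?m K = ?m J \<longleftrightarrow> K = J" if "K \<in> A" for K
  proof
    assume eq: "?m K = ?m J"
    have "s \<in> K \<longleftrightarrow> s \<in> J" for s
      using arg_cong[OF eq, of "\<lambda>m. lookup m s"] fin that J(1) pos[OF that, of s] pos[OF J(1), of s]
      by (auto simp: lookup_exponents split: if_splits)
    then show "K = J" by auto
  qed simp
  have gen: "lookup (\<Sum>K\<in>A. Const (c K) * single (?m K) 1) (?m J) = c J" for c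
  proof -
    have "lookup (\<Sum>K\<in>A. Const (c K) * single (?m K) 1) (?m J) =
      (\<Sum>K\<in>A. if K = J then c K else 0)"
      unfolding lookup_sum by (intro sum.cong refl)
        (simp add: Const_def mult_single lookup_single when_def inj)
    then show ?thesis using assms(1) J(1) by simp
  qed
  have fa: "f_add A b \<epsilon> = (\<Sum>K\<in>A. Const (\<epsilon> K) * single (?m K) 1)"
    unfolding f_add_def by (intro sum.cong refl) (simp add: prod_Var_power fin)
  have "diag_subst g (f_add A b \<epsilon>) = (\<Sum>K\<in>A. Const (\<epsilon> K) * (\<Prod>s\<in>K. (Const (g s) * Var s) ^ b K s))"
    by (simp add: diag_subst_def f_add_def)
  also have "\<dots> = (\<Sum>K\<in>A. Const (\<epsilon> K * (\<Prod>s\<in>K. g s ^ b K s)) * single (?m K) 1)"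
  proof (intro sum.cong refl)
    fix K assume "K \<in> A"
    have C: "(\<Prod>s\<in>K. Const (g s) ^ b K s) = Const (\<Prod>s\<in>K. g s ^ b K s)"
      by (simp add: Const_prod Const_power)
    show "Const (\<epsilon> K) * (\<Prod>s\<in>K. (Const (g s) * Var s) ^ b K s) =
      Const (\<epsilon> K * (\<Prod>s\<in>K. g s ^ b K s)) * single (?m K) 1"
      using fin[OF \<open>K \<in> A\<close>] by (simp add: power_mult_distrib prod.distrib C prod_Var_power Const_mult mult.assoc)
  qed
  finally have "\<epsilon> J * (\<Prod>s\<in>J. g s ^ b J s) = \<epsilon> J"
    using sym gen[of "\<lambda>K. \<epsilon> K * (\<Prod>s\<in>K. g s ^ b K s)"] gen[of \<epsilon>] fa by simp
  moreover have "(\<Prod>s\<in>J. g s ^ b J s) = (-1) ^ b J v"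
    using prod.remove[OF fin[OF J(1)] J(2), of "\<lambda>s. g s ^ b J s"] g by simp
  ultimately show ?thesis using eps[OF J(1)] by (metis mult_cancel_left mult.right_neutral neg_one_odd_power one_neq_neg_one)
qed

text \<open>A leaf has no incoming arrow, so \<open>x\<^sub>1\<close> occurs in the first part of \<open>f\<^sub>0\<close> only as \<open>x\<^sub>1\<^bsup>2 a 1\<^esup>\<close>, and that part is
  invariant. Hence the additional part is invariant too, its exponents of \<open>x\<^sub>1\<close> are even, and \<open>f\<^sub>0\<close> is a
  polynomial in \<open>x\<^sub>1\<^sup>2\<close>.\<close>
theorem proposition34:
  fixes N :: nat and \<kappa> a :: "nat \<Rightarrow> nat" and L :: "nat set" and q :: "nat \<Rightarrow> rat"
    and A :: "nat set set" and b :: "nat set \<Rightarrow> nat \<Rightarrow> nat" and \<epsilon> :: "nat set \<Rightarrow> complex"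
    and f0 f fbar :: "nat mpoly" and g :: diag and G :: "diag set"
  assumes "\<kappa> \<in> {1..N} \<rightarrow> {1..N}"
    and "loop_with_branches {1..N} \<kappa> L"
    and "leaf {1..N} \<kappa> L 1" and "\<kappa> 1 = 2"
    and "a 1 \<ge> 1" and "\<And>j. j \<in> {2..N} \<Longrightarrow> a j \<ge> 2"
    and "of_nat (2 * a 1) * q 1 + q 2 = 1"
    and "\<And>j. j \<in> {2..N} \<Longrightarrow> of_nat (a j) * q j + q (\<kappa> j) = 1"
    and "A = pointing_sets {1..N} \<kappa> L"
    and "\<And>J s. J \<in> A \<Longrightarrow> s \<in> J \<Longrightarrow> b J s > 0"
    and "\<And>J. J \<in> A \<Longrightarrow> (\<Sum>s\<in>J. of_nat (b J s) * q s) = 1"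
    and "\<And>J. J \<in> A \<Longrightarrow> \<epsilon> J \<noteq> 0"
    and "f0 = f_kappa N \<kappa> a (2 * a 1) + f_add A b \<epsilon>"
    and "nondegenerate {1..N} f0"
    and "f = f0 + Var (N + 1) ^ 2"
    and "g = (\<lambda>i. if i \<in> {1, N + 1} then -1 else 1)"
    and "G = generate (torus (N + 1)) {g}"
    and "\<And>h. h \<in> G \<Longrightarrow> diag_subst h f = f"
    and "fbar = f_kappa N \<kappa> a (a 1) + Var (N + 1) ^ 2 * Var 1
                + f_add A (\<lambda>J. (b J)(1 := b J 1 div 2)) \<epsilon>"
  shows "\<exists>\<psi> \<in> algebra_iso complex_ring (jac {1..N + 1} fbar) (jac_inv (N + 1) f G).
    \<forall>i \<in> {1..N + 1}. \<psi> (jac_class {1..N + 1} fbar (Var i)) =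
      (if i = 1 then xi (N + 1) f G (Var 1 ^ 2) \<one>\<^bsub>torus (N + 1)\<^esub>
       else if i = N + 1 then xi (N + 1) f G 1 g
       else xi (N + 1) f G (Var i) \<one>\<^bsub>torus (N + 1)\<^esub>)"
proof -
  note kappa = assms(1) and leaf = assms(3) and A = assms(9)
  have one: "1 \<in> {1..N}" using leaf by (auto simp: leaf_def)
  then have two: "2 \<in> {1..N}" using kappa assms(4) by force
  have no1: "\<kappa> j \<noteq> 1" if "j \<in> {1..N}" for j
    using leaf_not_image[OF leaf _ that] assms(4) by simp
  have J_sub: "J \<subseteq> {1..N}" if "J \<in> A" for J
    using that by (auto simp: A pointing_sets_def arrows_def)
  have fin_J: "finite J" if "J \<in> A" for J
    using J_sub[OF that] finite_subset by blast
  have fin_A: "finite A"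
    by (rule finite_subset[of _ "Pow {1..N}"]) (use J_sub in auto)
  have g1: "g 1 = -1" "g (N + 1) = -1" by (simp_all add: assms(16))
  have gi: "g i = 1" if "i \<in> {2..N}" for i
    using that by (auto simp: assms(16))

  have gT: "g \<in> carrier (torus (N + 1))" by (auto simp: torus_def assms(16))
  have "G = {\<one>\<^bsub>torus (N + 1)\<^esub>, g}"
    unfolding assms(17) by (rule generate_involution[OF gT]) (auto simp: torus_def assms(16))
  then have G: "G = {\<lambda>_. 1, g}" by (simp add: torus_def)

  have even: "even (b J 1)" if J: "J \<in> A" "1 \<in> J" for J
  proof (rule diag_symmetric_exponent_even[of A b \<epsilon> g J 1])
    have "diag_subst g f = f" using assms(18) G by simp
    moreover have "diag_subst g (f_kappa N \<kappa> a (2 * a 1)) = f_kappa N \<kappa> a (2 * a 1)"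
    proof -
      have "diag_subst g (\<Sum>j = 2..N. Var j ^ a j * Var (\<kappa> j)) = (\<Sum>j = 2..N. Var j ^ a j * Var (\<kappa> j))"
        unfolding diag_subst_def subst_sum
      proof (intro sum.cong refl)
        fix j assume j: "j \<in> {2..N}"
        then have "\<kappa> j \<in> {1..N}" "\<kappa> j \<noteq> 1" using kappa no1[of j] by auto
        then have "g (\<kappa> j) = 1" using gi[of "\<kappa> j"] by force
        then show "subst (\<lambda>i. Const (g i) * Var i) (Var j ^ a j * Var (\<kappa> j)) = Var j ^ a j * Var (\<kappa> j)"
          using gi[OF j] by simp
      qed
      then show ?thesis
        using g1 gi[of 2] two by (simp add: f_kappa_def diag_subst_def Const_uminus power_mult)
    qed
    moreover have "diag_subst g (Var (N + 1) ^ 2) = Var (N + 1) ^ 2"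
      using g1 by (simp add: diag_subst_def Const_uminus)
    ultimately show "diag_subst g (f_add A b \<epsilon>) = f_add A b \<epsilon>"
      by (simp add: assms(13,15) diag_subst_def)
    show "g s = 1" if "s \<in> J" "s \<noteq> 1" for s
      using gi[of s] J_sub[OF J(1)] that by force
  qed (use fin_A fin_J assms(10,12) J g1 in auto)

  define F where "F = f_kappa N \<kappa> a (a 1) + f_add A (\<lambda>J. (b J)(1 := b J 1 div 2)) \<epsilon>"
  have vars_F: "vars F \<subseteq> {1..<N + 1}"
  proof -
    have V: "vars (Var v ^ k :: nat mpoly) \<subseteq> {1..<N + 1}" if "v \<in> {1..N}" for v k
      using that by (intro vars_power_subset) auto
    have K: "vars (Var (\<kappa> j) :: nat mpoly) \<subseteq> {1..<N + 1}" if "j \<in> {1..N}" for j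
      using that kappa by force
    have "vars (f_kappa N \<kappa> a (a 1)) \<subseteq> {1..<N + 1}"
      unfolding f_kappa_def using one two
      by (intro vars_add_subset vars_mult_subset subset_trans[OF vars_sum] UN_least V K) auto
    moreover have "vars (\<Prod>s\<in>J. Var s ^ c s :: nat mpoly) \<subseteq> {1..<N + 1}" if "J \<in> A" for J c
      by (rule subset_trans[OF vars_prod UN_least[OF V]]) (use J_sub[OF that] in blast)
    then have "vars (f_add A c \<epsilon>) \<subseteq> {1..<N + 1}" for c
      unfolding f_add_def
      by (intro subset_trans[OF vars_sum] UN_least vars_mult_subset) simp_all
    ultimately show ?thesis unfolding F_def by (rule vars_add_subset)
  qed
  interpret square_cover "N + 1" F
    by unfold_locales (use two vars_F in auto)

  have sqF: "sq 1 F = f0"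
  proof -
    have "sq 1 (f_kappa N \<kappa> a (a 1)) = f_kappa N \<kappa> a (2 * a 1)"
    proof -
      have "sq 1 (\<Sum>j = 2..N. Var j ^ a j * Var (\<kappa> j)) = (\<Sum>j = 2..N. Var j ^ a j * Var (\<kappa> j))"
        unfolding sq_def subst_sum by (intro sum.cong refl) (use no1 in auto)
      then show ?thesis by (simp add: f_kappa_def power_mult)
    qed
    moreover have "sq 1 (f_add A (\<lambda>J. (b J)(1 := b J 1 div 2)) \<epsilon>) = f_add A b \<epsilon>"
    proof -
      have "(\<Prod>s\<in>J. (Var(1 := (Var 1)\<^sup>2)) s ^ ((b J)(1 := b J 1 div 2)) s) = (\<Prod>s\<in>J. Var s ^ b J s)"
        if "J \<in> A" for J
      proof (intro prod.cong refl)
        fix s assume "s \<in> J"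
        then show "(Var(1 := (Var 1)\<^sup>2)) s ^ ((b J)(1 := b J 1 div 2)) s = (Var s ^ b J s :: nat mpoly)"
          using even[OF that] by (auto simp: power_mult[symmetric])
      qed
      then show ?thesis unfolding f_add_def sq_def by simp
    qed
    ultimately show ?thesis by (simp add: F_def assms(13))
  qed
  have "square_cover.f (N + 1) F = f" by (simp add: f_def sqF assms(15))
  moreover have "square_cover.fbar (N + 1) F = fbar" unfolding fbar_def unfolding F_def assms(19) by (simp only: add_ac)
  moreover have "square_cover.g (N + 1) = g" by (simp add: g_def assms(16))
  ultimately show ?thesis using jac_fbar_iso by (simp only: G)
qed

end
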